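(* Let $W$ be a complex reflection group with reflection representation $\mathfrak h$, and let $H_{\mathfrak{c}}=H_{\mathfrak{c}}(W,\mathfrak h)$ be the rational Cherednik algebra (with $t=1$). Then $\mathcal{O}_{H_{\mathfrak{c}}}=\mathbb{H}(H_{\mathfrak{c}},\mathbb{C}[\mathfrak h^*])$.
   Context: The base field is $\mathbb{C}$. Let $W$ be a finite complex reflection group acting on the finite dimensional vector space $\mathfrak h$, $S\subset W$ the set of complex reflections, and $\mathfrak{c}:S\to\mathbb{C}$ a function invariant under $W$-conjugation. For $s\in S$ let $\alpha_s\in\mathfrak h^*$ be a nonzero linear form vanishing on the fixed hyperplane of $s$ in $\mathfrak h$, and $\alpha_s^\vee\in\mathfrak h$ an eigenvector of $s$ with eigenvalue different from $1$, normalized by $\langle\alpha_s,\alpha_s^\vee\rangle=2$. The rational Cherednik algebra $H_{\mathfrak{c}}(W,\mathfrak h)$ with $t=1$ is the quotient of $T(\mathfrak h\oplus\mathfrak h^* )\rtimes W$ by the relations $[x,x']=0$, $[y,y']=0$, $[y,x]=\langle x,y\rangle-\sum_{s\in S}\mathfrak{c}(s)\langle\alpha_s,y\rangle\langle x,\alpha_s^\vee\rangle s$ for $x,x'\in\mathfrak h^*$, $y,y'\in\mathfrak h$. By the PBW theorem it contains $\mathbb{C}[\mathfrak h^*]=\operatorname{Sym}\mathfrak h$ as a subalgebra. $\mathcal{O}_{H_{\mathfrak{c}}}$ is the category of finitely generated (left) $H_{\mathfrak{c}}$-modules on which $\mathbb{C}[\mathfrak h^*]$ acts locally finitely, i.e.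 $\mathbb{C}[\mathfrak h^*]v$ is finite dimensional for each vector $v$. Given an algebra $U$ and a subalgebra $\Gamma$, $\operatorname{cfs}\Gamma$ is the set of maximal two-sided ideals of $\Gamma$ of finite codimension. $\Gamma$ is quasicommutative if $\operatorname{Ext}^1_\Gamma(\mathsf{S}_{\mathfrak{m}},\mathsf{S}_{\mathfrak{n}})=0$ for distinct $\mathfrak{m},\mathfrak{n}\in\operatorname{cfs}\Gamma$, where $\mathsf{S}_{\mathfrak{m}}$ is the unique simple $\Gamma/\mathfrak{m}$-module; it is quasicentral in $U$ if $\Gamma u\Gamma$ is a finitely generated left and right $\Gamma$-module for every $u\in U$; it is a Harish-Chandra subalgebra if both hold ($\mathbb{C}[\mathfrak h^*]$ is a Harish-Chandra subalgebra of $H_{\mathfrak c}$). $\mathbb{H}(U,\Gamma)$ is the full subcategory of $U$-modules consisting of finitely generated $U$-modules $M$ such that $M=\bigoplus_{\mathfrak{n}\in\operatorname{cfs}\Gamma}M(\mathfrak{n})$, where $M(\mathfrak{n})=\{x\in M:\mathfrak{n}^{N}x=0\text{ for some }N>0\}$. *)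

theory Defs
  imports
    Complex_Main
    "HOL-Algebra.Embedded_Algebras"
    "HOL-Algebra.Free_Abelian_Groups"
    "HOL-Algebra.Generated_Rings"
    "HOL-Algebra.Ideal_Product"
    "HOL-Library.Poly_Mapping"
    "HOL-Library.Function_Algebras"
    "HOL-Library.Product_Plus"
begin

section \<open>Complex reflection groups\<close>

definition GL :: "(complex \<Rightarrow> 'v::ab_group_add \<Rightarrow> 'v) \<Rightarrow> ('v \<Rightarrow> 'v) monoid" where
  "GL scale = \<lparr>carrier = {g. Vector_Spaces.linear scale scale g \<and> bij g}, mult = (\<circ>), one = id\<rparr>"

text \<open>The condition is \<open>codim (ker (s - 1)) = 1\<close>, written additively because subtraction on
  \<^typ>\<open>nat\<close> truncates; in particular \<^term>\<open>id\<close> is never a reflection.\<close>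

definition complex_reflections ::
  "(complex \<Rightarrow> 'v::ab_group_add \<Rightarrow> 'v) \<Rightarrow> ('v \<Rightarrow> 'v) set \<Rightarrow> ('v \<Rightarrow> 'v) set" where
  "complex_reflections scale W =
     {s \<in> W. vector_space.dim scale {v. s v = v} + 1 = vector_space.dim scale UNIV}"

definition complex_reflection_group ::
  "(complex \<Rightarrow> 'v::ab_group_add \<Rightarrow> 'v) \<Rightarrow> ('v \<Rightarrow> 'v) set \<Rightarrow> bool" where
  "complex_reflection_group scale W \<longleftrightarrow>
     subgroup W (GL scale) \<and> finite W \<and> generate (GL scale) (complex_reflections scale W) = W"

definition linear_forms :: "(complex \<Rightarrow> 'v::ab_group_add \<Rightarrow> 'v) \<Rightarrow> ('v \<Rightarrow> complex) set" where
  "linear_forms scale = {f. Vector_Spaces.linear scale (*) f}"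


section \<open>Tensor algebras\<close>

text \<open>Words form a monoid under concatenation, so \<^typ>\<open>'a list \<Rightarrow>\<^sub>0 complex\<close> with the convolution
  product of \<^theory>\<open>HOL-Library.Poly_Mapping\<close> is the free complex algebra on \<^typ>\<open>'a\<close>.\<close>

instantiation list :: (type) monoid_add
begin
definition "0 = []"
definition "xs + ys = xs @ ys"
instance by standard (simp_all add: zero_list_def plus_list_def)
end

definition free_algebra :: "'a set \<Rightarrow> ('a list \<Rightarrow>\<^sub>0 complex) ring" where
  "free_algebra V =
     \<lparr>carrier = {p. Poly_Mapping.keys p \<subseteq> lists V}, mult = (*), one = 1, ring.zero = 0, add = (+)\<rparr>"

definition free_map :: "('a \<Rightarrow> 'b) \<Rightarrow> ('a list \<Rightarrow>\<^sub>0 complex) \<Rightarrow> ('b list \<Rightarrow>\<^sub>0 complex)" where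
  "free_map g p =
     (\<Sum>u \<in> Poly_Mapping.keys p. Poly_Mapping.single (map g u) (Poly_Mapping.lookup p u))"

text \<open>The tensor algebra of a complex vector space with underlying set \<open>V\<close> and scalar
  multiplication \<open>sc\<close> is the free algebra on \<open>V\<close> modulo the relations making \<open>V \<rightarrow> T(V)\<close> linear.\<close>

definition tensor_ideal ::
  "'a::ab_group_add set \<Rightarrow> (complex \<Rightarrow> 'a \<Rightarrow> 'a) \<Rightarrow> ('a list \<Rightarrow>\<^sub>0 complex) set" where
  "tensor_ideal V sc = genideal (free_algebra V)
     ({Poly_Mapping.single [v + w] 1 - Poly_Mapping.single [v] 1 - Poly_Mapping.single [w] 1
         | v w. v \<in> V \<and> w \<in> V} \<union>
      {Poly_Mapping.single [sc a v] 1 - Poly_Mapping.single [v] a | a v. v \<in> V})"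

definition tensor_algebra ::
  "'a::ab_group_add set \<Rightarrow> (complex \<Rightarrow> 'a \<Rightarrow> 'a) \<Rightarrow> ('a list \<Rightarrow>\<^sub>0 complex) set ring" where
  "tensor_algebra V sc = free_algebra V Quot tensor_ideal V sc"

definition tensor_of ::
  "'a::ab_group_add set \<Rightarrow> (complex \<Rightarrow> 'a \<Rightarrow> 'a) \<Rightarrow> 'a \<Rightarrow> ('a list \<Rightarrow>\<^sub>0 complex) set" where
  "tensor_of V sc v = tensor_ideal V sc +>\<^bsub>free_algebra V\<^esub> Poly_Mapping.single [v] 1"

definition tensor_scalar ::
  "'a::ab_group_add set \<Rightarrow> (complex \<Rightarrow> 'a \<Rightarrow> 'a) \<Rightarrow> complex \<Rightarrow> ('a list \<Rightarrow>\<^sub>0 complex) set" where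
  "tensor_scalar V sc a = tensor_ideal V sc +>\<^bsub>free_algebra V\<^esub> Poly_Mapping.single [] a"

text \<open>The endomorphism \<open>T(g)\<close> of \<open>T(V)\<close> induced by a linear map \<open>g : V \<rightarrow> V\<close>. Elements of \<open>T(V)\<close> are
  cosets; all members of the union are the same coset.\<close>

definition tensor_map ::
  "'a::ab_group_add set \<Rightarrow> (complex \<Rightarrow> 'a \<Rightarrow> 'a) \<Rightarrow> ('a \<Rightarrow> 'a) \<Rightarrow>
     ('a list \<Rightarrow>\<^sub>0 complex) set \<Rightarrow> ('a list \<Rightarrow>\<^sub>0 complex) set" where
  "tensor_map V sc g C = (\<Union>p\<in>C. tensor_ideal V sc +>\<^bsub>free_algebra V\<^esub> free_map g p)"


section \<open>Smash products\<close>

text \<open>For a finite group \<open>G\<close> acting on a ring \<open>A\<close> by automorphisms, a function \<open>f\<close> on \<open>G\<close> represents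
  \<open>\<Sum>g\<in>G. f(g) g\<close> in \<open>A \<rtimes> G\<close>, where \<open>(a g)(b h) = a (g\<cdot>b) gh\<close>.\<close>

definition smash_product ::
  "('a, 'x) ring_scheme \<Rightarrow> ('g, 'y) monoid_scheme \<Rightarrow> ('g \<Rightarrow> 'a \<Rightarrow> 'a) \<Rightarrow> ('g \<Rightarrow> 'a) ring" where
  "smash_product A G act =
     \<lparr>carrier = carrier G \<rightarrow>\<^sub>E carrier A,
      mult = (\<lambda>f f'. \<lambda>g\<in>carrier G.
        finsum A (\<lambda>h. f h \<otimes>\<^bsub>A\<^esub> act h (f' (inv\<^bsub>G\<^esub> h \<otimes>\<^bsub>G\<^esub> g))) (carrier G)),
      one = (\<lambda>g\<in>carrier G. if g = \<one>\<^bsub>G\<^esub> then \<one>\<^bsub>A\<^esub> else \<zero>\<^bsub>A\<^esub>),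
      ring.zero = (\<lambda>g\<in>carrier G. \<zero>\<^bsub>A\<^esub>),
      add = (\<lambda>f f'. \<lambda>g\<in>carrier G. f g \<oplus>\<^bsub>A\<^esub> f' g)\<rparr>"

definition smash_elem ::
  "('a, 'x) ring_scheme \<Rightarrow> ('g, 'y) monoid_scheme \<Rightarrow> 'a \<Rightarrow> 'g \<Rightarrow> ('g \<Rightarrow> 'a)" where
  "smash_elem A G a g = (\<lambda>h\<in>carrier G. if h = g then a else \<zero>\<^bsub>A\<^esub>)"


section \<open>Rational Cherednik algebras\<close>

text \<open>The space \<open>\<hh> \<oplus> \<hh>\<^sup>*\<close>, as pairs \<open>(y, x)\<close>, with the action of \<open>W\<close>
  (on \<open>\<hh>\<^sup>*\<close>, \<open>(w\<cdot>x)(y) = x (w\<inverse> y)\<close>).\<close>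

definition double_space ::
  "(complex \<Rightarrow> 'v::ab_group_add \<Rightarrow> 'v) \<Rightarrow> ('v \<times> ('v \<Rightarrow> complex)) set" where
  "double_space scale = UNIV \<times> linear_forms scale"

definition double_scale ::
  "(complex \<Rightarrow> 'v::ab_group_add \<Rightarrow> 'v) \<Rightarrow>
     complex \<Rightarrow> 'v \<times> ('v \<Rightarrow> complex) \<Rightarrow> 'v \<times> ('v \<Rightarrow> complex)" where
  "double_scale scale a = (\<lambda>(y, x). (scale a y, \<lambda>v. a * x v))"

definition double_act ::
  "(complex \<Rightarrow> 'v::ab_group_add \<Rightarrow> 'v) \<Rightarrow> ('v \<Rightarrow> 'v) \<Rightarrow>
     'v \<times> ('v \<Rightarrow> complex) \<Rightarrow> 'v \<times> ('v \<Rightarrow> complex)" where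
  "double_act scale w = (\<lambda>(y, x). (w y, x \<circ> inv\<^bsub>GL scale\<^esub> w))"

type_synonym 'v double_tensor = "(('v \<times> ('v \<Rightarrow> complex)) list \<Rightarrow>\<^sub>0 complex) set"
type_synonym 'v double_smash = "('v \<Rightarrow> 'v) \<Rightarrow> 'v double_tensor"

definition double_tensor_algebra ::
  "(complex \<Rightarrow> 'v::ab_group_add \<Rightarrow> 'v) \<Rightarrow> 'v double_tensor ring" where
  "double_tensor_algebra scale = tensor_algebra (double_space scale) (double_scale scale)"

definition double_smash_algebra ::
  "(complex \<Rightarrow> 'v::ab_group_add \<Rightarrow> 'v) \<Rightarrow> ('v \<Rightarrow> 'v) set \<Rightarrow> 'v double_smash ring" where
  "double_smash_algebra scale W =
     smash_product (double_tensor_algebra scale) (GL scale\<lparr>carrier := W\<rparr>)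
       (\<lambda>w. tensor_map (double_space scale) (double_scale scale) (double_act scale w))"

text \<open>The images in \<open>T(\<hh> \<oplus> \<hh>\<^sup>*) \<rtimes> W\<close> of a scalar, of \<open>y \<in> \<hh>\<close>, of \<open>x \<in> \<hh>\<^sup>*\<close> and of \<open>w \<in> W\<close>.\<close>

definition smash_scalar ::
  "(complex \<Rightarrow> 'v::ab_group_add \<Rightarrow> 'v) \<Rightarrow> ('v \<Rightarrow> 'v) set \<Rightarrow> complex \<Rightarrow> 'v double_smash" where
  "smash_scalar scale W a = smash_elem (double_tensor_algebra scale) (GL scale\<lparr>carrier := W\<rparr>)
     (tensor_scalar (double_space scale) (double_scale scale) a) id"

definition smash_vec ::
  "(complex \<Rightarrow> 'v::ab_group_add \<Rightarrow> 'v) \<Rightarrow> ('v \<Rightarrow> 'v) set \<Rightarrow> 'v \<Rightarrow> 'v double_smash" where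
  "smash_vec scale W y = smash_elem (double_tensor_algebra scale) (GL scale\<lparr>carrier := W\<rparr>)
     (tensor_of (double_space scale) (double_scale scale) (y, 0)) id"

definition smash_form ::
  "(complex \<Rightarrow> 'v::ab_group_add \<Rightarrow> 'v) \<Rightarrow> ('v \<Rightarrow> 'v) set \<Rightarrow> ('v \<Rightarrow> complex) \<Rightarrow> 'v double_smash" where
  "smash_form scale W x = smash_elem (double_tensor_algebra scale) (GL scale\<lparr>carrier := W\<rparr>)
     (tensor_of (double_space scale) (double_scale scale) (0, x)) id"

definition smash_group ::
  "(complex \<Rightarrow> 'v::ab_group_add \<Rightarrow> 'v) \<Rightarrow> ('v \<Rightarrow> 'v) set \<Rightarrow> ('v \<Rightarrow> 'v) \<Rightarrow> 'v double_smash" where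
  "smash_group scale W w = smash_elem (double_tensor_algebra scale) (GL scale\<lparr>carrier := W\<rparr>)
     \<one>\<^bsub>double_tensor_algebra scale\<^esub> w"

definition ring_commutator :: "('a, 'x) ring_scheme \<Rightarrow> 'a \<Rightarrow> 'a \<Rightarrow> 'a" where
  "ring_commutator R a b = (a \<otimes>\<^bsub>R\<^esub> b) \<ominus>\<^bsub>R\<^esub> (b \<otimes>\<^bsub>R\<^esub> a)"

text \<open>The arguments \<open>\<alpha> s\<close> and \<open>\<alpha>v s\<close> stand for \<open>\<alpha>\<^sub>s \<in> \<hh>\<^sup>*\<close> and \<open>\<alpha>\<^sub>s\<^sup>\<or> \<in> \<hh>\<close>; the values of \<open>c\<close>, \<open>\<alpha>\<close>,
  \<open>\<alpha>v\<close> off the set of reflections are irrelevant.\<close>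

definition cherednik_ideal ::
  "(complex \<Rightarrow> 'v::ab_group_add \<Rightarrow> 'v) \<Rightarrow> ('v \<Rightarrow> 'v) set \<Rightarrow> (('v \<Rightarrow> 'v) \<Rightarrow> complex) \<Rightarrow>
     (('v \<Rightarrow> 'v) \<Rightarrow> 'v \<Rightarrow> complex) \<Rightarrow> (('v \<Rightarrow> 'v) \<Rightarrow> 'v) \<Rightarrow> 'v double_smash set" where
  "cherednik_ideal scale W c \<alpha> \<alpha>v =
     (let A = double_smash_algebra scale W;
          X = smash_form scale W; Y = smash_vec scale W;
          k = smash_scalar scale W; g = smash_group scale W
      in genideal A
           ({ring_commutator A (X x) (X x') | x x'.
               x \<in> linear_forms scale \<and> x' \<in> linear_forms scale} \<union>
            {ring_commutator A (Y y) (Y y') | y y'. True} \<union>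
            {ring_commutator A (Y y) (X x) \<ominus>\<^bsub>A\<^esub>
               (k (x y) \<ominus>\<^bsub>A\<^esub>
                finsum A (\<lambda>s. k (c s * \<alpha> s y * x (\<alpha>v s)) \<otimes>\<^bsub>A\<^esub> g s)
                  (complex_reflections scale W))
             | x y. x \<in> linear_forms scale}))"

definition cherednik_algebra ::
  "(complex \<Rightarrow> 'v::ab_group_add \<Rightarrow> 'v) \<Rightarrow> ('v \<Rightarrow> 'v) set \<Rightarrow> (('v \<Rightarrow> 'v) \<Rightarrow> complex) \<Rightarrow>
     (('v \<Rightarrow> 'v) \<Rightarrow> 'v \<Rightarrow> complex) \<Rightarrow> (('v \<Rightarrow> 'v) \<Rightarrow> 'v) \<Rightarrow> 'v double_smash set ring" where
  "cherednik_algebra scale W c \<alpha> \<alpha>v =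
     double_smash_algebra scale W Quot cherednik_ideal scale W c \<alpha> \<alpha>v"

definition cherednik_scalar ::
  "(complex \<Rightarrow> 'v::ab_group_add \<Rightarrow> 'v) \<Rightarrow> ('v \<Rightarrow> 'v) set \<Rightarrow> (('v \<Rightarrow> 'v) \<Rightarrow> complex) \<Rightarrow>
     (('v \<Rightarrow> 'v) \<Rightarrow> 'v \<Rightarrow> complex) \<Rightarrow> (('v \<Rightarrow> 'v) \<Rightarrow> 'v) \<Rightarrow> complex \<Rightarrow> 'v double_smash set" where
  "cherednik_scalar scale W c \<alpha> \<alpha>v a =
     cherednik_ideal scale W c \<alpha> \<alpha>v +>\<^bsub>double_smash_algebra scale W\<^esub> smash_scalar scale W a"

definition cherednik_vec ::
  "(complex \<Rightarrow> 'v::ab_group_add \<Rightarrow> 'v) \<Rightarrow> ('v \<Rightarrow> 'v) set \<Rightarrow> (('v \<Rightarrow> 'v) \<Rightarrow> complex) \<Rightarrow>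
     (('v \<Rightarrow> 'v) \<Rightarrow> 'v \<Rightarrow> complex) \<Rightarrow> (('v \<Rightarrow> 'v) \<Rightarrow> 'v) \<Rightarrow> 'v \<Rightarrow> 'v double_smash set" where
  "cherednik_vec scale W c \<alpha> \<alpha>v y =
     cherednik_ideal scale W c \<alpha> \<alpha>v +>\<^bsub>double_smash_algebra scale W\<^esub> smash_vec scale W y"

text \<open>\<open>\<complex>[\<hh>\<^sup>*] = Sym \<hh>\<close>, embedded (by the PBW theorem) in the Cherednik algebra as the subalgebra
  generated by \<open>\<hh>\<close>.\<close>

definition cherednik_sym ::
  "(complex \<Rightarrow> 'v::ab_group_add \<Rightarrow> 'v) \<Rightarrow> ('v \<Rightarrow> 'v) set \<Rightarrow> (('v \<Rightarrow> 'v) \<Rightarrow> complex) \<Rightarrow>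
     (('v \<Rightarrow> 'v) \<Rightarrow> 'v \<Rightarrow> complex) \<Rightarrow> (('v \<Rightarrow> 'v) \<Rightarrow> 'v) \<Rightarrow> 'v double_smash set set" where
  "cherednik_sym scale W c \<alpha> \<alpha>v =
     generate_ring (cherednik_algebra scale W c \<alpha> \<alpha>v)
       (range (cherednik_scalar scale W c \<alpha> \<alpha>v) \<union> range (cherednik_vec scale W c \<alpha> \<alpha>v))"


section \<open>Modules over a noncommutative algebra\<close>

text \<open>The library's locale \<^locale>\<open>Module.module\<close> requires a commutative ring; the record type for
  modules is reused (its multiplication and unit are irrelevant).\<close>

locale left_module = R?: ring R + M?: abelian_group M
  for R :: "('r, 'x) ring_scheme" (structure) and M :: "('r, 'm, 'y) module_scheme" (structure) +
  assumes smult_closed: "\<lbrakk>a \<in> carrier R; x \<in> carrier M\<rbrakk> \<Longrightarrow> a \<odot>\<^bsub>M\<^esub> x \<in> carrier M"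
    and smult_l_distr: "\<lbrakk>a \<in> carrier R; b \<in> carrier R; x \<in> carrier M\<rbrakk> \<Longrightarrow>
      (a \<oplus>\<^bsub>R\<^esub> b) \<odot>\<^bsub>M\<^esub> x = a \<odot>\<^bsub>M\<^esub> x \<oplus>\<^bsub>M\<^esub> b \<odot>\<^bsub>M\<^esub> x"
    and smult_r_distr: "\<lbrakk>a \<in> carrier R; x \<in> carrier M; y \<in> carrier M\<rbrakk> \<Longrightarrow>
      a \<odot>\<^bsub>M\<^esub> (x \<oplus>\<^bsub>M\<^esub> y) = a \<odot>\<^bsub>M\<^esub> x \<oplus>\<^bsub>M\<^esub> a \<odot>\<^bsub>M\<^esub> y"
    and smult_assoc: "\<lbrakk>a \<in> carrier R; b \<in> carrier R; x \<in> carrier M\<rbrakk> \<Longrightarrow>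
      (a \<otimes>\<^bsub>R\<^esub> b) \<odot>\<^bsub>M\<^esub> x = a \<odot>\<^bsub>M\<^esub> (b \<odot>\<^bsub>M\<^esub> x)"
    and smult_one: "x \<in> carrier M \<Longrightarrow> \<one>\<^bsub>R\<^esub> \<odot>\<^bsub>M\<^esub> x = x"

text \<open>\<open>N\<close> is a finitely generated module over the subring \<open>K\<close> of the ring acting on \<open>M\<close>.\<close>

definition fin_gen :: "('r, 'm, 'x) module_scheme \<Rightarrow> 'r set \<Rightarrow> 'm set \<Rightarrow> bool" where
  "fin_gen M K N \<longleftrightarrow>
     (\<exists>B. finite B \<and> B \<subseteq> N \<and> N = {finsum M (\<lambda>b. k b \<odot>\<^bsub>M\<^esub> b) B | k. k \<in> B \<rightarrow> K})"

text \<open>Below, a complex algebra is a ring \<open>U\<close> together with its structure map \<open>\<eta> : \<complex> \<rightarrow> U\<close>; a subspace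
  of a \<open>U\<close>-module is finite dimensional iff it is finitely generated over \<open>range \<eta>\<close>. Categories
  are full subcategories of the category of left \<open>U\<close>-modules, given by their objects.\<close>

definition category_O ::
  "('r, 'x) ring_scheme \<Rightarrow> (complex \<Rightarrow> 'r) \<Rightarrow> 'r set \<Rightarrow> ('r, 'm) module set" where
  "category_O U \<eta> \<Gamma> =
     {M. left_module U M \<and> fin_gen M (carrier U) (carrier M) \<and>
         (\<forall>v\<in>carrier M. fin_gen M (range \<eta>) {a \<odot>\<^bsub>M\<^esub> v | a. a \<in> \<Gamma>})}"

definition cfs :: "('r, 'x) ring_scheme \<Rightarrow> (complex \<Rightarrow> 'r) \<Rightarrow> 'r set \<Rightarrow> 'r set set" where
  "cfs U \<eta> \<Gamma> =
     (let G = U\<lparr>carrier := \<Gamma>\<rparr>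
      in {n. maximalideal n G \<and>
             ring.finite_dimension (G Quot n) (range (\<lambda>a. n +>\<^bsub>G\<^esub> \<eta> a)) (carrier (G Quot n))})"

definition generalized_weight_space ::
  "('r, 'x) ring_scheme \<Rightarrow> 'r set \<Rightarrow> ('r, 'm, 'y) module_scheme \<Rightarrow> 'r set \<Rightarrow> 'm set" where
  "generalized_weight_space U \<Gamma> M n =
     {x \<in> carrier M. \<exists>N::nat. N > 0 \<and>
        (\<forall>a \<in> n [^]\<^bsub>ideals_set (U\<lparr>carrier := \<Gamma>\<rparr>)\<^esub> N. a \<odot>\<^bsub>M\<^esub> x = \<zero>\<^bsub>M\<^esub>)}"

text \<open>\<open>M = \<Oplus>i\<in>I. P i\<close>: the canonical map from the external direct sum is an isomorphism.\<close>

definition internal_direct_sum :: "('m, 'x) ring_scheme \<Rightarrow> 'i set \<Rightarrow> ('i \<Rightarrow> 'm set) \<Rightarrow> bool" where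
  "internal_direct_sum M I P \<longleftrightarrow>
     (\<forall>i\<in>I. subgroup (P i) (add_monoid M)) \<and>
     (\<lambda>f. gfinprod (add_monoid M) f I) \<in>
       iso (sum_group I (\<lambda>i. add_monoid M\<lparr>carrier := P i\<rparr>)) (add_monoid M)"

definition harish_chandra_modules ::
  "('r, 'x) ring_scheme \<Rightarrow> (complex \<Rightarrow> 'r) \<Rightarrow> 'r set \<Rightarrow> ('r, 'm) module set" where
  "harish_chandra_modules U \<eta> \<Gamma> =
     {M. left_module U M \<and> fin_gen M (carrier U) (carrier M) \<and>
         internal_direct_sum M (cfs U \<eta> \<Gamma>) (generalized_weight_space U \<Gamma> M)}"

end

theory Submission
  imports
    Defs
    "HOL-Computational_Algebra.Field_as_Ring"
    "HOL-Computational_Algebra.Fundamental_Theorem_Algebra"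
    "HOL-Computational_Algebra.Polynomial_Factorial"
begin

text \<open>Only two features of \<open>\<Gamma> = \<complex>[\<hh>\<^sup>*]\<close> inside \<open>H\<close> matter: it is commutative, and it is generated
  over \<open>\<complex>\<close> by finitely many elements \<open>y\<close> (a basis of \<open>\<hh>\<close>). In particular the PBW theorem plays no
  role. On a \<open>\<Gamma>\<close>-module both conditions are compared with a third one: every vector \<open>v\<close> is
  annihilated, for each generator \<open>y\<close>, by some nonzero polynomial \<open>p(y)\<close>. This is equivalent to
  \<open>dim \<Gamma>v < \<infinity>\<close>, since the powers \<open>y\<^sup>k v\<close> are then linearly dependent, and conversely the monomials of
  bounded degree in each generator span \<open>\<Gamma>v\<close>. Splitting the polynomials into linear factors, one
  generator at a time, writes \<open>v\<close> as a sum of vectors on which all \<open>y - \<lambda>\<^sub>y\<close> are nilpotent; those lie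
  in \<open>M(n)\<close> for the maximal ideal \<open>n\<close> generated by the \<open>y - \<lambda>\<^sub>y\<close>. Conversely, if \<open>\<Gamma>/n\<close> is finite
  dimensional then some \<open>p(y)\<close> lies in \<open>n\<close>, hence a power of it annihilates a given vector of \<open>M(n)\<close>.\<close>

text \<open>The sum of the M(n) is direct for two reasons: an element of \<Gamma> outside n acts
  injectively on M(n), being invertible modulo n, and finitely many vectors from other weight spaces
  are killed by one such element, since n is prime. The splitting never writes out a decomposition
  of v. It shows that v lies in every subgroup D of M containing all pieces of the wanted kind in
  \<Gamma>v; at the end D is the image of the external direct sum of the weight spaces. As relations
  among the generators of \<Gamma> are not controlled, the shifted generators may generate the unit
  ideal; a vector on which they are all nilpotent is then zero. Finite generation over H is the same
  clause in both categories, so only the action of \<Gamma> has to be compared. What remains is to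
  check that H, a quotient of a smash product over a tensor algebra, is a ring in which the images
  of \<hh> commute and depend linearly on y.\<close>

text \<open>Gaussian elimination, by induction on the equations \<open>J\<close>: an unknown
  \<open>k0\<close> with nonzero coefficient in equation \<open>j\<close> serves as pivot, and
  eliminating it removes one unknown and one equation.\<close>

lemma homogeneous_system_nontrivial_solution:
  fixes C :: "'k \<Rightarrow> 'j \<Rightarrow> complex"
  assumes "finite J" "finite K" "card J < card K"
  shows "\<exists>a. (\<exists>k\<in>K. a k \<noteq> 0) \<and> (\<forall>j\<in>J. (\<Sum>k\<in>K. a k * C k j) = 0)"
  using assms
proof (induction J arbitrary: K C rule: finite_induct)
  case empty
  then obtain k where "k \<in> K" by (metis card_gt_0_iff card.empty ex_in_conv)
  then show ?case by (intro exI[of _ "\<lambda>_. 1"]) auto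
next
  case (insert j J)
  show ?case
  proof (cases "\<forall>k\<in>K. C k j = 0")
    case True
    have "card J < card K" using insert by simp
    from insert.IH[OF insert.prems(1) this, of C] show ?thesis using True by auto
  next
    case False
    then obtain k0 where k0: "k0 \<in> K" "C k0 j \<noteq> 0" by blast
    \<comment> \<open>Row \<open>k\<close> minus the multiple of the pivot row \<open>k0\<close>
      that clears column \<open>j\<close>.\<close>
    define C' where "C' k i = C k i - C k j / C k0 j * C k0 i" for k i
    have "card J < card (K - {k0})" using insert k0 by simp
    with insert.IH[of "K - {k0}" C'] insert.prems(1) obtain a where
      a: "\<exists>k\<in>K - {k0}. a k \<noteq> 0" "\<forall>i\<in>J. (\<Sum>k\<in>K - {k0}. a k * C' k i) = 0" by blast
    define s where "s = (\<Sum>k\<in>K - {k0}. a k * (C k j / C k0 j))"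
    \<comment> \<open>Equation \<open>j\<close> forces the value at \<open>k0\<close>: with it, the
      \<open>C\<close>-combination of all rows equals the \<open>C'\<close>-combination of the rows
      other than \<open>k0\<close>.\<close>
    define b where "b = a(k0 := - s)"
    have sum_b: "(\<Sum>k\<in>K. b k * C k i) = (\<Sum>k\<in>K - {k0}. a k * C' k i)" for i
    proof -
      have "(\<Sum>k\<in>K. b k * C k i) = - s * C k0 i + (\<Sum>k\<in>K - {k0}. a k * C k i)"
        by (subst sum.remove[OF insert.prems(1) k0(1)]) (auto simp: b_def intro!: sum.cong)
      also have "\<dots> = (\<Sum>k\<in>K - {k0}. a k * C' k i)"
        by (simp add: s_def C'_def sum_distrib_left sum_subtractf algebra_simps)
      finally show ?thesis .
    qed
    have "C' k j = 0" for k using k0 by (simp add: C'_def)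
    then have "\<forall>i\<in>insert j J. (\<Sum>k\<in>K. b k * C k i) = 0" using a(2) by (simp add: sum_b)
    moreover have "\<exists>k\<in>K. b k \<noteq> 0" using a(1) by (auto simp: b_def)
    ultimately show ?thesis by blast
  qed
qed

lemma (in abelian_monoid) finsum_swap:
  assumes "finite A" "finite B" "\<And>i j. i \<in> A \<Longrightarrow> j \<in> B \<Longrightarrow> f i j \<in> carrier G"
  shows "(\<Oplus>i\<in>A. \<Oplus>j\<in>B. f i j) = (\<Oplus>j\<in>B. \<Oplus>i\<in>A. f i j)"
  using assms(1,3)
proof (induction A rule: finite_induct)
  case empty
  then show ?case by (simp add: finsum_zero)
next
  case (insert a A)
  have "(\<Oplus>i\<in>insert a A. \<Oplus>j\<in>B. f i j) = (\<Oplus>j\<in>B. f a j) \<oplus> (\<Oplus>i\<in>A. \<Oplus>j\<in>B. f i j)"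
    using insert by (intro finsum_insert) (auto intro!: finsum_closed)
  also have "\<dots> = (\<Oplus>j\<in>B. f a j) \<oplus> (\<Oplus>j\<in>B. \<Oplus>i\<in>A. f i j)" using insert by simp
  also have "\<dots> = (\<Oplus>j\<in>B. f a j \<oplus> (\<Oplus>i\<in>A. f i j))"
    using insert by (intro finsum_addf[symmetric]) (auto intro!: finsum_closed)
  also have "\<dots> = (\<Oplus>j\<in>B. \<Oplus>i\<in>insert a A. f i j)"
    using insert by (intro finsum_cong' refl) (auto intro!: finsum_insert[symmetric] finsum_closed)
  finally show ?case .
qed

context left_module
begin

lemma smult_add_hom: "a \<in> carrier R \<Longrightarrow> (\<odot>\<^bsub>M\<^esub>) a \<in> hom (add_monoid M) (add_monoid M)"
  by (auto simp: hom_def smult_closed smult_r_distr)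

lemma smult_r_null: "a \<in> carrier R \<Longrightarrow> a \<odot>\<^bsub>M\<^esub> \<zero>\<^bsub>M\<^esub> = \<zero>\<^bsub>M\<^esub>"
  using group_hom.hom_one[of "add_monoid M" "add_monoid M" "(\<odot>\<^bsub>M\<^esub>) a"] smult_add_hom
  by (simp add: group_hom_def group_hom_axioms_def M.a_group)

lemma smult_l_null: "x \<in> carrier M \<Longrightarrow> \<zero>\<^bsub>R\<^esub> \<odot>\<^bsub>M\<^esub> x = \<zero>\<^bsub>M\<^esub>"
  by (metis M.add.l_cancel_one M.zero_closed R.l_zero R.zero_closed smult_closed smult_l_distr)

lemma smult_l_minus:
  "a \<in> carrier R \<Longrightarrow> x \<in> carrier M \<Longrightarrow> (\<ominus>\<^bsub>R\<^esub> a) \<odot>\<^bsub>M\<^esub> x = \<ominus>\<^bsub>M\<^esub> (a \<odot>\<^bsub>M\<^esub> x)"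
  by (metis M.minus_equality R.a_inv_closed R.l_neg smult_closed smult_l_distr smult_l_null)

lemma smult_r_minus:
  "a \<in> carrier R \<Longrightarrow> x \<in> carrier M \<Longrightarrow> a \<odot>\<^bsub>M\<^esub> (\<ominus>\<^bsub>M\<^esub> x) = \<ominus>\<^bsub>M\<^esub> (a \<odot>\<^bsub>M\<^esub> x)"
  by (metis M.a_inv_closed M.l_neg M.minus_equality smult_closed smult_r_distr smult_r_null)

lemma smult_finsum:
  assumes "a \<in> carrier R" "f \<in> A \<rightarrow> carrier M"
  shows "a \<odot>\<^bsub>M\<^esub> finsum M f A = finsum M (\<lambda>i. a \<odot>\<^bsub>M\<^esub> f i) A"
  using assms(2)
proof (induction A rule: infinite_finite_induct)
  case (insert i A)
  then show ?case using assms(1)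
    by (subst (1 2) M.finsum_insert)
      (auto simp: Pi_iff smult_closed smult_r_distr M.finsum_closed)
qed (use assms(1) in \<open>auto simp: smult_r_null\<close>)

end

section \<open>Modules over finitely generated commutative algebras\<close>

locale cring_module = R?: cring R + left_module R M
  for R :: "('r, 'x) ring_scheme" (structure) and M :: "('r, 'm, 'y) module_scheme" (structure)
begin

lemma smult_commute:
  "\<lbrakk>a \<in> carrier R; b \<in> carrier R; x \<in> carrier M\<rbrakk> \<Longrightarrow>
    a \<odot>\<^bsub>M\<^esub> (b \<odot>\<^bsub>M\<^esub> x) = b \<odot>\<^bsub>M\<^esub> (a \<odot>\<^bsub>M\<^esub> x)"
  by (metis m_comm smult_assoc)

end

text \<open>\<open>R\<close> stands for \<Gamma> and later has \<Gamma> as its carrier. Relations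
  among the elements of \<open>Y\<close> are allowed, and \<open>R\<close> may even be the zero
  ring. The module is a parameter so that it can be replaced by a quotient of \<open>R\<close> with
  \<open>\<eta>\<close> and \<open>Y\<close> kept.\<close>

locale fg_algebra_module = cring_module R M
  for R :: "('r, 'x) ring_scheme" (structure) and M :: "('r, 'm, 'y) module_scheme" (structure) +
  fixes \<eta> :: "complex \<Rightarrow> 'r" and Y :: "'r set"
  assumes eta_closed [simp]: "\<eta> a \<in> carrier R"
    and eta_add: "\<eta> (a + b) = \<eta> a \<oplus>\<^bsub>R\<^esub> \<eta> b"
    and eta_mult: "\<eta> (a * b) = \<eta> a \<otimes>\<^bsub>R\<^esub> \<eta> b"
    and eta_one: "\<eta> 1 = \<one>\<^bsub>R\<^esub>"
    and finite_Y: "finite Y"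
    and Y_carrier: "Y \<subseteq> carrier R"
    and generated: "carrier R = generate_ring R (range \<eta> \<union> Y)"
begin

lemma eta_zero: "\<eta> 0 = \<zero>\<^bsub>R\<^esub>"
  by (metis R.add.l_cancel_one' add.left_neutral eta_add eta_closed)

lemma eta_minus: "\<eta> (- a) = \<ominus>\<^bsub>R\<^esub> \<eta> a"
  by (metis R.minus_equality add.left_inverse eta_add eta_closed eta_zero)

text \<open>The evaluation homomorphism from C[X] to \<open>R\<close> at \<open>y\<close>, where
  constants enter through \<open>\<eta>\<close>. The Horner form matches induction along
  \<open>pCons\<close>.\<close>

definition ev :: "'r \<Rightarrow> complex poly \<Rightarrow> 'r" where
  "ev y p = fold_coeffs (\<lambda>a u. \<eta> a \<oplus>\<^bsub>R\<^esub> y \<otimes>\<^bsub>R\<^esub> u) p \<zero>\<^bsub>R\<^esub>"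

lemma ev_0 [simp]: "ev y 0 = \<zero>\<^bsub>R\<^esub>"
  by (simp add: ev_def)

lemma ev_pCons: "y \<in> carrier R \<Longrightarrow> ev y (pCons a p) = \<eta> a \<oplus>\<^bsub>R\<^esub> y \<otimes>\<^bsub>R\<^esub> ev y p"
  by (cases "p = 0 \<and> a = 0") (auto simp: ev_def eta_zero fold_coeffs_pCons_coeff_not_0_eq
      fold_coeffs_pCons_not_0_0_eq)

lemma ev_closed [simp]: "y \<in> carrier R \<Longrightarrow> ev y p \<in> carrier R"
  by (induction p) (auto simp: ev_pCons)

lemma ev_add: "y \<in> carrier R \<Longrightarrow> ev y (p + q) = ev y p \<oplus>\<^bsub>R\<^esub> ev y q"
proof (induction p q rule: poly_induct2)
  case (pCons a p b q)
  then show ?case by (simp add: ev_pCons eta_add r_distr R.add.m_ac)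
qed simp

lemma ev_smult: "y \<in> carrier R \<Longrightarrow> ev y (Polynomial.smult a p) = \<eta> a \<otimes>\<^bsub>R\<^esub> ev y p"
  by (induction p) (simp_all add: ev_pCons eta_mult r_distr m_lcomm)

lemma ev_mult: "y \<in> carrier R \<Longrightarrow> ev y (p * q) = ev y p \<otimes>\<^bsub>R\<^esub> ev y q"
  by (induction p)
    (simp_all add: ev_pCons mult_pCons_left ev_add ev_smult eta_zero l_distr m_assoc)

lemma ev_1: "y \<in> carrier R \<Longrightarrow> ev y 1 = \<one>\<^bsub>R\<^esub>"
  by (simp add: one_pCons ev_pCons eta_one)

lemma ev_power: "y \<in> carrier R \<Longrightarrow> ev y (p ^ n) = ev y p [^]\<^bsub>R\<^esub> n"
  by (induction n) (simp_all add: ev_1 ev_mult m_comm)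

lemma ev_monom: "y \<in> carrier R \<Longrightarrow> ev y (Polynomial.monom a n) = \<eta> a \<otimes>\<^bsub>R\<^esub> y [^]\<^bsub>R\<^esub> n"
  by (induction n) (simp_all add: Polynomial.monom_0 Polynomial.monom_Suc ev_pCons eta_zero m_ac)

lemma ev_sum:
  "finite A \<Longrightarrow> y \<in> carrier R \<Longrightarrow> ev y (\<Sum>i\<in>A. p i) = (\<Oplus>\<^bsub>R\<^esub>i\<in>A. ev y (p i))"
  by (induction A rule: finite_induct) (simp_all add: ev_add R.finsum_insert)

lemma ev_linear: "y \<in> carrier R \<Longrightarrow> ev y [:- a, 1:] = y \<ominus>\<^bsub>R\<^esub> \<eta> a"
  by (simp add: ev_pCons eta_minus eta_one R.minus_eq R.add.m_comm)

section \<open>Torsion with respect to one generator\<close>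

definition annihilable :: "'r \<Rightarrow> 'm \<Rightarrow> bool" where
  "annihilable y x \<longleftrightarrow> (\<exists>p. p \<noteq> 0 \<and> ev y p \<odot>\<^bsub>M\<^esub> x = \<zero>\<^bsub>M\<^esub>)"

lemma annihilable_smult:
  assumes "annihilable y x" "y \<in> carrier R" "a \<in> carrier R" "x \<in> carrier M"
  shows "annihilable y (a \<odot>\<^bsub>M\<^esub> x)"
  using assms unfolding annihilable_def by (metis ev_closed smult_commute smult_r_null)

text \<open>The two summands may need different polynomials; the product kills both by commutativity
  and is nonzero because C[X] is a domain. Closure under sums is what carries annihilation from
  weight vectors to finite sums of them.\<close>

lemma subgroup_annihilable:
  assumes "y \<in> carrier R"
  shows "subgroup {x \<in> carrier M. annihilable y x} (add_monoid M)"
proof (rule group.subgroupI[OF M.a_group])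
  show "{x \<in> carrier M. annihilable y x} \<noteq> {}"
    using smult_r_null[OF ev_closed[OF assms]] by (auto simp: annihilable_def intro!: exI[of _ 1] exI[of _ "\<zero>\<^bsub>M\<^esub>"])
next
  fix x assume "x \<in> {x \<in> carrier M. annihilable y x}"
  then show "inv\<^bsub>add_monoid M\<^esub> x \<in> {x \<in> carrier M. annihilable y x}"
    using annihilable_smult[OF _ assms, of x "\<ominus>\<^bsub>R\<^esub> \<one>\<^bsub>R\<^esub>"]
    by (auto simp: smult_l_minus smult_one a_inv_def[of M, symmetric])
next
  fix x z assume "x \<in> {x \<in> carrier M. annihilable y x}" "z \<in> {x \<in> carrier M. annihilable y x}"
  then obtain p q where *: "p \<noteq> 0" "q \<noteq> 0" "ev y p \<odot>\<^bsub>M\<^esub> x = \<zero>\<^bsub>M\<^esub>" "ev y q \<odot>\<^bsub>M\<^esub> z = \<zero>\<^bsub>M\<^esub>"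
      and x: "x \<in> carrier M" and z: "z \<in> carrier M"
    by (auto simp: annihilable_def)
  have "ev y (p * q) \<odot>\<^bsub>M\<^esub> x = ev y q \<odot>\<^bsub>M\<^esub> (ev y p \<odot>\<^bsub>M\<^esub> x)"
    using assms x by (metis ev_closed ev_mult m_comm smult_assoc)
  moreover have "ev y (p * q) \<odot>\<^bsub>M\<^esub> z = ev y p \<odot>\<^bsub>M\<^esub> (ev y q \<odot>\<^bsub>M\<^esub> z)"
    using assms z by (metis ev_closed ev_mult smult_assoc)
  ultimately have "ev y (p * q) \<odot>\<^bsub>M\<^esub> (x \<oplus>\<^bsub>M\<^esub> z) = \<zero>\<^bsub>M\<^esub>"
    using * assms x z by (simp add: smult_r_distr smult_r_null)
  then show "x \<otimes>\<^bsub>add_monoid M\<^esub> z \<in> {x \<in> carrier M. annihilable y x}"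
    using * x z by (auto simp: annihilable_def intro!: exI[of _ "p * q"])
qed auto

section \<open>Complex subspaces and finite spans\<close>

definition complex_subspace :: "'m set \<Rightarrow> bool" where
  "complex_subspace E \<longleftrightarrow> subgroup E (add_monoid M) \<and> (\<forall>a. \<forall>x\<in>E. \<eta> a \<odot>\<^bsub>M\<^esub> x \<in> E)"

lemma complex_subspaceI:
  assumes "E \<subseteq> carrier M" "\<zero>\<^bsub>M\<^esub> \<in> E" "\<And>x z. x \<in> E \<Longrightarrow> z \<in> E \<Longrightarrow> x \<oplus>\<^bsub>M\<^esub> z \<in> E"
    and "\<And>a x. x \<in> E \<Longrightarrow> \<eta> a \<odot>\<^bsub>M\<^esub> x \<in> E"
  shows "complex_subspace E"
proof -
  have "inv\<^bsub>add_monoid M\<^esub> x \<in> E" if "x \<in> E" for x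
  proof -
    have "x \<in> carrier M" using that assms(1) by blast
    then have "\<ominus>\<^bsub>M\<^esub> x = \<eta> (- 1) \<odot>\<^bsub>M\<^esub> x"
      by (simp add: eta_minus eta_one smult_l_minus smult_one)
    then show ?thesis using assms(4)[OF that] by (simp add: a_inv_def)
  qed
  then have "subgroup E (add_monoid M)"
    using assms by (intro group.subgroupI[OF M.a_group]) auto
  then show ?thesis using assms(4) by (simp add: complex_subspace_def)
qed

lemma complex_subspaceD:
  assumes "complex_subspace E"
  shows "E \<subseteq> carrier M" "\<zero>\<^bsub>M\<^esub> \<in> E" "\<And>x z. x \<in> E \<Longrightarrow> z \<in> E \<Longrightarrow> x \<oplus>\<^bsub>M\<^esub> z \<in> E"
    "\<And>a x. x \<in> E \<Longrightarrow> \<eta> a \<odot>\<^bsub>M\<^esub> x \<in> E"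
  using assms subgroup.subset[of E "add_monoid M"] subgroup.one_closed[of E "add_monoid M"]
    subgroup.m_closed[of E "add_monoid M"]
  unfolding complex_subspace_def by auto

text \<open>Meant for finite \<open>B\<close>: over an infinite set \<open>finsum\<close> defaults
  to zero, and the formula gives only the zero subspace.\<close>

definition complex_span :: "'m set \<Rightarrow> 'm set" where
  "complex_span B = {finsum M (\<lambda>b. \<eta> (k b) \<odot>\<^bsub>M\<^esub> b) B | k. True}"

lemma complex_spanI: "finsum M (\<lambda>b. \<eta> (k b) \<odot>\<^bsub>M\<^esub> b) B \<in> complex_span B"
  by (auto simp: complex_span_def)

lemma complex_spanE:
  assumes "x \<in> complex_span B"
  obtains k where "x = finsum M (\<lambda>b. \<eta> (k b) \<odot>\<^bsub>M\<^esub> b) B"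
  using assms unfolding complex_span_def by (elim CollectE exE conjE)

text \<open>Choosing preimages under \<open>\<eta>\<close> turns coefficients in the ring into
  complex numbers, the form in which linear systems can be solved. The preimages are chosen because
  \<open>\<eta>\<close> may fail to be injective.\<close>

lemma fin_gen_iff:
  "fin_gen M (range \<eta>) N \<longleftrightarrow> (\<exists>B. finite B \<and> B \<subseteq> N \<and> N = complex_span B)"
  if N: "N \<subseteq> carrier M"
proof -
  have "{finsum M (\<lambda>b. k b \<odot>\<^bsub>M\<^esub> b) B | k. k \<in> B \<rightarrow> range \<eta>} = complex_span B" (is "?L = _") if B: "B \<subseteq> N" for B
  proof
    show "complex_span B \<subseteq> ?L"
    proof
      fix x assume "x \<in> complex_span B"
      then obtain k where k: "x = finsum M (\<lambda>b. \<eta> (k b) \<odot>\<^bsub>M\<^esub> b) B" by (rule complex_spanE)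
      show "x \<in> ?L"
        by (rule CollectI, rule exI[of _ "\<lambda>b. \<eta> (k b)"]) (simp add: k)
    qed
  next
    show "?L \<subseteq> complex_span B"
    proof
      fix x assume "x \<in> ?L"
      then obtain k where k: "k \<in> B \<rightarrow> range \<eta>" and x: "x = finsum M (\<lambda>b. k b \<odot>\<^bsub>M\<^esub> b) B"
        by (elim CollectE exE conjE)
      have "\<forall>b\<in>B. \<exists>a. k b = \<eta> a" using k by blast
      then obtain a where a: "\<forall>b\<in>B. k b = \<eta> (a b)" by (rule bchoice[THEN exE])
      have "x = finsum M (\<lambda>b. \<eta> (a b) \<odot>\<^bsub>M\<^esub> b) B" unfolding x
      proof (rule M.finsum_cong'[OF refl])
        show "(\<lambda>b. \<eta> (a b) \<odot>\<^bsub>M\<^esub> b) \<in> B \<rightarrow> carrier M"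
          using B N by (meson Pi_I eta_closed smult_closed subsetD)
      qed (simp add: a)
      then show "x \<in> complex_span B" using complex_spanI[of a B] by (simp only:)
    qed
  qed
  then show ?thesis unfolding fin_gen_def by (intro iff_exI conj_cong refl) (simp only:)
qed

lemma finsum_in_subgroup:
  assumes "subgroup D (add_monoid M)" "f \<in> A \<rightarrow> D"
  shows "finsum M f A \<in> D"
proof -
  have D: "D \<subseteq> carrier M" using subgroup.subset[OF assms(1)] by simp
  show ?thesis using assms(2)
  proof (induction A rule: infinite_finite_induct)
    case (infinite A)
    then show ?case using subgroup.one_closed[OF assms(1)] by simp
  next
    case empty
    then show ?case using subgroup.one_closed[OF assms(1)] by simp
  next
    case (insert a A)
    then have "finsum M f (insert a A) = f a \<oplus>\<^bsub>M\<^esub> finsum M f A"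
      using D by (intro M.finsum_insert) auto
    then show ?case using insert subgroup.m_closed[OF assms(1)] by auto
  qed
qed

lemma complex_span_minimal:
  assumes "complex_subspace E" "B \<subseteq> E"
  shows "complex_span B \<subseteq> E"
proof
  fix x assume "x \<in> complex_span B"
  then obtain k where k: "x = finsum M (\<lambda>b. \<eta> (k b) \<odot>\<^bsub>M\<^esub> b) B" by (rule complex_spanE)
  show "x \<in> E" unfolding k
  proof (rule finsum_in_subgroup)
    show "subgroup E (add_monoid M)" using assms(1) by (simp add: complex_subspace_def)
    show "(\<lambda>b. \<eta> (k b) \<odot>\<^bsub>M\<^esub> b) \<in> B \<rightarrow> E"
      using assms(2) complex_subspaceD(4)[OF assms(1)] by blast
  qed
qed

lemma complex_subspace_span:
  assumes "finite B" "B \<subseteq> carrier M"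
  shows "complex_subspace (complex_span B)"
proof (rule complex_subspaceI)
  have b: "b \<in> carrier M" if "b \<in> B" for b using that assms(2) by blast
  have cl: "(\<lambda>b. \<eta> (k b) \<odot>\<^bsub>M\<^esub> b) \<in> B \<rightarrow> carrier M" for k
    by (simp add: b smult_closed)
  show "complex_span B \<subseteq> carrier M"
  proof
    fix x assume "x \<in> complex_span B"
    then obtain k where "x = finsum M (\<lambda>b. \<eta> (k b) \<odot>\<^bsub>M\<^esub> b) B" by (rule complex_spanE)
    then show "x \<in> carrier M" using M.finsum_closed[OF cl[of k]] by simp
  qed
  have "finsum M (\<lambda>b. \<eta> 0 \<odot>\<^bsub>M\<^esub> b) B = \<zero>\<^bsub>M\<^esub>"
    by (rule M.add.finprod_one_eqI) (simp add: b eta_zero smult_l_null)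
  then show "\<zero>\<^bsub>M\<^esub> \<in> complex_span B" using complex_spanI[of "\<lambda>_. 0" B] by (simp only:)
  show "x \<oplus>\<^bsub>M\<^esub> z \<in> complex_span B" if x: "x \<in> complex_span B" and z: "z \<in> complex_span B" for x z
  proof -
    obtain k where k: "x = finsum M (\<lambda>b. \<eta> (k b) \<odot>\<^bsub>M\<^esub> b) B"
      using x by (rule complex_spanE)
    obtain l where l: "z = finsum M (\<lambda>b. \<eta> (l b) \<odot>\<^bsub>M\<^esub> b) B"
      using z by (rule complex_spanE)
    have "x \<oplus>\<^bsub>M\<^esub> z = finsum M (\<lambda>b. \<eta> (k b) \<odot>\<^bsub>M\<^esub> b \<oplus>\<^bsub>M\<^esub> \<eta> (l b) \<odot>\<^bsub>M\<^esub> b) B"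
      unfolding k l by (rule M.finsum_addf[OF cl cl, symmetric])
    also have "\<dots> = finsum M (\<lambda>b. \<eta> (k b + l b) \<odot>\<^bsub>M\<^esub> b) B"
      by (rule M.finsum_cong'[OF refl cl]) (simp add: b eta_add smult_l_distr)
    finally show ?thesis using complex_spanI[of "\<lambda>b. k b + l b" B] by (simp only:)
  qed
  show "\<eta> a \<odot>\<^bsub>M\<^esub> x \<in> complex_span B" if x: "x \<in> complex_span B" for a x
  proof -
    obtain k where k: "x = finsum M (\<lambda>b. \<eta> (k b) \<odot>\<^bsub>M\<^esub> b) B"
      using x by (rule complex_spanE)
    have "\<eta> a \<odot>\<^bsub>M\<^esub> x = finsum M (\<lambda>b. \<eta> a \<odot>\<^bsub>M\<^esub> (\<eta> (k b) \<odot>\<^bsub>M\<^esub> b)) B"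
      unfolding k by (rule smult_finsum[OF eta_closed cl])
    also have "\<dots> = finsum M (\<lambda>b. \<eta> (a * k b) \<odot>\<^bsub>M\<^esub> b) B"
      by (rule M.finsum_cong'[OF refl cl]) (simp add: b eta_mult smult_assoc)
    finally show ?thesis using complex_spanI[of "\<lambda>b. a * k b" B] by (simp only:)
  qed
qed

lemma complex_span_superset:
  assumes "finite B" "B \<subseteq> carrier M"
  shows "B \<subseteq> complex_span B"
proof
  fix b assume b: "b \<in> B"
  have "finsum M (\<lambda>c. \<eta> (if c = b then 1 else 0) \<odot>\<^bsub>M\<^esub> c) B
      = finsum M (\<lambda>c. if b = c then c else \<zero>\<^bsub>M\<^esub>) B"
  proof (rule M.finsum_cong'[OF refl])
    show "(\<lambda>c. if b = c then c else \<zero>\<^bsub>M\<^esub>) \<in> B \<rightarrow> carrier M" using assms(2) by auto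
    show "\<eta> (if c = b then 1 else 0) \<odot>\<^bsub>M\<^esub> c = (if b = c then c else \<zero>\<^bsub>M\<^esub>)" if "c \<in> B" for c
      using that assms(2) by (auto simp: eta_one eta_zero smult_one smult_l_null)
  qed
  also have "\<dots> = b"
    using assms b by (intro M.finsum_singleton) auto
  finally have "b = finsum M (\<lambda>c. \<eta> (if c = b then 1 else 0) \<odot>\<^bsub>M\<^esub> c) B" by simp
  with complex_spanI[of "\<lambda>c. if c = b then 1 else 0" B] show "b \<in> complex_span B" by (simp only:)
qed

section \<open>Finite dimension versus annihilating polynomials\<close>

text \<open>A linear dependence among the coefficient vectors of \<open>card J + 1\<close> powers
  gives the coefficients of the polynomial; interchanging the two sums shows that it kills
  \<open>x\<close>. The spanning vectors are a family indexed by \<open>J\<close> so that the lemma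
  applies both to a finite spanning set in \<open>M\<close> and to a numbered spanning family of a
  quotient of \<open>R\<close>.\<close>

lemma annihilable_of_powers_spanned:
  assumes y: "y \<in> carrier R" and x: "x \<in> carrier M"
    and J: "finite J" "b \<in> J \<rightarrow> carrier M"
    and sp: "\<And>k::nat. y [^]\<^bsub>R\<^esub> k \<odot>\<^bsub>M\<^esub> x = finsum M (\<lambda>j. \<eta> (C k j) \<odot>\<^bsub>M\<^esub> b j) J"
  shows "annihilable y x"
proof -
  \<comment> \<open>\<open>{..card J}\<close> has \<open>card J + 1\<close> elements, one more than
    there are equations.\<close>
  obtain a where a: "\<exists>k\<in>{..card J}. a k \<noteq> 0" "\<forall>j\<in>J. (\<Sum>k\<in>{..card J}. a k * C k j) = 0"
    using homogeneous_system_nontrivial_solution[OF J(1), of "{..card J}" C] by auto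
  define p where "p = (\<Sum>k\<le>card J. Polynomial.monom (a k) k)"
  obtain k where k: "k \<le> card J" "a k \<noteq> 0" using a(1) by blast
  then have "Polynomial.coeff p k = a k" by (simp add: p_def coeff_sum)
  with k(2) have "p \<noteq> 0" by auto
  have bj: "b j \<in> carrier M" if "j \<in> J" for j using J(2) that by auto
  have eta_sum: "finsum M (\<lambda>k. \<eta> (f k) \<odot>\<^bsub>M\<^esub> z) A = \<eta> (sum f A) \<odot>\<^bsub>M\<^esub> z"
    if "z \<in> carrier M" "finite A" for z f and A :: "nat set"
    using that(2)
  proof (induction A rule: finite_induct)
    case (insert i A)
    then show ?case using that(1)
      by (subst M.finsum_insert) (auto simp: eta_add smult_l_distr intro!: smult_closed)
  qed (use that in \<open>simp add: eta_zero smult_l_null\<close>)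
  have smult_fin: "finsum R g A \<odot>\<^bsub>M\<^esub> z = finsum M (\<lambda>k. g k \<odot>\<^bsub>M\<^esub> z) A"
    if "z \<in> carrier M" "finite A" "g \<in> A \<rightarrow> carrier R" for z g and A :: "nat set"
    using that(2,3)
  proof (induction A rule: finite_induct)
    case (insert i A)
    then show ?case using that(1)
      by (subst M.finsum_insert) (auto simp: smult_l_distr intro!: smult_closed)
  qed (use that in \<open>simp add: smult_l_null\<close>)
  have "ev y p = finsum R (\<lambda>k. \<eta> (a k) \<otimes>\<^bsub>R\<^esub> y [^]\<^bsub>R\<^esub> k) {..card J}"
    using y by (simp add: p_def ev_sum ev_monom)
  then have "ev y p \<odot>\<^bsub>M\<^esub> x = finsum R (\<lambda>k. \<eta> (a k) \<otimes>\<^bsub>R\<^esub> y [^]\<^bsub>R\<^esub> k) {..card J} \<odot>\<^bsub>M\<^esub> x"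
    by (rule arg_cong)
  also have "\<dots> = finsum M (\<lambda>k. (\<eta> (a k) \<otimes>\<^bsub>R\<^esub> y [^]\<^bsub>R\<^esub> k) \<odot>\<^bsub>M\<^esub> x) {..card J}"
    using x y by (intro smult_fin) auto
  also have "\<dots> = finsum M (\<lambda>k. finsum M (\<lambda>j. \<eta> (a k * C k j) \<odot>\<^bsub>M\<^esub> b j) J) {..card J}"
  proof (intro M.finsum_cong' refl)
    fix k assume "k \<in> {..card J}"
    have "(\<eta> (a k) \<otimes>\<^bsub>R\<^esub> y [^]\<^bsub>R\<^esub> k) \<odot>\<^bsub>M\<^esub> x = \<eta> (a k) \<odot>\<^bsub>M\<^esub> finsum M (\<lambda>j. \<eta> (C k j) \<odot>\<^bsub>M\<^esub> b j) J"
      using x y by (simp add: smult_assoc sp)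
    also have "\<dots> = finsum M (\<lambda>j. \<eta> (a k) \<odot>\<^bsub>M\<^esub> (\<eta> (C k j) \<odot>\<^bsub>M\<^esub> b j)) J"
      using bj by (intro smult_finsum) (auto intro!: smult_closed)
    also have "\<dots> = finsum M (\<lambda>j. \<eta> (a k * C k j) \<odot>\<^bsub>M\<^esub> b j) J"
      using bj by (intro M.finsum_cong') (auto simp: eta_mult smult_assoc intro!: smult_closed)
    finally show "(\<eta> (a k) \<otimes>\<^bsub>R\<^esub> y [^]\<^bsub>R\<^esub> k) \<odot>\<^bsub>M\<^esub> x = finsum M (\<lambda>j. \<eta> (a k * C k j) \<odot>\<^bsub>M\<^esub> b j) J" .
  qed (use bj in \<open>auto intro!: M.finsum_closed smult_closed\<close>)
  also have "\<dots> = finsum M (\<lambda>j. finsum M (\<lambda>k. \<eta> (a k * C k j) \<odot>\<^bsub>M\<^esub> b j) {..card J}) J"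
    using bj J by (intro M.finsum_swap) (auto intro!: smult_closed)
  also have "\<dots> = finsum M (\<lambda>j. \<zero>\<^bsub>M\<^esub>) J"
    using bj a(2) by (intro M.finsum_cong') (auto simp: eta_sum eta_zero smult_l_null)
  also have "\<dots> = \<zero>\<^bsub>M\<^esub>" by simp
  finally show ?thesis using \<open>p \<noteq> 0\<close> by (auto simp: annihilable_def)
qed

lemma annihilable_of_fin_gen:
  assumes y: "y \<in> carrier R" and x: "x \<in> carrier M"
    and fg: "fin_gen M (range \<eta>) {a \<odot>\<^bsub>M\<^esub> x | a. a \<in> carrier R}"
  shows "annihilable y x"
proof -
  have sub: "{a \<odot>\<^bsub>M\<^esub> x | a. a \<in> carrier R} \<subseteq> carrier M" using x by (auto intro!: smult_closed)
  obtain B where B: "finite B" "B \<subseteq> carrier M" and eq: "{a \<odot>\<^bsub>M\<^esub> x | a. a \<in> carrier R} = complex_span B"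
    using fg sub unfolding fin_gen_iff[OF sub] by (metis (no_types, lifting) order_trans)
  have "y [^]\<^bsub>R\<^esub> k \<odot>\<^bsub>M\<^esub> x \<in> complex_span B" for k :: nat
    unfolding eq[symmetric] using y by blast
  then have "\<forall>k::nat. \<exists>C. y [^]\<^bsub>R\<^esub> k \<odot>\<^bsub>M\<^esub> x = finsum M (\<lambda>b. \<eta> (C b) \<odot>\<^bsub>M\<^esub> b) B"
    by (auto elim!: complex_spanE)
  then obtain C where "y [^]\<^bsub>R\<^esub> k \<odot>\<^bsub>M\<^esub> x = finsum M (\<lambda>b. \<eta> (C k b) \<odot>\<^bsub>M\<^esub> b) B" for k :: nat
    by metis
  then show ?thesis
    using annihilable_of_powers_spanned[OF y x B(1), of "\<lambda>b. b" C] B(2) by auto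
qed

text \<open>Horner's rule moves one factor \<open>y\<close> from the polynomial to the vector, so
  the induction replaces \<open>z\<close> by \<open>y z\<close> and \<open>d\<close> by
  \<open>d - 1\<close>.\<close>

lemma ev_smult_in_subspace:
  assumes "complex_subspace E" "y \<in> carrier R" "z \<in> carrier M"
    and "\<And>k::nat. k < d \<Longrightarrow> y [^]\<^bsub>R\<^esub> k \<odot>\<^bsub>M\<^esub> z \<in> E" "degree p < d"
  shows "ev y p \<odot>\<^bsub>M\<^esub> z \<in> E"
  using assms(3-5)
proof (induction p arbitrary: z d)
  case 0
  then show ?case using complex_subspaceD(2)[OF assms(1)] by (simp add: smult_l_null)
next
  case (pCons a p)
  have z: "z \<in> E" using pCons.prems(2)[of 0] pCons.prems by (simp add: smult_one)
  have "ev y p \<odot>\<^bsub>M\<^esub> (y \<odot>\<^bsub>M\<^esub> z) \<in> E"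
  proof (cases "p = 0")
    case True
    then show ?thesis
      using complex_subspaceD(2)[OF assms(1)] assms(2) pCons.prems by (simp add: smult_l_null smult_closed)
  next
    case False
    then have "degree p < d - 1" using pCons.prems by simp
    moreover have "y [^]\<^bsub>R\<^esub> k \<odot>\<^bsub>M\<^esub> (y \<odot>\<^bsub>M\<^esub> z) \<in> E" if "k < d - 1" for k :: nat
      using pCons.prems(2)[of "Suc k"] that assms(2) pCons.prems(1) by (simp add: smult_assoc)
    ultimately show ?thesis using pCons.IH[of "y \<odot>\<^bsub>M\<^esub> z" "d - 1"] assms(2) pCons.prems(1) by (simp add: smult_closed)
  qed
  moreover have "ev y (pCons a p) \<odot>\<^bsub>M\<^esub> z = \<eta> a \<odot>\<^bsub>M\<^esub> z \<oplus>\<^bsub>M\<^esub> ev y p \<odot>\<^bsub>M\<^esub> (y \<odot>\<^bsub>M\<^esub> z)"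
    using assms(2) pCons.prems(1)
    by (simp add: ev_pCons smult_l_distr smult_assoc smult_commute[of y "ev y p"])
  ultimately show ?case using complex_subspaceD(3,4)[OF assms(1)] z by simp
qed

text \<open>Solving a monic annihilating polynomial for its top power rewrites that power through
  lower ones. By commutativity the same \<open>q\<close> works on all multiples of \<open>x\<close>,
  and this is where the spanning vectors built from it will lie.\<close>

lemma annihilable_power_reduction:
  assumes "annihilable y x" "y \<in> carrier R" "x \<in> carrier M"
  obtains d q where "d > 0" "degree q < d"
    "\<And>a. a \<in> carrier R \<Longrightarrow> y [^]\<^bsub>R\<^esub> d \<odot>\<^bsub>M\<^esub> (a \<odot>\<^bsub>M\<^esub> x) = ev y q \<odot>\<^bsub>M\<^esub> (a \<odot>\<^bsub>M\<^esub> x)"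
proof -
  obtain p where p: "p \<noteq> 0" "ev y p \<odot>\<^bsub>M\<^esub> x = \<zero>\<^bsub>M\<^esub>" using assms(1) by (auto simp: annihilable_def)
  \<comment> \<open>Besides making \<open>p\<close> monic, the factor X forces positive degree
    \<open>d\<close> even if \<open>p\<close> is constant; the range of exponents
    \<open>k < d\<close> then always contains 0.\<close>
  define r where "r = pCons 0 (Polynomial.smult (inverse (lead_coeff p)) p)"
  define d where "d = Suc (degree p)"
  define q where "q = Polynomial.monom 1 d - r"
  have "lead_coeff r = 1" "degree r = d" using p(1) by (auto simp: r_def d_def)
  then have "coeff q d = 0" by (simp add: q_def)
  moreover have "degree q \<le> d" unfolding q_def
    by (intro degree_diff_le) (auto simp: \<open>degree r = d\<close> degree_monom_le)
  \<comment> \<open>If the degree of \<open>q\<close> were \<open>d\<close>, its leading coefficient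
    would be the vanishing \<open>coeff q d\<close>, so \<open>q\<close> would be zero and of degree
    0, which is less than \<open>d\<close>.\<close>
  ultimately have dq: "degree q < d"
    by (metis d_def degree_0 leading_coeff_0_iff nless_le zero_less_Suc)
  have rx: "ev y r \<odot>\<^bsub>M\<^esub> (a \<odot>\<^bsub>M\<^esub> x) = \<zero>\<^bsub>M\<^esub>" if a: "a \<in> carrier R" for a
  proof -
    define u where "u = y \<otimes>\<^bsub>R\<^esub> \<eta> (inverse (lead_coeff p))"
    have u: "u \<in> carrier R" using assms(2) by (simp add: u_def)
    have "ev y r = u \<otimes>\<^bsub>R\<^esub> ev y p"
      using assms(2) by (simp add: r_def u_def ev_pCons ev_smult eta_zero m_assoc)
    then have "ev y r \<odot>\<^bsub>M\<^esub> (a \<odot>\<^bsub>M\<^esub> x) = u \<odot>\<^bsub>M\<^esub> (a \<odot>\<^bsub>M\<^esub> (ev y p \<odot>\<^bsub>M\<^esub> x))"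
      using a u assms by (simp add: smult_assoc smult_closed smult_commute[of _ a])
    then show ?thesis using p(2) a u by (simp add: smult_r_null)
  qed
  have mon: "Polynomial.monom 1 d = q + r" by (simp add: q_def)
  have "y [^]\<^bsub>R\<^esub> d \<odot>\<^bsub>M\<^esub> (a \<odot>\<^bsub>M\<^esub> x) = ev y q \<odot>\<^bsub>M\<^esub> (a \<odot>\<^bsub>M\<^esub> x)" if a: "a \<in> carrier R" for a
  proof -
    have "y [^]\<^bsub>R\<^esub> d = ev y (Polynomial.monom 1 d)" using assms(2) by (simp add: ev_monom eta_one)
    also have "\<dots> = ev y q \<oplus>\<^bsub>R\<^esub> ev y r" using assms(2) unfolding mon by (rule ev_add)
    finally show ?thesis using rx[OF a] a assms by (simp add: smult_l_distr smult_closed)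
  qed
  then show ?thesis using dq that[of d q] by (simp add: d_def)
qed

text \<open>One generator is added at a time: from \<open>B\<close> to all \<open>y^k b\<close> with
  \<open>k < d\<close>. The new span is stable under \<open>y\<close> because \<open>y^d\<close>
  reduces to lower powers, and it stays stable under the older generators because they commute with
  \<open>y^k\<close>. Keeping \<open>B\<close> inside the multiples of \<open>x\<close> makes the
  power reduction applicable to its elements.\<close>

lemma stable_spanning_set:
  assumes "finite Z" "Z \<subseteq> carrier R" "x \<in> carrier M" "\<And>y. y \<in> Z \<Longrightarrow> annihilable y x"
  shows "\<exists>B. finite B \<and> x \<in> B \<and> B \<subseteq> {a \<odot>\<^bsub>M\<^esub> x | a. a \<in> carrier R} \<and>
    (\<forall>y\<in>Z. \<forall>b\<in>B. y \<odot>\<^bsub>M\<^esub> b \<in> complex_span B)"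
  using assms(1,2,4)
proof (induction Z rule: finite_induct)
  case empty
  show ?case using assms(3) by (intro exI[of _ "{x}"]) (auto intro!: exI[of _ "\<one>\<^bsub>R\<^esub>"] simp: smult_one)
next
  case (insert y Z)
  let ?X = "{a \<odot>\<^bsub>M\<^esub> x | a. a \<in> carrier R}"
  have X: "?X \<subseteq> carrier M" using assms(3) by (auto intro!: smult_closed)
  have "\<exists>B. finite B \<and> x \<in> B \<and> B \<subseteq> ?X \<and> (\<forall>z\<in>Z. \<forall>b\<in>B. z \<odot>\<^bsub>M\<^esub> b \<in> complex_span B)"
    using insert.prems by (intro insert.IH) auto
  then obtain B where B: "finite B" "x \<in> B" "B \<subseteq> ?X"
      "\<And>z b. z \<in> Z \<Longrightarrow> b \<in> B \<Longrightarrow> z \<odot>\<^bsub>M\<^esub> b \<in> complex_span B" by blast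
  have BM: "B \<subseteq> carrier M" using B X by blast
  have y: "y \<in> carrier R" using insert by simp
  have "annihilable y x" using insert by simp
  then obtain d q where d: "d > 0" "degree q < d"
      "\<And>a. a \<in> carrier R \<Longrightarrow> y [^]\<^bsub>R\<^esub> d \<odot>\<^bsub>M\<^esub> (a \<odot>\<^bsub>M\<^esub> x) = ev y q \<odot>\<^bsub>M\<^esub> (a \<odot>\<^bsub>M\<^esub> x)"
    using annihilable_power_reduction[OF _ y assms(3)] by metis
  define B' where "B' = {y [^]\<^bsub>R\<^esub> k \<odot>\<^bsub>M\<^esub> b | k b. k < d \<and> b \<in> B}"
  have B'I: "y [^]\<^bsub>R\<^esub> k \<odot>\<^bsub>M\<^esub> b \<in> B'" if "k < d" "b \<in> B" for k b
    using that by (auto simp: B'_def)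
  have fin: "finite B'" using B(1) by (auto simp: B'_def intro!: finite_image_set2)
  have B'X: "B' \<subseteq> ?X"
  proof
    fix c assume "c \<in> B'"
    then obtain k :: nat and b where kb: "b \<in> B" "c = y [^]\<^bsub>R\<^esub> k \<odot>\<^bsub>M\<^esub> b" unfolding B'_def by blast
    then obtain a where "a \<in> carrier R" "b = a \<odot>\<^bsub>M\<^esub> x" using B(3) by blast
    then have "c = (y [^]\<^bsub>R\<^esub> k \<otimes>\<^bsub>R\<^esub> a) \<odot>\<^bsub>M\<^esub> x" "y [^]\<^bsub>R\<^esub> k \<otimes>\<^bsub>R\<^esub> a \<in> carrier R"
      using kb y assms(3) by (auto simp: smult_assoc)
    then show "c \<in> ?X" by blast
  qed
  then have B'M: "B' \<subseteq> carrier M" using X by blast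
  note sub = complex_subspace_span[OF fin B'M]
  have B'sub: "B' \<subseteq> complex_span B'" by (rule complex_span_superset[OF fin B'M])
  have "x \<in> B'" using B'I[OF d(1) B(2)] assms(3) by (simp add: smult_one)
  moreover have "z \<odot>\<^bsub>M\<^esub> c \<in> complex_span B'" if zZ: "z \<in> insert y Z" and c: "c \<in> B'" for z c
  proof -
    obtain k :: nat and b where k: "k < d" and b: "b \<in> B" and ckb: "c = y [^]\<^bsub>R\<^esub> k \<odot>\<^bsub>M\<^esub> b"
      using c unfolding B'_def by blast
    have bM: "b \<in> carrier M" using b BM by blast
    show ?thesis
    proof (cases "z = y")
      case True
      have zc: "z \<odot>\<^bsub>M\<^esub> c = y [^]\<^bsub>R\<^esub> Suc k \<odot>\<^bsub>M\<^esub> b"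
        using y bM by (simp add: True ckb smult_assoc smult_closed smult_commute)
      show ?thesis
      proof (cases "Suc k < d")
        case True
        then show ?thesis using B'I[OF True b] B'sub zc by auto
      next
        case False
        then have "Suc k = d" using k by simp
        moreover obtain a where "a \<in> carrier R" "b = a \<odot>\<^bsub>M\<^esub> x" using b B(3) by blast
        ultimately have "z \<odot>\<^bsub>M\<^esub> c = ev y q \<odot>\<^bsub>M\<^esub> b" using zc d(3) by simp
        then show ?thesis
          using ev_smult_in_subspace[OF sub y bM _ d(2)] B'I[OF _ b] B'sub by auto
      qed
    next
      case False
      then have zZ: "z \<in> Z" using zZ by simp
      then have z: "z \<in> carrier R" using insert.prems by auto
      \<comment> \<open>The stability known for \<open>z\<close> only says that \<open>z b\<close>
        lies in the span of the old \<open>B\<close>. The vectors carried into the new span by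
        \<open>y^k\<close> form a subspace that contains \<open>B\<close>, hence also
        \<open>z b\<close>.\<close>
      have "complex_subspace {u \<in> carrier M. y [^]\<^bsub>R\<^esub> k \<odot>\<^bsub>M\<^esub> u \<in> complex_span B'}"
        using y complex_subspaceD[OF sub]
        by (intro complex_subspaceI) (auto simp: smult_r_null smult_r_distr smult_closed smult_commute[of "y [^]\<^bsub>R\<^esub> k" "\<eta> _"])
      then have "complex_span B \<subseteq> {u \<in> carrier M. y [^]\<^bsub>R\<^esub> k \<odot>\<^bsub>M\<^esub> u \<in> complex_span B'}"
        using B'I[OF k] B'sub BM by (intro complex_span_minimal) auto
      then have "y [^]\<^bsub>R\<^esub> k \<odot>\<^bsub>M\<^esub> (z \<odot>\<^bsub>M\<^esub> b) \<in> complex_span B'" using B(4)[OF zZ b] by blast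
      then show ?thesis using z y bM by (simp add: ckb smult_commute)
    qed
  qed
  ultimately show ?case using fin B'X by blast
qed

text \<open>A finite span that is stable under the generators is stable under everything they
  generate. As it contains \<open>x\<close> and is spanned by multiples of \<open>x\<close>, it is
  exactly the cyclic submodule of \<open>x\<close>.\<close>

lemma fin_gen_of_annihilable:
  assumes x: "x \<in> carrier M" and an: "\<And>y. y \<in> Y \<Longrightarrow> annihilable y x"
  shows "fin_gen M (range \<eta>) {a \<odot>\<^bsub>M\<^esub> x | a. a \<in> carrier R}"
proof -
  let ?X = "{a \<odot>\<^bsub>M\<^esub> x | a. a \<in> carrier R}"
  have X: "?X \<subseteq> carrier M" using x by (auto intro!: smult_closed)
  obtain B where B: "finite B" "x \<in> B" "B \<subseteq> ?X"
      "\<And>z b. z \<in> Y \<Longrightarrow> b \<in> B \<Longrightarrow> z \<odot>\<^bsub>M\<^esub> b \<in> complex_span B"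
    using stable_spanning_set[OF finite_Y Y_carrier x an] by blast
  have BM: "B \<subseteq> carrier M" using B X by blast
  note sub = complex_subspace_span[OF B(1) BM]
  note subD = complex_subspaceD[OF sub]
  have "\<forall>u\<in>complex_span B. a \<odot>\<^bsub>M\<^esub> u \<in> complex_span B" if "a \<in> carrier R" for a
    using that unfolding generated
  proof (induction a rule: generate_ring.induct)
    case one
    then show ?case using subD(1) by (auto simp: smult_one)
  next
    case (incl h)
    show ?case
    proof (cases "h \<in> Y")
      case True
      then have h: "h \<in> carrier R" using Y_carrier by blast
      have "complex_subspace {u \<in> carrier M. h \<odot>\<^bsub>M\<^esub> u \<in> complex_span B}"
        using h subD
        by (intro complex_subspaceI) (auto simp: smult_r_null smult_r_distr smult_closed smult_commute[of h "\<eta> _"])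
      then have "complex_span B \<subseteq> {u \<in> carrier M. h \<odot>\<^bsub>M\<^esub> u \<in> complex_span B}"
        using B(4)[OF True] BM by (intro complex_span_minimal) auto
      then show ?thesis by blast
    next
      case False
      then show ?thesis using incl subD(4) by auto
    qed
  next
    case (a_inv h)
    then have h: "h \<in> carrier R" using generated by blast
    have "(\<ominus>\<^bsub>R\<^esub> h) \<odot>\<^bsub>M\<^esub> u = \<eta> (-1) \<odot>\<^bsub>M\<^esub> (h \<odot>\<^bsub>M\<^esub> u)" if "u \<in> complex_span B" for u
      using h that subD(1) by (auto simp: eta_minus eta_one smult_l_minus smult_one smult_closed)
    then show ?case using a_inv subD(4) by auto
  next
    case (eng_add h1 h2)
    then have h: "h1 \<in> carrier R" "h2 \<in> carrier R" using generated by blast+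
    then have "(h1 \<oplus>\<^bsub>R\<^esub> h2) \<odot>\<^bsub>M\<^esub> u = h1 \<odot>\<^bsub>M\<^esub> u \<oplus>\<^bsub>M\<^esub> h2 \<odot>\<^bsub>M\<^esub> u" if "u \<in> complex_span B" for u
      using that subD(1) by (auto simp: smult_l_distr)
    then show ?case using eng_add subD(3) by auto
  next
    case (eng_mult h1 h2)
    then have h: "h1 \<in> carrier R" "h2 \<in> carrier R" using generated by blast+
    then have "(h1 \<otimes>\<^bsub>R\<^esub> h2) \<odot>\<^bsub>M\<^esub> u = h1 \<odot>\<^bsub>M\<^esub> (h2 \<odot>\<^bsub>M\<^esub> u)" if "u \<in> complex_span B" for u
      using that subD(1) by (auto simp: smult_assoc)
    then show ?case using eng_mult by auto
  qed
  then have "?X \<subseteq> complex_span B"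
    using complex_span_superset[OF B(1) BM] B(2) by auto
  moreover have "complex_subspace ?X"
  proof (rule complex_subspaceI[OF X])
    show "\<zero>\<^bsub>M\<^esub> \<in> ?X" using x smult_l_null[OF x] by (auto intro!: exI[of _ "\<zero>\<^bsub>R\<^esub>"])
  next
    fix u v assume "u \<in> ?X" "v \<in> ?X"
    then obtain a b where "u = a \<odot>\<^bsub>M\<^esub> x" "v = b \<odot>\<^bsub>M\<^esub> x" "a \<in> carrier R" "b \<in> carrier R" by blast
    then show "u \<oplus>\<^bsub>M\<^esub> v \<in> ?X" using x by (auto intro!: exI[of _ "a \<oplus>\<^bsub>R\<^esub> b"] simp: smult_l_distr)
  next
    fix c u assume "u \<in> ?X"
    then obtain a where "u = a \<odot>\<^bsub>M\<^esub> x" "a \<in> carrier R" by blast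
    then show "\<eta> c \<odot>\<^bsub>M\<^esub> u \<in> ?X" using x by (auto intro!: exI[of _ "\<eta> c \<otimes>\<^bsub>R\<^esub> a"] simp: smult_assoc)
  qed
  then have "complex_span B \<subseteq> ?X" using B(3) by (rule complex_span_minimal)
  ultimately show ?thesis unfolding fin_gen_iff[OF X] using B(1,3) by blast
qed

section \<open>Splitting into generalized eigenvectors\<close>

text \<open>Factor \<open>p = r q\<close> with \<open>r\<close> the full power of X - l at a root l.
  Bezout's identity splits \<open>x\<close> into a part killed by \<open>q\<close>, of smaller
  degree, and a part killed by \<open>r\<close>. The last hypothesis ranges over all multiples of
  \<open>x\<close> so that it is inherited by both parts.\<close>

lemma split_annihilated:
  assumes D: "subgroup D (add_monoid M)" and y: "y \<in> carrier R"
    and "x \<in> carrier M" "p \<noteq> 0" "ev y p \<odot>\<^bsub>M\<^esub> x = \<zero>\<^bsub>M\<^esub>"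
    and "\<And>a l m. \<lbrakk>a \<in> carrier R; ev y ([:- l, 1:] ^ m) \<odot>\<^bsub>M\<^esub> (a \<odot>\<^bsub>M\<^esub> x) = \<zero>\<^bsub>M\<^esub>\<rbrakk> \<Longrightarrow> a \<odot>\<^bsub>M\<^esub> x \<in> D"
  shows "x \<in> D"
  using assms(3-)
proof (induction "degree p" arbitrary: p x rule: less_induct)
  case less
  note x = \<open>x \<in> carrier M\<close>
  show ?case
  proof (cases "degree p = 0")
    \<comment> \<open>A nonzero constant polynomial acts invertibly, so \<open>x\<close> is
      zero.\<close>
    case True
    then obtain c where c: "p = [:c:]" by (rule degree_eq_zeroE)
    with less.prems have "c \<noteq> 0" by simp
    have "ev y p = \<eta> c" using y by (simp add: c ev_pCons)
    then have "\<eta> c \<odot>\<^bsub>M\<^esub> x = \<zero>\<^bsub>M\<^esub>" using less.prems by simp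
    then have "(\<eta> (inverse c) \<otimes>\<^bsub>R\<^esub> \<eta> c) \<odot>\<^bsub>M\<^esub> x = \<zero>\<^bsub>M\<^esub>"
      using x by (simp add: smult_assoc smult_r_null)
    moreover have "\<eta> (inverse c) \<otimes>\<^bsub>R\<^esub> \<eta> c = \<one>\<^bsub>R\<^esub>"
      using \<open>c \<noteq> 0\<close> by (simp add: eta_mult[symmetric] eta_one)
    ultimately have "x = \<zero>\<^bsub>M\<^esub>" using x by (simp add: smult_one)
    then show ?thesis using subgroup.one_closed[OF D] by simp
  next
    case False
    then have "\<not> constant (poly p)" by (simp add: constant_degree)
    then obtain l where l: "poly p l = 0" using fundamental_theorem_of_algebra by blast
    \<comment> \<open>The whole multiplicity of the root is removed at once; otherwise the cofactor
      would not be coprime to \<open>r\<close>.\<close>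
    obtain q where q: "p = [:- l, 1:] ^ order l p * q" "\<not> [:- l, 1:] dvd q"
      using order_decomp[OF \<open>p \<noteq> 0\<close>] by blast
    define r where "r = [:- l, 1:] ^ order l p"
    have pr: "p = r * q" using q(1) by (simp add: r_def)
    have "order l p > 0" using l \<open>p \<noteq> 0\<close> by (simp add: order_root)
    moreover have "degree r = order l p" by (simp add: r_def degree_power_eq)
    moreover have "q \<noteq> 0" "r \<noteq> 0" using pr \<open>p \<noteq> 0\<close> by auto
    ultimately have dq: "degree q < degree p" unfolding pr by (simp add: degree_mult_eq)
    have "prime_elem [:- l, 1:]" by (rule prime_elem_linear_field_poly) simp
    then have "coprime [:- l, 1:] q" using q(2) by (rule prime_elem_imp_coprime)
    then have "coprime r q" by (simp add: r_def)
    then obtain a b where ab: "a * r + b * q = 1"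
      by (metis bezout_coefficients_fst_snd coprime_imp_gcd_eq_1)
    have kill: "ev y q \<odot>\<^bsub>M\<^esub> (ev y (a * r) \<odot>\<^bsub>M\<^esub> x) = \<zero>\<^bsub>M\<^esub>"
    proof -
      have "ev y q \<odot>\<^bsub>M\<^esub> (ev y (a * r) \<odot>\<^bsub>M\<^esub> x) = ev y (q * (a * r)) \<odot>\<^bsub>M\<^esub> x"
        using x y by (simp add: ev_mult smult_assoc)
      also have "q * (a * r) = a * p" by (simp add: pr ac_simps)
      also have "ev y (a * p) \<odot>\<^bsub>M\<^esub> x = ev y a \<odot>\<^bsub>M\<^esub> (ev y p \<odot>\<^bsub>M\<^esub> x)"
        using x y by (simp add: ev_mult smult_assoc)
      finally show ?thesis using less.prems y by (simp add: smult_r_null)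
    qed
    have "ev y (a * r) \<odot>\<^bsub>M\<^esub> x \<in> D"
    proof (rule less.hyps[OF dq _ \<open>q \<noteq> 0\<close> kill])
      show "ev y (a * r) \<odot>\<^bsub>M\<^esub> x \<in> carrier M" using x y by (simp add: smult_closed)
      \<comment> \<open>A multiple of the component is again a multiple of the original
        \<open>x\<close>, so the hypothesis on \<open>x\<close> covers it.\<close>
      fix e k m assume e: "e \<in> carrier R"
        "ev y ([:- k, 1:] ^ m) \<odot>\<^bsub>M\<^esub> (e \<odot>\<^bsub>M\<^esub> (ev y (a * r) \<odot>\<^bsub>M\<^esub> x)) = \<zero>\<^bsub>M\<^esub>"
      have "e \<odot>\<^bsub>M\<^esub> (ev y (a * r) \<odot>\<^bsub>M\<^esub> x) = (e \<otimes>\<^bsub>R\<^esub> ev y (a * r)) \<odot>\<^bsub>M\<^esub> x"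
        using x y e(1) by (simp only: smult_assoc ev_closed)
      then show "e \<odot>\<^bsub>M\<^esub> (ev y (a * r) \<odot>\<^bsub>M\<^esub> x) \<in> D"
        using less.prems(4)[of "e \<otimes>\<^bsub>R\<^esub> ev y (a * r)" k m] e y by simp
    qed
    moreover have "ev y (b * q) \<odot>\<^bsub>M\<^esub> x \<in> D"
    proof (rule less.prems(4))
      show "ev y (b * q) \<in> carrier R" using y by simp
      have "ev y r \<odot>\<^bsub>M\<^esub> (ev y (b * q) \<odot>\<^bsub>M\<^esub> x) = ev y (r * (b * q)) \<odot>\<^bsub>M\<^esub> x"
        using x y by (simp add: ev_mult smult_assoc)
      also have "r * (b * q) = b * p" by (simp add: pr ac_simps)
      also have "ev y (b * p) \<odot>\<^bsub>M\<^esub> x = ev y b \<odot>\<^bsub>M\<^esub> (ev y p \<odot>\<^bsub>M\<^esub> x)"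
        using x y by (simp add: ev_mult smult_assoc)
      finally show "ev y ([:- l, 1:] ^ order l p) \<odot>\<^bsub>M\<^esub> (ev y (b * q) \<odot>\<^bsub>M\<^esub> x) = \<zero>\<^bsub>M\<^esub>"
        using less.prems y by (simp add: r_def smult_r_null)
    qed
    moreover have "x = ev y (a * r) \<odot>\<^bsub>M\<^esub> x \<oplus>\<^bsub>M\<^esub> ev y (b * q) \<odot>\<^bsub>M\<^esub> x"
    proof -
      have "ev y (a * r) \<oplus>\<^bsub>R\<^esub> ev y (b * q) = \<one>\<^bsub>R\<^esub>"
        using y by (simp only: ev_add[symmetric] ab ev_1)
      moreover have "(ev y (a * r) \<oplus>\<^bsub>R\<^esub> ev y (b * q)) \<odot>\<^bsub>M\<^esub> x
          = ev y (a * r) \<odot>\<^bsub>M\<^esub> x \<oplus>\<^bsub>M\<^esub> ev y (b * q) \<odot>\<^bsub>M\<^esub> x"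
        using x y by (intro smult_l_distr ev_closed)
      ultimately show ?thesis using x by (simp only: smult_one)
    qed
    ultimately show ?thesis using subgroup.m_closed[OF D] by (metis monoid.select_convs(1))
  qed
qed

text \<open>Eigenvalue and exponent may vary with the generator. The exponent 0 is allowed and
  forces a vector of \<open>M\<close> to be zero.\<close>

definition joint_generalized_eigenvector :: "'r set \<Rightarrow> 'm \<Rightarrow> bool" where
  "joint_generalized_eigenvector Z x \<longleftrightarrow> (\<forall>y\<in>Z. \<exists>l m. ev y ([:- l, 1:] ^ m) \<odot>\<^bsub>M\<^esub> x = \<zero>\<^bsub>M\<^esub>)"

text \<open>Each new generator is split off by \<open>split_annihilated\<close>, and its pieces are
  handed to the induction hypothesis. Further splitting only replaces a piece by multiples of it,
  and these are still killed by the same power of the shifted generator because \<open>R\<close> is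
  commutative.\<close>

lemma split_annihilable:
  assumes D: "subgroup D (add_monoid M)" and "finite Z" "Z \<subseteq> carrier R"
    and "x \<in> carrier M" "\<forall>y\<in>Z. annihilable y x"
    and "\<And>a. \<lbrakk>a \<in> carrier R; joint_generalized_eigenvector Z (a \<odot>\<^bsub>M\<^esub> x)\<rbrakk> \<Longrightarrow> a \<odot>\<^bsub>M\<^esub> x \<in> D"
  shows "x \<in> D"
  using assms(2-)
proof (induction Z arbitrary: x rule: finite_induct)
  case empty
  from empty.prems(4)[of "\<one>\<^bsub>R\<^esub>"] empty.prems(2) show ?case
    by (simp add: joint_generalized_eigenvector_def smult_one)
next
  case (insert y Z)
  note x = \<open>x \<in> carrier M\<close>
  have y: "y \<in> carrier R" using insert.prems by simp
  obtain p where p: "p \<noteq> 0" "ev y p \<odot>\<^bsub>M\<^esub> x = \<zero>\<^bsub>M\<^esub>"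
    using insert.prems(3) by (auto simp: annihilable_def)
  show ?case
  proof (rule split_annihilated[OF D y x p])
    fix a l m
    assume a: "a \<in> carrier R" and nil: "ev y ([:- l, 1:] ^ m) \<odot>\<^bsub>M\<^esub> (a \<odot>\<^bsub>M\<^esub> x) = \<zero>\<^bsub>M\<^esub>"
    show "a \<odot>\<^bsub>M\<^esub> x \<in> D"
    proof (rule insert.IH)
      show "Z \<subseteq> carrier R" "a \<odot>\<^bsub>M\<^esub> x \<in> carrier M" using insert.prems a by (auto intro: smult_closed)
      show "\<forall>z\<in>Z. annihilable z (a \<odot>\<^bsub>M\<^esub> x)"
        using insert.prems a by (auto intro!: annihilable_smult)
      fix b assume b: "b \<in> carrier R" and jb: "joint_generalized_eigenvector Z (b \<odot>\<^bsub>M\<^esub> (a \<odot>\<^bsub>M\<^esub> x))"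
      have "ev y ([:- l, 1:] ^ m) \<odot>\<^bsub>M\<^esub> (b \<odot>\<^bsub>M\<^esub> (a \<odot>\<^bsub>M\<^esub> x))
          = b \<odot>\<^bsub>M\<^esub> (ev y ([:- l, 1:] ^ m) \<odot>\<^bsub>M\<^esub> (a \<odot>\<^bsub>M\<^esub> x))"
        using a b x y by (intro smult_commute ev_closed smult_closed)
      then have "ev y ([:- l, 1:] ^ m) \<odot>\<^bsub>M\<^esub> (b \<odot>\<^bsub>M\<^esub> (a \<odot>\<^bsub>M\<^esub> x)) = \<zero>\<^bsub>M\<^esub>"
        using nil b by (simp only: smult_r_null)
      then have "joint_generalized_eigenvector (insert y Z) (b \<odot>\<^bsub>M\<^esub> (a \<odot>\<^bsub>M\<^esub> x))"
        using jb unfolding joint_generalized_eigenvector_def by blast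
      moreover have "b \<odot>\<^bsub>M\<^esub> (a \<odot>\<^bsub>M\<^esub> x) = (b \<otimes>\<^bsub>R\<^esub> a) \<odot>\<^bsub>M\<^esub> x" "b \<otimes>\<^bsub>R\<^esub> a \<in> carrier R"
        using a b x by (simp_all add: smult_assoc)
      ultimately show "b \<odot>\<^bsub>M\<^esub> (a \<odot>\<^bsub>M\<^esub> x) \<in> D" using insert.prems(4) by simp
    qed
  qed
qed

section \<open>Generalized weight spaces\<close>

definition ideal_power :: "'r set \<Rightarrow> nat \<Rightarrow> 'r set" where
  "ideal_power I n = I [^]\<^bsub>ideals_set R\<^esub> n"

lemma ideal_power_0: "ideal_power I 0 = carrier R"
  by (simp add: ideal_power_def ideals_set_def nat_pow_def)

lemma ideal_power_Suc: "ideal_power I (Suc n) = ideal_prod R (ideal_power I n) I"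
  by (simp add: ideal_power_def ideals_set_def nat_pow_def)

lemma ideal_ideal_power: "ideal I R \<Longrightarrow> ideal (ideal_power I n) R"
  by (induction n) (simp_all add: ideal_power_0 ideal_power_Suc R.oneideal R.ideal_prod_is_ideal)

lemma ideal_power_decreasing:
  assumes "ideal I R"
  shows "ideal_power I (k + n) \<subseteq> ideal_power I k"
proof (induction n)
  case (Suc n)
  have "ideal_power I (k + Suc n) \<subseteq> ideal_power I (k + n)"
    using R.ideal_prod_inter[OF ideal_ideal_power[OF assms] assms, of "k + n"]
    by (simp add: ideal_power_Suc)
  with Suc show ?case by blast
qed simp

lemma pow_in_ideal_power: "ideal I R \<Longrightarrow> c \<in> I \<Longrightarrow> c [^]\<^bsub>R\<^esub> n \<in> ideal_power I n"
  by (induction n) (auto simp: ideal_power_0 ideal_power_Suc intro: ideal_prod.prod)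

lemma ideal_prod_smult:
  assumes "ideal I R" "ideal J R" "x \<in> carrier M" "a \<in> ideal_prod R I J"
    and "\<And>i j. i \<in> I \<Longrightarrow> j \<in> J \<Longrightarrow> i \<odot>\<^bsub>M\<^esub> (j \<odot>\<^bsub>M\<^esub> x) = \<zero>\<^bsub>M\<^esub>"
  shows "a \<odot>\<^bsub>M\<^esub> x = \<zero>\<^bsub>M\<^esub>"
proof -
  have c: "ideal_prod R I J \<subseteq> carrier R" by (rule R.ideal_prod_in_carrier[OF assms(1,2)])
  show ?thesis using assms(4)
  proof (induction a rule: ideal_prod.induct)
    case (prod i j)
    then have "i \<in> carrier R" "j \<in> carrier R"
      using assms(1,2) ideal.Icarr by metis+
    then show ?case using prod assms(3,5) by (simp add: smult_assoc)
  next
    case (sum s1 s2)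
    then have "s1 \<in> carrier R" "s2 \<in> carrier R" using c by blast+
    then show ?case using sum assms(3) by (simp add: smult_l_distr)
  qed
qed

text \<open>The exponent cannot be lowered to \<^term>\<open>sum m G\<close>: for \<open>G = {}\<close> the ideal is zero, but its zeroth
  power is the whole ring.\<close>

lemma genideal_power_annihilates:
  assumes "finite G" "G \<subseteq> carrier R"
    and "x \<in> carrier M" "\<And>g. g \<in> G \<Longrightarrow> g [^]\<^bsub>R\<^esub> (m g :: nat) \<odot>\<^bsub>M\<^esub> x = \<zero>\<^bsub>M\<^esub>"
    and "a \<in> ideal_power (genideal R G) (Suc (sum m G))"
  shows "a \<odot>\<^bsub>M\<^esub> x = \<zero>\<^bsub>M\<^esub>"
  using assms(3-)
proof (induction "sum m G" arbitrary: m x a rule: less_induct)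
  case less
  let ?I = "genideal R G"
  let ?P = "ideal_power ?I (sum m G)"
  note x = \<open>x \<in> carrier M\<close>
  have I: "ideal ?I R" by (rule R.genideal_ideal[OF assms(2)])
  then have P: "ideal ?P R" by (rule ideal_ideal_power)
  then have Pc: "b \<in> carrier R" if "b \<in> ?P" for b using that by (rule ideal.Icarr)
  \<comment> \<open>This replaces an expansion of products of generators: \<open>S\<close> is an
    ideal, and it contains each \<open>g\<close> because \<open>g x\<close> needs one power of
    \<open>g\<close> less than \<open>x\<close>. So it contains the ideal generated by
    \<open>G\<close>, and multiplying once more by that ideal kills \<open>x\<close>.\<close>
  define S where "S = {c \<in> carrier R. \<forall>b\<in>?P. b \<odot>\<^bsub>M\<^esub> (c \<odot>\<^bsub>M\<^esub> x) = \<zero>\<^bsub>M\<^esub>}"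
  have "ideal S R"
  proof (rule idealI[OF R.ring_axioms])
    show "subgroup S (add_monoid R)"
    proof (rule group.subgroupI[OF R.a_group])
      show "S \<subseteq> carrier (add_monoid R)" by (auto simp: S_def)
      have "\<zero>\<^bsub>R\<^esub> \<in> S" using x Pc by (simp add: S_def smult_l_null smult_r_null)
      then show "S \<noteq> {}" by blast
      show "inv\<^bsub>add_monoid R\<^esub> c \<in> S" if "c \<in> S" for c
        using that x Pc by (simp add: S_def smult_l_minus smult_r_minus smult_closed
            a_inv_def[of R, symmetric])
      show "c \<otimes>\<^bsub>add_monoid R\<^esub> d \<in> S" if "c \<in> S" "d \<in> S" for c d
        using that x Pc by (simp add: S_def smult_l_distr smult_r_distr smult_closed)
    qed
    have *: "u \<otimes>\<^bsub>R\<^esub> c \<in> S" if c: "c \<in> S" and u: "u \<in> carrier R" for c u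
    proof -
      have cc: "c \<in> carrier R" using c by (simp add: S_def)
      have "b \<odot>\<^bsub>M\<^esub> ((u \<otimes>\<^bsub>R\<^esub> c) \<odot>\<^bsub>M\<^esub> x) = u \<odot>\<^bsub>M\<^esub> (b \<odot>\<^bsub>M\<^esub> (c \<odot>\<^bsub>M\<^esub> x))" if "b \<in> ?P" for b
        using that u cc x Pc by (simp add: smult_assoc smult_commute[of b u] smult_closed)
      then show ?thesis using c u by (simp add: S_def smult_r_null)
    qed
    show "u \<otimes>\<^bsub>R\<^esub> c \<in> S" if "c \<in> S" "u \<in> carrier R" for c u using * that .
    show "c \<otimes>\<^bsub>R\<^esub> u \<in> S" if "c \<in> S" "u \<in> carrier R" for c u
    proof -
      have "c \<in> carrier R" using that(1) by (simp add: S_def)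
      then show ?thesis using *[OF that] m_comm that(2) by simp
    qed
  qed
  moreover have "G \<subseteq> S"
  proof
    fix g assume g: "g \<in> G"
    then have gc: "g \<in> carrier R" using assms(2) by blast
    show "g \<in> S"
    proof (cases "m g")
      \<comment> \<open>Here no exponent can be lowered, but \<open>g^0 x = 0\<close> already says
        that \<open>x\<close> is zero.\<close>
      case 0
      then have "x = \<zero>\<^bsub>M\<^esub>" using less.prems(2)[OF g] x by (simp add: smult_one)
      then show ?thesis using gc Pc by (simp add: S_def smult_r_null)
    next
      case (Suc k)
      \<comment> \<open>The exponent sum drops by exactly one, so the power handled by the induction
        hypothesis for \<open>g x\<close> is precisely \<open>?P\<close>.\<close>
      define m' where "m' = m(g := k)"
      have sm: "sum m G = Suc (sum m' G)"
        by (simp add: sum.remove[OF assms(1) g] m'_def Suc)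
      have gx: "g \<odot>\<^bsub>M\<^esub> x \<in> carrier M" using gc x by (rule smult_closed)
      have kill: "h [^]\<^bsub>R\<^esub> m' h \<odot>\<^bsub>M\<^esub> (g \<odot>\<^bsub>M\<^esub> x) = \<zero>\<^bsub>M\<^esub>" if h: "h \<in> G" for h
      proof (cases "h = g")
        case True
        then show ?thesis using less.prems(2)[OF g] Suc gc x by (simp add: m'_def smult_assoc)
      next
        case False
        have hc: "h \<in> carrier R" using h assms(2) by blast
        have "h [^]\<^bsub>R\<^esub> m' h \<odot>\<^bsub>M\<^esub> (g \<odot>\<^bsub>M\<^esub> x) = g \<odot>\<^bsub>M\<^esub> (h [^]\<^bsub>R\<^esub> m h \<odot>\<^bsub>M\<^esub> x)"
          using False hc gc x by (simp add: m'_def smult_commute[of _ g])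
        then show ?thesis using less.prems(2)[OF h] gc by (simp add: smult_r_null)
      qed
      have "b \<odot>\<^bsub>M\<^esub> (g \<odot>\<^bsub>M\<^esub> x) = \<zero>\<^bsub>M\<^esub>" if b: "b \<in> ?P" for b
        using less.hyps[OF _ gx kill] b by (simp add: sm)
      then show ?thesis using gc by (simp add: S_def)
    qed
  qed
  ultimately have "?I \<subseteq> S" by (rule R.genideal_minimal)
  then show ?case
    using less.prems(3) unfolding ideal_power_Suc
    by (intro ideal_prod_smult[OF P I x]) (auto simp: S_def)
qed

abbreviation weight_space :: "'r set \<Rightarrow> 'm set" where
  "weight_space \<equiv> generalized_weight_space R (carrier R) M"

lemma mem_weight_space_iff:
  "x \<in> weight_space n \<longleftrightarrow>
    x \<in> carrier M \<and> (\<exists>N>0. \<forall>a\<in>ideal_power n N. a \<odot>\<^bsub>M\<^esub> x = \<zero>\<^bsub>M\<^esub>)"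
  by (simp add: generalized_weight_space_def ideal_power_def)

lemma mem_cfs_iff:
  "n \<in> cfs R \<eta> (carrier R) \<longleftrightarrow> maximalideal n R \<and>
    ring.finite_dimension (R Quot n) (range (\<lambda>a. n +>\<^bsub>R\<^esub> \<eta> a)) (carrier (R Quot n))"
  by (simp add: cfs_def Let_def)

lemma cfs_ideal: "n \<in> cfs R \<eta> (carrier R) \<Longrightarrow> ideal n R"
  by (simp add: mem_cfs_iff maximalideal_def)

lemma subgroup_weight_space:
  assumes n: "ideal n R"
  shows "subgroup (weight_space n) (add_monoid M)"
proof (rule group.subgroupI[OF M.a_group])
  have pc: "a \<in> carrier R" if "a \<in> ideal_power n N" for a N
    using that by (rule ideal.Icarr[OF ideal_ideal_power[OF n]])
  show "weight_space n \<subseteq> carrier (add_monoid M)" by (auto simp: mem_weight_space_iff)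
  have "\<zero>\<^bsub>M\<^esub> \<in> weight_space n"
    using pc by (auto simp: mem_weight_space_iff smult_r_null intro!: exI[of _ 1])
  then show "weight_space n \<noteq> {}" by blast
  show "inv\<^bsub>add_monoid M\<^esub> x \<in> weight_space n" if x: "x \<in> weight_space n" for x
  proof -
    obtain N where "N > 0" "\<forall>a\<in>ideal_power n N. a \<odot>\<^bsub>M\<^esub> x = \<zero>\<^bsub>M\<^esub>" "x \<in> carrier M"
      using x by (auto simp: mem_weight_space_iff)
    then show ?thesis
      by (auto simp: mem_weight_space_iff a_inv_def[of M, symmetric] smult_r_minus pc intro!: exI[of _ N])
  qed
  show "x \<otimes>\<^bsub>add_monoid M\<^esub> z \<in> weight_space n" if x: "x \<in> weight_space n" and z: "z \<in> weight_space n" for x z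
  proof -
    obtain N where N: "N > 0" "\<forall>a\<in>ideal_power n N. a \<odot>\<^bsub>M\<^esub> x = \<zero>\<^bsub>M\<^esub>" "x \<in> carrier M"
      using x by (auto simp: mem_weight_space_iff)
    obtain K where K: "K > 0" "\<forall>a\<in>ideal_power n K. a \<odot>\<^bsub>M\<^esub> z = \<zero>\<^bsub>M\<^esub>" "z \<in> carrier M"
      using z by (auto simp: mem_weight_space_iff)
    have "a \<odot>\<^bsub>M\<^esub> (x \<oplus>\<^bsub>M\<^esub> z) = \<zero>\<^bsub>M\<^esub>" if a: "a \<in> ideal_power n (N + K)" for a
    proof -
      have "a \<in> ideal_power n N" "a \<in> ideal_power n K"
        using a ideal_power_decreasing[OF n, of N K] ideal_power_decreasing[OF n, of K N]
        by (auto simp: add.commute)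
      then show ?thesis using N K pc[OF a] by (simp add: smult_r_distr)
    qed
    then show ?thesis using N K
      by (auto simp: mem_weight_space_iff intro!: exI[of _ "N + K"])
  qed
qed

end

section \<open>Ideals of finite codimension\<close>

text \<open>Each \<open>line_extension\<close> in the inductive definition of dimension contributes
  one spanning vector. Numbering them by \<open>{..<n}\<close> gives the indexed family that the
  linear dependence argument takes as input.\<close>

lemma (in ring) dimension_spanned:
  assumes "dimension n K E" "K \<subseteq> carrier R"
  shows "\<exists>b. b \<in> {..<n} \<rightarrow> carrier R \<and>
    (\<forall>v\<in>E. \<exists>k. k \<in> {..<n} \<rightarrow> K \<and> v = (\<Oplus>j\<in>{..<n}. k j \<otimes> b j))"
  using assms
proof (induction rule: dimension.induct)
  case (zero_dim K)
  show ?case by simp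
next
  case (Suc_dim v E n K)
  then obtain b where b: "b \<in> {..<n} \<rightarrow> carrier R"
    and sp: "\<And>u. u \<in> E \<Longrightarrow> \<exists>k. k \<in> {..<n} \<rightarrow> K \<and> u = (\<Oplus>j\<in>{..<n}. k j \<otimes> b j)" by blast
  define b' where "b' = b(n := v)"
  have b': "b' \<in> {..<Suc n} \<rightarrow> carrier R" using b Suc_dim.hyps(1) by (auto simp: b'_def less_Suc_eq)
  have "\<exists>k. k \<in> {..<Suc n} \<rightarrow> K \<and> u = (\<Oplus>j\<in>{..<Suc n}. k j \<otimes> b' j)"
    if u: "u \<in> line_extension K v E" for u
  proof -
    obtain c e where ce: "c \<in> K" "e \<in> E" "u = c \<otimes> v \<oplus> e"
      using u by (auto simp: line_extension_mem_iff)
    obtain k where k: "k \<in> {..<n} \<rightarrow> K" "e = (\<Oplus>j\<in>{..<n}. k j \<otimes> b j)" using sp[OF ce(2)] by blast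
    define k' where "k' = k(n := c)"
    have k': "k' \<in> {..<Suc n} \<rightarrow> K" using k(1) ce(1) by (auto simp: k'_def less_Suc_eq)
    have kb: "k' j \<otimes> b' j \<in> carrier R" if "j < Suc n" for j
      using that k' b' Suc_dim.prems by auto
    have "(\<Oplus>j\<in>{..<n}. k' j \<otimes> b' j) = e" unfolding k(2)
      using k(1) b Suc_dim.prems by (intro finsum_cong') (auto simp: k'_def b'_def)
    moreover have "(\<Oplus>j\<in>insert n {..<n}. k' j \<otimes> b' j) = k' n \<otimes> b' n \<oplus> (\<Oplus>j\<in>{..<n}. k' j \<otimes> b' j)"
      using kb by (intro finsum_insert) auto
    ultimately have "u = (\<Oplus>j\<in>{..<Suc n}. k' j \<otimes> b' j)"
      by (simp add: ce(3) k'_def b'_def lessThan_Suc)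
    with k' show ?thesis by blast
  qed
  with b' show ?case by blast
qed

text \<open>Views \<open>R/n\<close> as a module, so that the linear dependence argument for \<open>\<Gamma>v\<close> also applies to \<open>\<Gamma>/n\<close>.\<close>

definition quotient_module :: "('r, 'x) ring_scheme \<Rightarrow> 'r set \<Rightarrow> ('r, 'r set) module" where
  "quotient_module R n = \<lparr>carrier = carrier (R Quot n), monoid.mult = monoid.mult (R Quot n),
     monoid.one = monoid.one (R Quot n), ring.zero = ring.zero (R Quot n), add = add (R Quot n),
     module.smult = (\<lambda>a X. (n +>\<^bsub>R\<^esub> a) \<otimes>\<^bsub>R Quot n\<^esub> X)\<rparr>"

lemma quotient_module_simps:
  "carrier (quotient_module R n) = carrier (R Quot n)"
  "add (quotient_module R n) = add (R Quot n)"
  "ring.zero (quotient_module R n) = ring.zero (R Quot n)"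
  "a \<odot>\<^bsub>quotient_module R n\<^esub> X = (n +>\<^bsub>R\<^esub> a) \<otimes>\<^bsub>R Quot n\<^esub> X"
  "finsum (quotient_module R n) = finsum (R Quot n)"
  by (simp_all add: quotient_module_def finsum_def finprod_def fun_eq_iff)

lemma FactRing_zero: "\<zero>\<^bsub>R Quot n\<^esub> = n"
  and FactRing_one: "\<one>\<^bsub>R Quot n\<^esub> = n +>\<^bsub>R\<^esub> \<one>\<^bsub>R\<^esub>"
  by (simp_all add: FactRing_def)

lemma mem_carrier_FactRing_iff: "X \<in> carrier (R Quot n) \<longleftrightarrow> (\<exists>a\<in>carrier R. X = n +>\<^bsub>R\<^esub> a)"
  by (auto simp: FactRing_simps)

lemma (in ideal) left_module_quotient: "left_module R (quotient_module R I)"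
proof -
  interpret Q: ring "R Quot I" by (rule quotient_is_ring)
  interpret q: ring_hom_ring R "R Quot I" "(+>) I" by (rule rcos_ring_hom_ring)
  have "abelian_group (quotient_module R I)"
  proof (rule abelian_groupI, unfold quotient_module_simps)
    show "\<exists>Y\<in>carrier (R Quot I). Y \<oplus>\<^bsub>R Quot I\<^esub> X = \<zero>\<^bsub>R Quot I\<^esub>"
      if "X \<in> carrier (R Quot I)" for X
      using that Q.a_inv_closed Q.l_neg by blast
  qed (simp_all add: Q.a_ac)
  then show ?thesis
    by (intro left_module.intro left_module_axioms.intro ring_axioms)
      (simp_all add: quotient_module_simps Q.l_distr Q.r_distr Q.m_assoc)
qed

context fg_algebra_module
begin

text \<open>The elements congruent to a scalar modulo an ideal form a subring, so it suffices to
  test the generators. In other words, the complex numbers surject onto the quotient.\<close>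

lemma scalar_mod_ideal:
  assumes n: "ideal n R" and g: "g \<in> carrier R"
    and gen: "\<And>y. y \<in> Y \<Longrightarrow> \<exists>a. \<exists>c\<in>n. y = \<eta> a \<oplus>\<^bsub>R\<^esub> c"
  shows "\<exists>a. \<exists>c\<in>n. g = \<eta> a \<oplus>\<^bsub>R\<^esub> c"
proof -
  interpret n: ideal n R by (rule n)
  show ?thesis
    using g unfolding generated
  proof (induction g rule: generate_ring.induct)
    case one
    have "\<one>\<^bsub>R\<^esub> = \<eta> 1 \<oplus>\<^bsub>R\<^esub> \<zero>\<^bsub>R\<^esub>" by (simp add: eta_one)
    then show ?case using n.zero_closed by blast
  next
    case (incl h)
    then show ?case
    proof
      assume "h \<in> range \<eta>"
      then obtain a where "h = \<eta> a \<oplus>\<^bsub>R\<^esub> \<zero>\<^bsub>R\<^esub>" by auto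
      then show ?thesis using n.zero_closed by blast
    qed (rule gen)
  next
    case (a_inv h)
    then obtain a c where ac: "c \<in> n" "h = \<eta> a \<oplus>\<^bsub>R\<^esub> c" by blast
    then have "\<ominus>\<^bsub>R\<^esub> h = \<eta> (- a) \<oplus>\<^bsub>R\<^esub> (\<ominus>\<^bsub>R\<^esub> c)"
      by (simp add: eta_minus R.minus_add n.Icarr)
    then show ?case using n.a_inv_closed[OF ac(1)] by blast
  next
    case (eng_add h1 h2)
    then obtain a c b d where ac: "c \<in> n" "h1 = \<eta> a \<oplus>\<^bsub>R\<^esub> c" "d \<in> n" "h2 = \<eta> b \<oplus>\<^bsub>R\<^esub> d" by blast
    then have "h1 \<oplus>\<^bsub>R\<^esub> h2 = \<eta> (a + b) \<oplus>\<^bsub>R\<^esub> (c \<oplus>\<^bsub>R\<^esub> d)"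
      by (simp add: eta_add n.Icarr R.a_ac)
    then show ?case using n.a_closed[OF ac(1,3)] by blast
  next
    case (eng_mult h1 h2)
    then obtain a c b d where ac: "c \<in> n" "h1 = \<eta> a \<oplus>\<^bsub>R\<^esub> c" "d \<in> n" "h2 = \<eta> b \<oplus>\<^bsub>R\<^esub> d" by blast
    then have "h1 \<otimes>\<^bsub>R\<^esub> h2 = \<eta> (a * b) \<oplus>\<^bsub>R\<^esub> (\<eta> a \<otimes>\<^bsub>R\<^esub> d \<oplus>\<^bsub>R\<^esub> c \<otimes>\<^bsub>R\<^esub> (\<eta> b \<oplus>\<^bsub>R\<^esub> d))"
      by (simp add: eta_mult n.Icarr R.r_distr R.l_distr R.a_ac)
    moreover have "\<eta> a \<otimes>\<^bsub>R\<^esub> d \<oplus>\<^bsub>R\<^esub> c \<otimes>\<^bsub>R\<^esub> (\<eta> b \<oplus>\<^bsub>R\<^esub> d) \<in> n"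
      using ac by (simp add: n.I_l_closed n.I_r_closed n.a_closed n.Icarr)
    ultimately show ?case by blast
  qed
qed

text \<open>Every element is a scalar modulo \<open>n\<close>, so the quotient is at most
  one-dimensional. The assumption \<open>proper\<close> says that the point \<open>l\<close> is
  compatible with the relations among the generators in \<open>R\<close>.\<close>

lemma point_ideal_in_cfs:
  fixes l :: "'r \<Rightarrow> complex"
  defines "n \<equiv> genideal R ((\<lambda>y. y \<ominus>\<^bsub>R\<^esub> \<eta> (l y)) ` Y)"
  assumes proper: "n \<noteq> carrier R"
  shows "n \<in> cfs R \<eta> (carrier R)"
proof -
  have Gc: "(\<lambda>y. y \<ominus>\<^bsub>R\<^esub> \<eta> (l y)) ` Y \<subseteq> carrier R" using Y_carrier by auto
  have id: "ideal n R" unfolding n_def by (rule R.genideal_ideal[OF Gc])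
  interpret n: ideal n R by (rule id)
  have gen: "\<exists>a. \<exists>c\<in>n. y = \<eta> a \<oplus>\<^bsub>R\<^esub> c" if y: "y \<in> Y" for y
  proof -
    have "y \<ominus>\<^bsub>R\<^esub> \<eta> (l y) \<in> n" unfolding n_def using R.genideal_self[OF Gc] y by blast
    moreover have "y = \<eta> (l y) \<oplus>\<^bsub>R\<^esub> (y \<ominus>\<^bsub>R\<^esub> \<eta> (l y))"
    proof -
      have yc: "y \<in> carrier R" using y Y_carrier by blast
      then have "\<eta> (l y) \<oplus>\<^bsub>R\<^esub> (y \<ominus>\<^bsub>R\<^esub> \<eta> (l y)) = y \<oplus>\<^bsub>R\<^esub> (\<eta> (l y) \<oplus>\<^bsub>R\<^esub> \<ominus>\<^bsub>R\<^esub> \<eta> (l y))"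
        by (simp only: R.minus_eq R.a_lcomm R.a_inv_closed eta_closed)
      also have "\<dots> = y" using yc by (simp add: R.r_neg)
      finally show ?thesis by simp
    qed
    ultimately show ?thesis by blast
  qed
  note cong = scalar_mod_ideal[OF id _ gen]
  have one: "\<one>\<^bsub>R\<^esub> \<notin> n" using proper n.one_imp_carrier by blast
  have "maximalideal n R"
  proof (rule maximalidealI[OF id])
    show "carrier R \<noteq> n" using proper by simp
    fix J assume J: "ideal J R" "n \<subseteq> J" "J \<subseteq> carrier R"
    interpret J: ideal J R by (rule J(1))
    show "J = n \<or> J = carrier R"
    proof (rule disjCI)
      assume "J \<noteq> carrier R"
      then have J1: "\<one>\<^bsub>R\<^esub> \<notin> J" using J.one_imp_carrier by blast
      have "J \<subseteq> n"
      proof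
        fix g assume g: "g \<in> J"
        then obtain a c where ac: "c \<in> n" "g = \<eta> a \<oplus>\<^bsub>R\<^esub> c" using cong J(3) by blast
        have cc: "c \<in> carrier R" using ac(1) by (rule n.Icarr)
        show "g \<in> n"
        proof (cases "a = 0")
          case True
          then show ?thesis using ac cc by (simp add: eta_zero)
        next
          case False
          \<comment> \<open>An element of \<open>J\<close> outside \<open>n\<close> has a nonzero
            scalar part, and this unit then lies in \<open>J\<close>.\<close>
          have "\<eta> a = g \<oplus>\<^bsub>R\<^esub> \<ominus>\<^bsub>R\<^esub> c" using cc by (simp add: ac(2) R.a_assoc R.r_neg)
          then have "\<eta> a \<in> J" using g ac(1) J(2) J.a_closed J.a_inv_closed by auto
          then have "\<eta> (inverse a) \<otimes>\<^bsub>R\<^esub> \<eta> a \<in> J" by (simp add: J.I_l_closed)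
          then have "\<one>\<^bsub>R\<^esub> \<in> J" using False by (simp add: eta_mult[symmetric] eta_one)
          then show ?thesis using J1 by simp
        qed
      qed
      then show "J = n" using J(2) by simp
    qed
  qed
  moreover have "ring.finite_dimension (R Quot n) (range (\<lambda>a. n +>\<^bsub>R\<^esub> \<eta> a)) (carrier (R Quot n))"
  proof -
    interpret Q: ring "R Quot n" by (rule n.quotient_is_ring)
    interpret q: ring_hom_ring R "R Quot n" "(+>\<^bsub>R\<^esub>) n" by (rule n.rcos_ring_hom_ring)
    let ?K = "range (\<lambda>a. n +>\<^bsub>R\<^esub> \<eta> a)"
    have KQ: "?K \<subseteq> carrier (R Quot n)" by auto
    have "carrier (R Quot n) \<subseteq> ?K"
    proof
      fix X assume "X \<in> carrier (R Quot n)"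
      then obtain g where g: "g \<in> carrier R" "X = n +>\<^bsub>R\<^esub> g"
        unfolding mem_carrier_FactRing_iff by blast
      then obtain a c where ac: "c \<in> n" "g = \<eta> a \<oplus>\<^bsub>R\<^esub> c" using cong by blast
      have "n +>\<^bsub>R\<^esub> c = \<zero>\<^bsub>R Quot n\<^esub>" unfolding FactRing_zero using ac(1) by (rule n.a_rcos_const)
      then have "X = n +>\<^bsub>R\<^esub> \<eta> a" using ac n.Icarr[OF ac(1)] by (simp add: g(2))
      then show "X \<in> ?K" by simp
    qed
    then have KE: "?K = carrier (R Quot n)" using KQ by blast
    \<comment> \<open>\<open>dimension\<close> only counts extensions by a vector outside the
      previous space, so the class of 1 must be nonzero before it can span the quotient over the
      zero space.\<close>
    have "\<one>\<^bsub>R Quot n\<^esub> \<notin> {\<zero>\<^bsub>R Quot n\<^esub>}"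
      using one n.a_rcos_self[of "\<one>\<^bsub>R\<^esub>"] FactRing_zero FactRing_one by (metis R.one_closed singletonD)
    then have "Q.dimension (Suc 0) ?K (Q.line_extension ?K \<one>\<^bsub>R Quot n\<^esub> {\<zero>\<^bsub>R Quot n\<^esub>})"
      by (intro Q.Suc_dim Q.zero_dim) simp_all
    moreover have "Q.line_extension ?K \<one>\<^bsub>R Quot n\<^esub> {\<zero>\<^bsub>R Quot n\<^esub>} = carrier (R Quot n)"
      unfolding KE by (auto simp: Q.line_extension_mem_iff)
    ultimately show ?thesis unfolding Q.finite_dimension_def by metis
  qed
  ultimately show ?thesis by (simp add: mem_cfs_iff)
qed

text \<open>In a finite dimensional algebra the class of \<open>y\<close> is algebraic. A polynomial
  in \<open>y\<close> that kills the class of 1 in the quotient by \<open>n\<close> lies in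
  \<open>n\<close>.\<close>

lemma ev_in_cfs_ideal:
  assumes n: "n \<in> cfs R \<eta> (carrier R)" and y: "y \<in> carrier R"
  shows "\<exists>p. p \<noteq> 0 \<and> ev y p \<in> n"
proof -
  interpret n: ideal n R by (rule cfs_ideal[OF n])
  interpret Q: ring "R Quot n" by (rule n.quotient_is_ring)
  interpret q: ring_hom_ring R "R Quot n" "(+>\<^bsub>R\<^esub>) n" by (rule n.rcos_ring_hom_ring)
  let ?N = "quotient_module R n"
  \<comment> \<open>The module is now the quotient by \<open>n\<close>, with the same ring, scalars
    and generators, so the linear dependence argument can be applied to the powers of
    \<open>y\<close> acting on the class of 1.\<close>
  interpret N: fg_algebra_module R ?N \<eta> Y
    using fg_algebra_module_axioms n.left_module_quotient
    by (simp add: fg_algebra_module_def cring_module_def R.is_cring)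
  let ?K = "range (\<lambda>a. n +>\<^bsub>R\<^esub> \<eta> a)"
  have "Q.finite_dimension ?K (carrier (R Quot n))" using n by (simp add: mem_cfs_iff)
  then obtain d where d: "Q.dimension d ?K (carrier (R Quot n))" by (auto simp: Q.finite_dimension_def)
  have "?K \<subseteq> carrier (R Quot n)" by auto
  from Q.dimension_spanned[OF d this]
  obtain b where b_sp: "b \<in> {..<d} \<rightarrow> carrier (R Quot n) \<and> (\<forall>v\<in>carrier (R Quot n). \<exists>k. k \<in> {..<d} \<rightarrow> ?K \<and>
      v = finsum (R Quot n) (\<lambda>j. k j \<otimes>\<^bsub>R Quot n\<^esub> b j) {..<d})" ..
  note b = b_sp[THEN conjunct1] and sp = b_sp[THEN conjunct2, THEN bspec]
  have "\<forall>v\<in>carrier (R Quot n). \<exists>C. v = finsum ?N (\<lambda>j. \<eta> (C j) \<odot>\<^bsub>?N\<^esub> b j) {..<d}"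
  proof
    fix v assume v: "v \<in> carrier (R Quot n)"
    obtain k where k: "k \<in> {..<d} \<rightarrow> ?K" and vk: "v = finsum (R Quot n) (\<lambda>j. k j \<otimes>\<^bsub>R Quot n\<^esub> b j) {..<d}"
      using sp[OF v] by (elim exE conjE)
    have "\<forall>j\<in>{..<d}. \<exists>a. k j = n +>\<^bsub>R\<^esub> \<eta> a" using k by blast
    then obtain C where C: "\<forall>j\<in>{..<d}. k j = n +>\<^bsub>R\<^esub> \<eta> (C j)" by (rule bchoice[THEN exE])
    have "v = finsum (R Quot n) (\<lambda>j. (n +>\<^bsub>R\<^esub> \<eta> (C j)) \<otimes>\<^bsub>R Quot n\<^esub> b j) {..<d}"
      unfolding vk
    proof (rule Q.finsum_cong'[OF refl])
      show "(\<lambda>j. (n +>\<^bsub>R\<^esub> \<eta> (C j)) \<otimes>\<^bsub>R Quot n\<^esub> b j) \<in> {..<d} \<rightarrow> carrier (R Quot n)"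
        using b by (intro Pi_I Q.m_closed q.hom_closed eta_closed) (rule Pi_mem)
    qed (use C in simp)
    then show "\<exists>C. v = finsum ?N (\<lambda>j. \<eta> (C j) \<odot>\<^bsub>?N\<^esub> b j) {..<d}"
      unfolding quotient_module_simps by (rule exI[where x = C])
  qed
  then obtain C where "\<forall>v\<in>carrier (R Quot n). v = finsum ?N (\<lambda>j. \<eta> (C v j) \<odot>\<^bsub>?N\<^esub> b j) {..<d}"
    by (rule bchoice[THEN exE])
  then have C: "v = finsum ?N (\<lambda>j. \<eta> (C v j) \<odot>\<^bsub>?N\<^esub> b j) {..<d}" if "v \<in> carrier (R Quot n)" for v
    using that by (rule bspec)
  have "N.annihilable y \<one>\<^bsub>R Quot n\<^esub>"
  proof (rule N.annihilable_of_powers_spanned[OF y])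
    show "\<one>\<^bsub>R Quot n\<^esub> \<in> carrier ?N" by (simp add: quotient_module_simps)
    show "finite {..<d}" by simp
    show "b \<in> {..<d} \<rightarrow> carrier ?N" using b by (simp add: quotient_module_simps)
    show "y [^]\<^bsub>R\<^esub> k \<odot>\<^bsub>?N\<^esub> \<one>\<^bsub>R Quot n\<^esub> =
        finsum ?N (\<lambda>j. \<eta> (C (y [^]\<^bsub>R\<^esub> k \<odot>\<^bsub>?N\<^esub> \<one>\<^bsub>R Quot n\<^esub>) j) \<odot>\<^bsub>?N\<^esub> b j) {..<d}" for k :: nat
    proof (rule C)
      show "y [^]\<^bsub>R\<^esub> k \<odot>\<^bsub>?N\<^esub> \<one>\<^bsub>R Quot n\<^esub> \<in> carrier (R Quot n)"
        using y by (simp add: quotient_module_simps)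
    qed
  qed
  then obtain p where p: "p \<noteq> 0" "ev y p \<odot>\<^bsub>?N\<^esub> \<one>\<^bsub>R Quot n\<^esub> = \<zero>\<^bsub>?N\<^esub>"
    unfolding N.annihilable_def by (elim exE conjE)
  have "(n +>\<^bsub>R\<^esub> ev y p) \<otimes>\<^bsub>R Quot n\<^esub> \<one>\<^bsub>R Quot n\<^esub> = \<zero>\<^bsub>R Quot n\<^esub>"
    using p(2) unfolding quotient_module_simps .
  then have "n +>\<^bsub>R\<^esub> ev y p = \<zero>\<^bsub>R Quot n\<^esub>"
    using Q.r_one[OF q.hom_closed[OF ev_closed[OF y]]] by (simp only:)
  then have "n +>\<^bsub>R\<^esub> ev y p = n" by (simp only: FactRing_zero)
  then have "ev y p \<in> n" using n.a_rcos_self[of "ev y p"] y by simp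
  with p(1) show ?thesis by blast
qed

lemma annihilable_weight_space:
  assumes n: "n \<in> cfs R \<eta> (carrier R)" and y: "y \<in> carrier R" and x: "x \<in> weight_space n"
  shows "annihilable y x"
proof -
  obtain p where p: "p \<noteq> 0" "ev y p \<in> n" using ev_in_cfs_ideal[OF n y] by blast
  obtain N where N: "\<forall>a\<in>ideal_power n N. a \<odot>\<^bsub>M\<^esub> x = \<zero>\<^bsub>M\<^esub>" using x by (auto simp: mem_weight_space_iff)
  have "ev y (p ^ N) \<in> ideal_power n N"
    using pow_in_ideal_power[OF cfs_ideal[OF n] p(2)] y by (simp add: ev_power)
  then show ?thesis using N p(1) by (auto simp: annihilable_def intro!: exI[of _ "p ^ N"])
qed

text \<open>The eigenvalues of \<open>x\<close> define a point \<open>l\<close>, and nilpotency of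
  the finitely many shifted generators bounds a power of the ideal \<open>?n\<close> of that point
  that kills \<open>x\<close>. If \<open>?n\<close> is proper, \<open>x\<close> is a weight vector;
  otherwise \<open>x\<close> is zero.\<close>

lemma joint_generalized_eigenvector_in_subgroup:
  assumes D: "subgroup D (add_monoid M)" "\<And>n. n \<in> cfs R \<eta> (carrier R) \<Longrightarrow> weight_space n \<subseteq> D"
    and x: "x \<in> carrier M" "joint_generalized_eigenvector Y x"
  shows "x \<in> D"
proof -
  have "\<forall>y\<in>Y. \<exists>l. \<exists>m. ev y ([:- l, 1:] ^ m) \<odot>\<^bsub>M\<^esub> x = \<zero>\<^bsub>M\<^esub>"
    using x(2) by (simp add: joint_generalized_eigenvector_def)
  then obtain l where l: "\<forall>y\<in>Y. \<exists>m. ev y ([:- l y, 1:] ^ m) \<odot>\<^bsub>M\<^esub> x = \<zero>\<^bsub>M\<^esub>"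
    by (rule bchoice[THEN exE])
  let ?G = "(\<lambda>y. y \<ominus>\<^bsub>R\<^esub> \<eta> (l y)) ` Y"
  let ?n = "genideal R ?G"
  have G: "finite ?G" "?G \<subseteq> carrier R" using finite_Y Y_carrier by auto
  \<comment> \<open>The exponent is chosen for each element of \<open>?G\<close> and not for each
    \<open>y\<close>, since different generators may give the same shifted element.\<close>
  have "\<forall>g\<in>?G. \<exists>m::nat. g [^]\<^bsub>R\<^esub> m \<odot>\<^bsub>M\<^esub> x = \<zero>\<^bsub>M\<^esub>"
  proof clarify
    fix y assume y: "y \<in> Y"
    then obtain m where m: "ev y ([:- l y, 1:] ^ m) \<odot>\<^bsub>M\<^esub> x = \<zero>\<^bsub>M\<^esub>" using l by blast
    moreover have "ev y ([:- l y, 1:] ^ m) = (y \<ominus>\<^bsub>R\<^esub> \<eta> (l y)) [^]\<^bsub>R\<^esub> m"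
      using y Y_carrier by (simp add: subset_iff ev_power ev_linear)
    ultimately show "\<exists>m::nat. (y \<ominus>\<^bsub>R\<^esub> \<eta> (l y)) [^]\<^bsub>R\<^esub> m \<odot>\<^bsub>M\<^esub> x = \<zero>\<^bsub>M\<^esub>" by auto
  qed
  then obtain m :: "'r \<Rightarrow> nat" where m: "\<forall>g\<in>?G. g [^]\<^bsub>R\<^esub> m g \<odot>\<^bsub>M\<^esub> x = \<zero>\<^bsub>M\<^esub>"
    by (rule bchoice[THEN exE])
  let ?N = "Suc (sum m ?G)"
  have kill: "a \<odot>\<^bsub>M\<^esub> x = \<zero>\<^bsub>M\<^esub>" if "a \<in> ideal_power ?n ?N" for a
    using genideal_power_annihilates[OF G x(1) _ that] m by blast
  show ?thesis
  proof (cases "?n = carrier R")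
    \<comment> \<open>The eigenvalues violate a relation among the generators. The power of the
      ideal then contains 1, which kills \<open>x\<close>.\<close>
    case True
    then have "\<one>\<^bsub>R\<^esub> \<in> ?n" by simp
    then have "\<one>\<^bsub>R\<^esub> [^]\<^bsub>R\<^esub> ?N \<in> ideal_power ?n ?N"
      by (rule pow_in_ideal_power[OF R.genideal_ideal[OF G(2)]])
    then have "x = \<zero>\<^bsub>M\<^esub>" using kill[of "\<one>\<^bsub>R\<^esub>"] x(1) by (simp add: smult_one)
    then show ?thesis using subgroup.one_closed[OF D(1)] by simp
  next
    case False
    then have "?n \<in> cfs R \<eta> (carrier R)" by (rule point_ideal_in_cfs)
    moreover have "x \<in> weight_space ?n"
      using x(1) kill by (auto simp: mem_weight_space_iff)
    ultimately show ?thesis using D(2) by blast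
  qed
qed

section \<open>Independence of the weight spaces\<close>

text \<open>By maximality \<open>a\<close> is invertible modulo \<open>n\<close>, so 1 = c + b a
  with c in \<open>n\<close>. Hence \<open>x = c x = c^N x\<close>, and \<open>c^N\<close> lies in
  the power of \<open>n\<close> that kills \<open>x\<close>.\<close>

lemma weight_space_torsion_free:
  assumes n: "n \<in> cfs R \<eta> (carrier R)" and x: "x \<in> weight_space n"
    and a: "a \<in> carrier R" "a \<notin> n" "a \<odot>\<^bsub>M\<^esub> x = \<zero>\<^bsub>M\<^esub>"
  shows "x = \<zero>\<^bsub>M\<^esub>"
proof -
  interpret n: maximalideal n R using n by (simp add: mem_cfs_iff)
  obtain N where xc: "x \<in> carrier M" and N: "\<forall>a\<in>ideal_power n N. a \<odot>\<^bsub>M\<^esub> x = \<zero>\<^bsub>M\<^esub>"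
    using x by (auto simp: mem_weight_space_iff)
  let ?J = "n <+>\<^bsub>R\<^esub> cgenideal R a"
  have J: "ideal ?J R" by (rule R.add_ideals[OF n.ideal_axioms R.cgenideal_ideal[OF a(1)]])
  have P0: "\<zero>\<^bsub>R\<^esub> \<in> cgenideal R a"
    by (meson R.cgenideal_ideal a(1) additive_subgroup.zero_closed ideal.axioms(1))
  have sub: "n \<subseteq> ?J"
  proof
    fix c assume c: "c \<in> n"
    then have "c = c \<oplus>\<^bsub>R\<^esub> \<zero>\<^bsub>R\<^esub>" using n.Icarr by simp
    then show "c \<in> ?J" using c P0 unfolding set_add_def' by blast
  qed
  have "a = \<zero>\<^bsub>R\<^esub> \<oplus>\<^bsub>R\<^esub> a" using a(1) by simp
  then have "a \<in> ?J" using n.zero_closed R.cgenideal_self[OF a(1)] unfolding set_add_def' by blast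
  then have "?J \<noteq> n" using a(2) by blast
  then have "?J = carrier R" using n.I_maximal[OF J sub] ideal.Icarr[OF J] by blast
  then have "\<one>\<^bsub>R\<^esub> \<in> ?J" by simp
  then obtain c b where cb: "c \<in> n" "b \<in> carrier R" "\<one>\<^bsub>R\<^esub> = c \<oplus>\<^bsub>R\<^esub> b \<otimes>\<^bsub>R\<^esub> a"
    by (auto simp: set_add_def' cgenideal_def)
  have cc: "c \<in> carrier R" using cb(1) by (rule n.Icarr)
  have "x = (c \<oplus>\<^bsub>R\<^esub> b \<otimes>\<^bsub>R\<^esub> a) \<odot>\<^bsub>M\<^esub> x" using xc by (simp only: cb(3)[symmetric] smult_one)
  also have "\<dots> = c \<odot>\<^bsub>M\<^esub> x" using xc cc cb(2) a by (simp add: smult_l_distr smult_assoc smult_r_null smult_closed)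
  finally have cx: "c \<odot>\<^bsub>M\<^esub> x = x" by simp
  have "c [^]\<^bsub>R\<^esub> k \<odot>\<^bsub>M\<^esub> x = x" for k :: nat
    by (induction k) (simp_all add: xc cc smult_one smult_assoc cx)
  moreover have "c [^]\<^bsub>R\<^esub> N \<in> ideal_power n N" by (rule pow_in_ideal_power[OF n.ideal_axioms cb(1)])
  ultimately show ?thesis using N by metis
qed

text \<open>A product of powers of elements of the sets \<open>j - n\<close>; it stays outside \<open>n\<close> because \<open>n\<close> is prime.\<close>

lemma separating_element:
  assumes n: "n \<in> cfs R \<eta> (carrier R)" and "finite F" "F \<subseteq> cfs R \<eta> (carrier R)" "n \<notin> F"
    and "\<And>j. j \<in> F \<Longrightarrow> w j \<in> weight_space j"
  shows "\<exists>a\<in>carrier R. a \<notin> n \<and> (\<forall>j\<in>F. a \<odot>\<^bsub>M\<^esub> w j = \<zero>\<^bsub>M\<^esub>)"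
  using assms(2-)
proof (induction F rule: finite_induct)
  case empty
  interpret n: maximalideal n R using n by (simp add: mem_cfs_iff)
  have "\<one>\<^bsub>R\<^esub> \<notin> n" using n.I_notcarr n.one_imp_carrier by blast
  then show ?case by blast
next
  case (insert j F)
  interpret n: maximalideal n R using n by (simp add: mem_cfs_iff)
  interpret np: primeideal n R by (rule R.maximalideal_prime[OF n.maximalideal_axioms])
  interpret j: maximalideal j R using insert.prems by (simp add: mem_cfs_iff)
  obtain a where a: "a \<in> carrier R" "a \<notin> n" "\<forall>i\<in>F. a \<odot>\<^bsub>M\<^esub> w i = \<zero>\<^bsub>M\<^esub>"
    using insert.IH insert.prems by auto
  \<comment> \<open>An inclusion between distinct maximal ideals is impossible.\<close>
  have "\<not> j \<subseteq> n"
    using j.I_maximal[OF n.ideal_axioms] n.I_notcarr insert.prems(2) n.Icarr by blast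
  then obtain c where c: "c \<in> j" "c \<notin> n" by blast
  have cc: "c \<in> carrier R" using c(1) by (rule j.Icarr)
  have wj: "w j \<in> weight_space j" using insert.prems by simp
  then obtain N where N: "\<forall>a\<in>ideal_power j N. a \<odot>\<^bsub>M\<^esub> w j = \<zero>\<^bsub>M\<^esub>"
    by (auto simp: mem_weight_space_iff)
  have wc: "w i \<in> carrier M" if "i \<in> insert j F" for i
    using insert.prems(3)[OF that] by (simp add: mem_weight_space_iff)
  have "\<one>\<^bsub>R\<^esub> \<notin> n" using n.I_notcarr n.one_imp_carrier by blast
  then have cn: "c [^]\<^bsub>R\<^esub> k \<notin> n" for k :: nat
  proof (induction k)
    case (Suc k)
    then show ?case using np.I_prime[of "c [^]\<^bsub>R\<^esub> k" c] c(2) cc by auto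
  qed simp
  define u where "u = c [^]\<^bsub>R\<^esub> N"
  have u: "u \<in> carrier R" "u \<notin> n" "u \<odot>\<^bsub>M\<^esub> w j = \<zero>\<^bsub>M\<^esub>"
    using cc cn[of N] N pow_in_ideal_power[OF j.ideal_axioms c(1), of N] by (simp_all add: u_def)
  have "u \<otimes>\<^bsub>R\<^esub> a \<notin> n" using np.I_prime[OF u(1) a(1)] u(2) a(2) by blast
  moreover have "u \<otimes>\<^bsub>R\<^esub> a \<in> carrier R" using u(1) a(1) by simp
  moreover have "\<forall>i\<in>insert j F. (u \<otimes>\<^bsub>R\<^esub> a) \<odot>\<^bsub>M\<^esub> w i = \<zero>\<^bsub>M\<^esub>"
  proof
    fix i assume i: "i \<in> insert j F"
    show "(u \<otimes>\<^bsub>R\<^esub> a) \<odot>\<^bsub>M\<^esub> w i = \<zero>\<^bsub>M\<^esub>"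
    proof (cases "i = j")
      case True
      have "(u \<otimes>\<^bsub>R\<^esub> a) \<odot>\<^bsub>M\<^esub> w j = a \<odot>\<^bsub>M\<^esub> (u \<odot>\<^bsub>M\<^esub> w j)"
        using u(1) a(1) wc[of j] by (simp add: smult_assoc smult_commute[of u a])
      then show ?thesis using True u(3) a(1) by (simp add: smult_r_null)
    next
      case False
      then have "a \<odot>\<^bsub>M\<^esub> w i = \<zero>\<^bsub>M\<^esub>" using i a(3) by blast
      then show ?thesis using u(1) a(1) wc[OF i] by (simp add: smult_assoc smult_r_null)
    qed
  qed
  ultimately show ?case by blast
qed

text \<open>Multiplying the relation by an element outside \<open>i\<close> that kills all the other
  summands leaves only the multiple of \<open>w i\<close>, and that element acts injectively on the
  weight space of \<open>i\<close>.\<close>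

lemma weight_spaces_independent:
  assumes F: "finite F" "F \<subseteq> cfs R \<eta> (carrier R)" and w: "\<And>j. j \<in> F \<Longrightarrow> w j \<in> weight_space j"
    and sum0: "finsum M w F = \<zero>\<^bsub>M\<^esub>" and i: "i \<in> F"
  shows "w i = \<zero>\<^bsub>M\<^esub>"
proof -
  have wc: "w j \<in> carrier M" if "j \<in> F" for j
    using w[OF that] by (simp add: mem_weight_space_iff)
  obtain a where a: "a \<in> carrier R" "a \<notin> i" "\<forall>j\<in>F - {i}. a \<odot>\<^bsub>M\<^esub> w j = \<zero>\<^bsub>M\<^esub>"
  proof -
    have "\<exists>a\<in>carrier R. a \<notin> i \<and> (\<forall>j\<in>F - {i}. a \<odot>\<^bsub>M\<^esub> w j = \<zero>\<^bsub>M\<^esub>)"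
      by (rule separating_element) (use F i w in auto)
    then show ?thesis using that by blast
  qed
  have "\<zero>\<^bsub>M\<^esub> = a \<odot>\<^bsub>M\<^esub> finsum M w F" using a by (simp add: sum0 smult_r_null)
  also have "\<dots> = finsum M (\<lambda>j. a \<odot>\<^bsub>M\<^esub> w j) F" using a wc by (intro smult_finsum) auto
  also have "\<dots> = finsum M (\<lambda>j. if i = j then a \<odot>\<^bsub>M\<^esub> w j else \<zero>\<^bsub>M\<^esub>) F"
    using a wc by (intro M.finsum_cong') (auto simp: smult_closed)
  also have "\<dots> = a \<odot>\<^bsub>M\<^esub> w i"
    using F i a wc by (intro M.finsum_singleton) (auto simp: smult_closed)
  finally show ?thesis using weight_space_torsion_free[OF _ w[OF i] a(1,2)] F i by auto
qed

section \<open>The direct sum decomposition\<close>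

abbreviation weight_sum :: "('r set \<Rightarrow> 'm) monoid" where
  "weight_sum \<equiv> sum_group (cfs R \<eta> (carrier R)) (\<lambda>n. add_monoid M\<lparr>carrier := weight_space n\<rparr>)"

text \<open>\<open>gfinprod\<close> sums over the support only. The index set may be infinite, where
  \<open>finsum\<close> over the whole of it would default to zero.\<close>

abbreviation weight_sum_map :: "('r set \<Rightarrow> 'm) \<Rightarrow> 'm" where
  "weight_sum_map \<equiv> \<lambda>f. gfinprod (add_monoid M) f (cfs R \<eta> (carrier R))"

lemma group_weight_space:
  "n \<in> cfs R \<eta> (carrier R) \<Longrightarrow> group (add_monoid M\<lparr>carrier := weight_space n\<rparr>)"
  by (rule group.subgroup_imp_group[OF M.a_group subgroup_weight_space[OF cfs_ideal]])

lemma mem_carrier_weight_sum_iff: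
  "f \<in> carrier weight_sum \<longleftrightarrow>
    f \<in> (\<Pi>\<^sub>E n\<in>cfs R \<eta> (carrier R). weight_space n) \<and>
    finite {n \<in> cfs R \<eta> (carrier R). f n \<noteq> \<zero>\<^bsub>M\<^esub>}"
proof -
  have "carrier weight_sum = {x \<in> \<Pi>\<^sub>E n\<in>cfs R \<eta> (carrier R). carrier (add_monoid M\<lparr>carrier := weight_space n\<rparr>).
      finite {n \<in> cfs R \<eta> (carrier R). x n \<noteq> \<one>\<^bsub>add_monoid M\<lparr>carrier := weight_space n\<rparr>\<^esub>}}"
    by (rule carrier_sum_group) (rule group_weight_space)
  then show ?thesis by simp
qed

lemma weight_sum_map_eq:
  assumes "f \<in> carrier weight_sum"
  shows "weight_sum_map f = finsum M f {n \<in> cfs R \<eta> (carrier R). f n \<noteq> \<zero>\<^bsub>M\<^esub>}"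
  using assms unfolding mem_carrier_weight_sum_iff by (simp add: gfinprod_def finsum_def)

lemma group_hom_weight_sum_map: "group_hom weight_sum (add_monoid M) weight_sum_map"
proof -
  have "(\<lambda>x. x) \<in> hom (add_monoid M\<lparr>carrier := weight_space n\<rparr>) (add_monoid M)" for n
    by (auto simp: hom_def mem_weight_space_iff)
  then have "weight_sum_map \<in> hom weight_sum (add_monoid M)"
    using comm_group.hom_group_sum[OF M.a_comm_group, of "cfs R \<eta> (carrier R)" "\<lambda>_ x. x"
        "\<lambda>n. add_monoid M\<lparr>carrier := weight_space n\<rparr>"] group_weight_space by simp
  moreover have "group weight_sum" by (rule sum_group) (rule group_weight_space)
  ultimately show ?thesis
    by (simp add: group_hom_def group_hom_axioms_def M.a_group)
qed

lemma inj_on_weight_sum_map: "inj_on weight_sum_map (carrier weight_sum)"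
  unfolding group_hom.inj_on_one_iff[OF group_hom_weight_sum_map]
proof (intro allI impI)
  fix f assume f: "f \<in> carrier weight_sum" and f0: "weight_sum_map f = \<one>\<^bsub>add_monoid M\<^esub>"
  let ?I = "cfs R \<eta> (carrier R)"
  let ?F = "{n \<in> ?I. f n \<noteq> \<zero>\<^bsub>M\<^esub>}"
  have fw: "f \<in> (\<Pi>\<^sub>E n\<in>?I. weight_space n)" and fin: "finite ?F"
    using f unfolding mem_carrier_weight_sum_iff by blast+
  have s0: "finsum M f ?F = \<zero>\<^bsub>M\<^esub>" using f0 weight_sum_map_eq[OF f] by simp
  have "f n = \<zero>\<^bsub>M\<^esub>" if n: "n \<in> ?I" for n
  proof (rule ccontr)
    assume nz: "f n \<noteq> \<zero>\<^bsub>M\<^esub>"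
    have "f n = \<zero>\<^bsub>M\<^esub>"
    proof (rule weight_spaces_independent[OF fin _ _ s0])
      show "?F \<subseteq> ?I" "n \<in> ?F" using n nz by auto
      show "f j \<in> weight_space j" if "j \<in> ?F" for j using fw that by (auto simp: PiE_iff)
    qed
    then show False using nz by simp
  qed
  then show "f = \<one>\<^bsub>weight_sum\<^esub>"
    using fw by (intro extensionalityI[of _ ?I]) (auto simp: PiE_iff)
qed

lemma weight_space_subset_image:
  assumes n: "n \<in> cfs R \<eta> (carrier R)"
  shows "weight_space n \<subseteq> weight_sum_map ` carrier weight_sum"
proof
  fix x assume x: "x \<in> weight_space n"
  let ?I = "cfs R \<eta> (carrier R)"
  define f where "f = (\<lambda>i\<in>?I. if i = n then x else \<zero>\<^bsub>M\<^esub>)"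
  have xc: "x \<in> carrier M" using x by (simp add: mem_weight_space_iff)
  \<comment> \<open>For \<open>x = 0\<close> the support is empty and not
    \<open>{n}\<close>.\<close>
  have supp: "{i \<in> ?I. f i \<noteq> \<zero>\<^bsub>M\<^esub>} = (if x = \<zero>\<^bsub>M\<^esub> then {} else {n})"
    using n by (auto simp: f_def)
  have "\<zero>\<^bsub>M\<^esub> \<in> weight_space i" if "i \<in> ?I" for i
    using subgroup.one_closed[OF subgroup_weight_space[OF cfs_ideal[OF that]]] by simp
  then have f: "f \<in> carrier weight_sum"
    unfolding mem_carrier_weight_sum_iff supp using x by (auto simp: f_def)
  have "weight_sum_map f = x"
    unfolding weight_sum_map_eq[OF f] supp using xc n by (simp add: f_def)
  then show "x \<in> weight_sum_map ` carrier weight_sum" using f by blast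
qed

text \<open>From left to right only surjectivity depends on local finiteness; injectivity holds for
  every module. From right to left a vector is a finite sum of weight vectors, and such sums inherit
  annihilating polynomials.\<close>

theorem locally_finite_iff_weight_decomposition:
  "(\<forall>v\<in>carrier M. fin_gen M (range \<eta>) {a \<odot>\<^bsub>M\<^esub> v | a. a \<in> carrier R}) \<longleftrightarrow>
    internal_direct_sum M (cfs R \<eta> (carrier R)) weight_space"
proof
  assume lf: "\<forall>v\<in>carrier M. fin_gen M (range \<eta>) {a \<odot>\<^bsub>M\<^esub> v | a. a \<in> carrier R}"
  interpret h: group_hom weight_sum "add_monoid M" weight_sum_map
    by (rule group_hom_weight_sum_map)
  have "carrier M \<subseteq> weight_sum_map ` carrier weight_sum"
  proof
    fix v assume v: "v \<in> carrier M"
    show "v \<in> weight_sum_map ` carrier weight_sum"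
    \<comment> \<open>The subgroup \<open>D\<close> of the splitting lemmas becomes the image of the
      external direct sum, which contains every weight space.\<close>
    proof (rule split_annihilable[OF h.img_is_subgroup finite_Y Y_carrier v])
      show "\<forall>y\<in>Y. annihilable y v"
        using annihilable_of_fin_gen[OF _ v] lf v Y_carrier by blast
      fix a assume a: "a \<in> carrier R" "joint_generalized_eigenvector Y (a \<odot>\<^bsub>M\<^esub> v)"
      show "a \<odot>\<^bsub>M\<^esub> v \<in> weight_sum_map ` carrier weight_sum"
        by (rule joint_generalized_eigenvector_in_subgroup[OF h.img_is_subgroup weight_space_subset_image
              smult_closed[OF a(1) v] a(2)])
    qed
  qed
  moreover have "weight_sum_map ` carrier weight_sum \<subseteq> carrier M"
    using h.hom_closed by auto
  ultimately have "weight_sum_map \<in> iso weight_sum (add_monoid M)"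
    using inj_on_weight_sum_map h.homh by (auto simp: iso_def bij_betw_def)
  then show "internal_direct_sum M (cfs R \<eta> (carrier R)) weight_space"
    unfolding internal_direct_sum_def using subgroup_weight_space[OF cfs_ideal] by blast
next
  assume ds: "internal_direct_sum M (cfs R \<eta> (carrier R)) weight_space"
  show "\<forall>v\<in>carrier M. fin_gen M (range \<eta>) {a \<odot>\<^bsub>M\<^esub> v | a. a \<in> carrier R}"
  proof
    fix v assume v: "v \<in> carrier M"
    have "weight_sum_map ` carrier weight_sum = carrier M"
      using ds by (simp add: internal_direct_sum_def iso_def bij_betw_def)
    then obtain f where f: "f \<in> carrier weight_sum" "v = weight_sum_map f" using v by blast
    show "fin_gen M (range \<eta>) {a \<odot>\<^bsub>M\<^esub> v | a. a \<in> carrier R}"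
    proof (rule fin_gen_of_annihilable[OF v])
      fix y assume "y \<in> Y"
      then have y: "y \<in> carrier R" using Y_carrier by blast
      have "finsum M f {n \<in> cfs R \<eta> (carrier R). f n \<noteq> \<zero>\<^bsub>M\<^esub>} \<in> {x \<in> carrier M. annihilable y x}"
      proof (rule finsum_in_subgroup[OF subgroup_annihilable[OF y]])
        have "f n \<in> weight_space n" if "n \<in> cfs R \<eta> (carrier R)" for n
          using f(1) that unfolding mem_carrier_weight_sum_iff by (auto simp: PiE_iff)
        then show "f \<in> {n \<in> cfs R \<eta> (carrier R). f n \<noteq> \<zero>\<^bsub>M\<^esub>} \<rightarrow> {x \<in> carrier M. annihilable y x}"
          using annihilable_weight_space[OF _ y] mem_weight_space_iff by blast
      qed
      then show "annihilable y v" unfolding f(2) weight_sum_map_eq[OF f(1)] by blast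
    qed
  qed
qed

end

section \<open>Tensor algebras\<close>

lemma free_algebra_simps:
  "carrier (free_algebra V) = {p. Poly_Mapping.keys p \<subseteq> lists V}"
  "p \<otimes>\<^bsub>free_algebra V\<^esub> q = p * q" "\<one>\<^bsub>free_algebra V\<^esub> = 1"
  "\<zero>\<^bsub>free_algebra V\<^esub> = 0" "p \<oplus>\<^bsub>free_algebra V\<^esub> q = p + q"
  by (simp_all add: free_algebra_def)

lemma ring_free_algebra: "ring (free_algebra V)"
proof (rule ringI)
  show "abelian_group (free_algebra V)"
  proof (rule abelian_groupI)
    fix p q assume "p \<in> carrier (free_algebra V)" "q \<in> carrier (free_algebra V)"
    then show "p \<oplus>\<^bsub>free_algebra V\<^esub> q \<in> carrier (free_algebra V)"
      using Poly_Mapping.keys_add[of p q] by (auto simp: free_algebra_simps)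
  next
    fix p assume "p \<in> carrier (free_algebra V)"
    then show "\<exists>q\<in>carrier (free_algebra V). q \<oplus>\<^bsub>free_algebra V\<^esub> p = \<zero>\<^bsub>free_algebra V\<^esub>"
      by (intro bexI[of _ "- p"]) (auto simp: free_algebra_simps in_keys_iff subset_iff)
  qed (simp_all add: free_algebra_simps ac_simps)
  show "Group.monoid (free_algebra V)"
  proof (rule monoidI)
    fix p q assume "p \<in> carrier (free_algebra V)" "q \<in> carrier (free_algebra V)"
    then show "p \<otimes>\<^bsub>free_algebra V\<^esub> q \<in> carrier (free_algebra V)"
      using Poly_Mapping.keys_mult[of p q] by (fastforce simp: free_algebra_simps plus_list_def)
  qed (simp_all add: free_algebra_simps mult.assoc zero_list_def)
qed (simp_all add: free_algebra_simps distrib_left distrib_right)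

lemma free_algebra_minus:
  assumes "p \<in> carrier (free_algebra V)" "q \<in> carrier (free_algebra V)"
  shows "p \<ominus>\<^bsub>free_algebra V\<^esub> q = p - q"
proof -
  interpret ring "free_algebra V" by (rule ring_free_algebra)
  have "- q \<in> carrier (free_algebra V)"
    using assms(2) by (auto simp: free_algebra_simps in_keys_iff subset_iff)
  then have "\<ominus>\<^bsub>free_algebra V\<^esub> q = - q"
    using assms(2) by (intro minus_equality) (auto simp: free_algebra_simps)
  then show ?thesis by (simp add: a_minus_def free_algebra_simps)
qed

lemma single_in_free_algebra: "set u \<subseteq> V \<Longrightarrow> Poly_Mapping.single u a \<in> carrier (free_algebra V)"
  by (auto simp: free_algebra_simps)

text \<open>Enlarging the index set by words with zero coefficient lets sums for several polynomials
  run over one common set and be compared termwise.\<close>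

lemma free_map_superset:
  assumes "finite A" "Poly_Mapping.keys p \<subseteq> A"
  shows "free_map g p = (\<Sum>u\<in>A. Poly_Mapping.single (map g u) (Poly_Mapping.lookup p u))"
  unfolding free_map_def using assms by (intro sum.mono_neutral_left) (auto simp: in_keys_iff)

lemma free_map_add: "free_map g (p + q) = free_map g p + free_map g q"
proof -
  let ?A = "Poly_Mapping.keys p \<union> Poly_Mapping.keys q"
  have "Poly_Mapping.keys (p + q) \<subseteq> ?A" by (rule Poly_Mapping.keys_add)
  then show ?thesis
    by (subst (1 2 3) free_map_superset[of ?A])
      (auto simp: lookup_add single_add sum.distrib)
qed

lemma free_map_single: "free_map g (Poly_Mapping.single u a) = Poly_Mapping.single (map g u) a"
  by (cases "a = 0") (simp_all add: free_map_def)

lemma free_map_sum: "free_map g (sum f A) = (\<Sum>i\<in>A. free_map g (f i))"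
proof (induction A rule: infinite_finite_induct)
  case (insert i A)
  then show ?case by (simp add: free_map_add)
qed (simp_all add: free_map_def)

lemma sum_single_keys:
  "(\<Sum>u\<in>Poly_Mapping.keys p. Poly_Mapping.single u (Poly_Mapping.lookup p u)) = p"
  by (rule poly_mapping_eqI) (auto simp: lookup_sum lookup_single when_def in_keys_iff)

lemma free_map_mult: "free_map g (p * q) = free_map g p * free_map g q"
proof -
  let ?s = "\<lambda>p u. Poly_Mapping.single u (Poly_Mapping.lookup p u)"
  let ?t = "\<lambda>p u. Poly_Mapping.single (map g u) (Poly_Mapping.lookup p u)"
  have "p * q = (\<Sum>u\<in>Poly_Mapping.keys p. ?s p u) * (\<Sum>v\<in>Poly_Mapping.keys q. ?s q v)"
    by (simp only: sum_single_keys)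
  also have "\<dots> = (\<Sum>u\<in>Poly_Mapping.keys p. \<Sum>v\<in>Poly_Mapping.keys q. ?s p u * ?s q v)"
    by (rule sum_product)
  finally have "free_map g (p * q) = (\<Sum>u\<in>Poly_Mapping.keys p. \<Sum>v\<in>Poly_Mapping.keys q.
      free_map g (?s p u * ?s q v))"
    by (simp only: free_map_sum)
  also have "\<dots> = (\<Sum>u\<in>Poly_Mapping.keys p. \<Sum>v\<in>Poly_Mapping.keys q. ?t p u * ?t q v)"
    by (simp add: mult_single free_map_single plus_list_def)
  also have "\<dots> = free_map g p * free_map g q"
    unfolding free_map_def by (rule sum_product[symmetric])
  finally show ?thesis .
qed

lemma free_map_id: "free_map id p = p"
  by (simp add: free_map_def sum_single_keys)

lemma free_map_cong:
  assumes "p \<in> carrier (free_algebra V)" "\<And>v. v \<in> V \<Longrightarrow> g v = h v"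
  shows "free_map g p = free_map h p"
proof -
  have "map g u = map h u" if "u \<in> Poly_Mapping.keys p" for u
    using assms that by (auto simp: free_algebra_simps)
  then show ?thesis unfolding free_map_def by (intro sum.cong refl) (simp only:)
qed

lemma free_map_comp: "free_map g (free_map h p) = free_map (g \<circ> h) p"
proof -
  have "free_map g (free_map h p) = (\<Sum>u\<in>Poly_Mapping.keys p.
      free_map g (Poly_Mapping.single (map h u) (Poly_Mapping.lookup p u)))"
    by (simp only: free_map_def[of h] free_map_sum)
  then show ?thesis by (simp add: free_map_single free_map_def[of "g \<circ> h"])
qed

lemma free_map_ring_hom:
  assumes "g ` V \<subseteq> V'"
  shows "free_map g \<in> ring_hom (free_algebra V) (free_algebra V')"
proof (rule ring_hom_memI)
  fix p assume p: "p \<in> carrier (free_algebra V)"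
  have "free_map g p = (\<Sum>u\<in>Poly_Mapping.keys p. Poly_Mapping.single (map g u) (Poly_Mapping.lookup p u))"
    by (simp add: free_map_def)
  also have "Poly_Mapping.keys \<dots> \<subseteq> lists V'"
  proof
    fix w assume "w \<in> Poly_Mapping.keys (\<Sum>u\<in>Poly_Mapping.keys p.
        Poly_Mapping.single (map g u) (Poly_Mapping.lookup p u))"
    then obtain u where "u \<in> Poly_Mapping.keys p" "w = map g u"
      using Poly_Mapping.keys_sum by (fastforce split: if_splits)
    moreover from this have "set u \<subseteq> V" using p by (auto simp: free_algebra_simps)
    ultimately show "w \<in> lists V'" using assms by (auto simp: image_subset_iff subset_iff)
  qed
  finally show "free_map g p \<in> carrier (free_algebra V')" by (simp add: free_algebra_simps)
next
  have "free_map g (Poly_Mapping.single [] 1) = Poly_Mapping.single [] 1" by (simp add: free_map_single)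
  then show "free_map g \<one>\<^bsub>free_algebra V\<^esub> = \<one>\<^bsub>free_algebra V'\<^esub>"
    by (simp add: free_algebra_simps zero_list_def[symmetric])
qed (simp_all add: free_algebra_simps free_map_add free_map_mult)

section \<open>The tensor algebra as a quotient, and its functoriality\<close>

text \<open>\<open>V\<close> is a set and not a whole type because linear forms are only some of the
  functions. The closure conditions put the linear relations inside the free algebra on
  \<open>V\<close>, so that they generate an ideal.\<close>

locale complex_vector_set =
  fixes V :: "'a::ab_group_add set" and sc :: "complex \<Rightarrow> 'a \<Rightarrow> 'a"
  assumes add_closed: "v \<in> V \<Longrightarrow> w \<in> V \<Longrightarrow> v + w \<in> V"
    and scale_closed: "v \<in> V \<Longrightarrow> sc a v \<in> V"
begin

definition linear_relations :: "('a list \<Rightarrow>\<^sub>0 complex) set" where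
  "linear_relations =
    {Poly_Mapping.single [v + w] 1 - Poly_Mapping.single [v] 1 - Poly_Mapping.single [w] 1
       | v w. v \<in> V \<and> w \<in> V} \<union>
    {Poly_Mapping.single [sc a v] 1 - Poly_Mapping.single [v] a | a v. v \<in> V}"

lemma tensor_ideal_eq: "tensor_ideal V sc = genideal (free_algebra V) linear_relations"
  by (simp add: tensor_ideal_def linear_relations_def)

sublocale F: ring "free_algebra V"
  by (rule ring_free_algebra)

lemma diff_closed:
  assumes "p \<in> carrier (free_algebra V)" "q \<in> carrier (free_algebra V)"
  shows "p - q \<in> carrier (free_algebra V)"
  using F.minus_closed[OF assms] free_algebra_minus[OF assms] by simp

lemma linear_relations_closed: "linear_relations \<subseteq> carrier (free_algebra V)"
  unfolding linear_relations_def
  by (auto intro!: diff_closed single_in_free_algebra add_closed scale_closed)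

lemma linear_relations_in_ideal: "linear_relations \<subseteq> tensor_ideal V sc"
  unfolding tensor_ideal_eq by (rule F.genideal_self[OF linear_relations_closed])

sublocale J: ideal "tensor_ideal V sc" "free_algebra V"
  unfolding tensor_ideal_eq by (rule F.genideal_ideal[OF linear_relations_closed])

sublocale T: ring "tensor_algebra V sc"
  unfolding tensor_algebra_def by (rule J.quotient_is_ring)

lemma coset_ring_hom:
  "(+>\<^bsub>free_algebra V\<^esub>) (tensor_ideal V sc) \<in> ring_hom (free_algebra V) (tensor_algebra V sc)"
  unfolding tensor_algebra_def by (rule J.rcos_ring_hom)

lemma mem_tensor_algebra_iff:
  "X \<in> carrier (tensor_algebra V sc) \<longleftrightarrow>
    (\<exists>p\<in>carrier (free_algebra V). X = tensor_ideal V sc +>\<^bsub>free_algebra V\<^esub> p)"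
  unfolding tensor_algebra_def by (rule mem_carrier_FactRing_iff)

lemma coset_eqI:
  assumes "p \<in> carrier (free_algebra V)" "q \<in> carrier (free_algebra V)" "p - q \<in> tensor_ideal V sc"
  shows "tensor_ideal V sc +>\<^bsub>free_algebra V\<^esub> p = tensor_ideal V sc +>\<^bsub>free_algebra V\<^esub> q"
  using assms F.quotient_eq_iff_same_a_r_cos[OF J.ideal_axioms] free_algebra_minus by metis

lemma tensor_of_add:
  assumes "v \<in> V" "w \<in> V"
  shows "tensor_of V sc (v + w) = tensor_of V sc v \<oplus>\<^bsub>tensor_algebra V sc\<^esub> tensor_of V sc w"
proof -
  let ?x = "Poly_Mapping.single [v] 1" and ?y = "Poly_Mapping.single [w] 1"
  have c: "?x \<in> carrier (free_algebra V)" "?y \<in> carrier (free_algebra V)"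
    using assms by (auto intro!: single_in_free_algebra)
  have "Poly_Mapping.single [v + w] 1 - (?x + ?y) \<in> tensor_ideal V sc"
    using linear_relations_in_ideal assms by (auto simp: linear_relations_def diff_diff_eq)
  moreover have "Poly_Mapping.single [v + w] 1 \<in> carrier (free_algebra V)"
    using assms by (auto intro!: single_in_free_algebra add_closed)
  moreover have "?x + ?y \<in> carrier (free_algebra V)"
    using F.a_closed[OF c] by (simp add: free_algebra_simps(5))
  ultimately have "tensor_of V sc (v + w) = tensor_ideal V sc +>\<^bsub>free_algebra V\<^esub> (?x + ?y)"
    unfolding tensor_of_def by (intro coset_eqI)
  then show ?thesis
    using ring_hom_add[OF coset_ring_hom c] by (simp add: tensor_of_def free_algebra_simps(5))
qed

lemma tensor_of_scale:
  assumes "v \<in> V"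
  shows "tensor_of V sc (sc a v) = tensor_scalar V sc a \<otimes>\<^bsub>tensor_algebra V sc\<^esub> tensor_of V sc v"
proof -
  let ?x = "Poly_Mapping.single [v] 1" and ?a = "Poly_Mapping.single [] a"
  have c: "?a \<in> carrier (free_algebra V)" "?x \<in> carrier (free_algebra V)"
    using assms by (auto intro!: single_in_free_algebra)
  have ax: "?a * ?x = Poly_Mapping.single [v] a" by (simp add: mult_single plus_list_def)
  have "Poly_Mapping.single [sc a v] 1 - ?a * ?x \<in> tensor_ideal V sc"
    unfolding ax using linear_relations_in_ideal assms by (auto simp: linear_relations_def)
  moreover have "Poly_Mapping.single [sc a v] 1 \<in> carrier (free_algebra V)"
    using assms by (auto intro!: single_in_free_algebra scale_closed)
  moreover have "?a * ?x \<in> carrier (free_algebra V)"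
    using F.m_closed[OF c] by (simp add: free_algebra_simps(2))
  ultimately have "tensor_of V sc (sc a v) = tensor_ideal V sc +>\<^bsub>free_algebra V\<^esub> (?a * ?x)"
    unfolding tensor_of_def by (intro coset_eqI)
  then show ?thesis
    using ring_hom_mult[OF coset_ring_hom c]
    by (simp add: tensor_of_def tensor_scalar_def free_algebra_simps(2))
qed

lemma tensor_of_closed: "v \<in> V \<Longrightarrow> tensor_of V sc v \<in> carrier (tensor_algebra V sc)"
  unfolding mem_tensor_algebra_iff tensor_of_def
  by (auto intro!: bexI[of _ "Poly_Mapping.single [v] 1"] single_in_free_algebra)

lemma scalar_in_free_algebra: "Poly_Mapping.single [] a \<in> carrier (free_algebra V)"
  by (auto intro!: single_in_free_algebra)

lemma tensor_scalar_closed: "tensor_scalar V sc a \<in> carrier (tensor_algebra V sc)"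
  unfolding mem_tensor_algebra_iff tensor_scalar_def using scalar_in_free_algebra by blast

lemma tensor_scalar_one: "tensor_scalar V sc 1 = \<one>\<^bsub>tensor_algebra V sc\<^esub>"
  using ring_hom_one[OF coset_ring_hom]
  by (simp add: tensor_scalar_def free_algebra_simps zero_list_def[symmetric])

lemma tensor_scalar_add:
  "tensor_scalar V sc (a + b) = tensor_scalar V sc a \<oplus>\<^bsub>tensor_algebra V sc\<^esub> tensor_scalar V sc b"
  using ring_hom_add[OF coset_ring_hom scalar_in_free_algebra scalar_in_free_algebra]
  by (simp add: tensor_scalar_def free_algebra_simps(5) single_add)

lemma tensor_scalar_mult:
  "tensor_scalar V sc (a * b) = tensor_scalar V sc a \<otimes>\<^bsub>tensor_algebra V sc\<^esub> tensor_scalar V sc b"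
  using ring_hom_mult[OF coset_ring_hom scalar_in_free_algebra scalar_in_free_algebra, of a b]
  by (simp add: tensor_scalar_def free_algebra_simps(2) mult_single plus_list_def)

lemma tensor_scalar_commute:
  assumes "v \<in> V"
  shows "tensor_scalar V sc a \<otimes>\<^bsub>tensor_algebra V sc\<^esub> tensor_of V sc v =
    tensor_of V sc v \<otimes>\<^bsub>tensor_algebra V sc\<^esub> tensor_scalar V sc a"
proof -
  have v: "Poly_Mapping.single [v] 1 \<in> carrier (free_algebra V)"
    using assms by (auto intro!: single_in_free_algebra)
  show ?thesis
    using ring_hom_mult[OF coset_ring_hom scalar_in_free_algebra v, of a]
      ring_hom_mult[OF coset_ring_hom v scalar_in_free_algebra, of a]
    by (simp add: tensor_scalar_def tensor_of_def free_algebra_simps(2) mult_single plus_list_def)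
qed

definition linear_endo :: "('a \<Rightarrow> 'a) \<Rightarrow> bool" where
  "linear_endo g \<longleftrightarrow> g ` V \<subseteq> V \<and> (\<forall>v\<in>V. \<forall>w\<in>V. g (v + w) = g v + g w) \<and>
    (\<forall>a. \<forall>v\<in>V. g (sc a v) = sc a (g v))"

lemma free_map_diff: "free_map g (p - q) = free_map g p - free_map g q"
  using free_map_add[of g "p - q" q] by simp

text \<open>A linear \<open>g\<close> sends linear relations to linear relations. The preimage of
  the tensor ideal is thus an ideal containing its generators, and minimality gives the
  inclusion.\<close>

lemma free_map_tensor_ideal:
  assumes g: "linear_endo g" and p: "p \<in> tensor_ideal V sc"
  shows "free_map g p \<in> tensor_ideal V sc"
proof -
  have gV: "g ` V \<subseteq> V" using g by (simp add: linear_endo_def)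
  interpret h: ring_hom_ring "free_algebra V" "free_algebra V" "free_map g"
    by (rule ring_hom_ringI2[OF F.ring_axioms F.ring_axioms free_map_ring_hom[OF gV]])
  have "ideal {p \<in> carrier (free_algebra V). free_map g p \<in> tensor_ideal V sc} (free_algebra V)"
    by (rule h.ideal_vimage[OF J.ideal_axioms])
  moreover have "linear_relations \<subseteq> {p \<in> carrier (free_algebra V). free_map g p \<in> tensor_ideal V sc}"
  proof
    fix r assume r: "r \<in> linear_relations"
    then have "free_map g r \<in> linear_relations"
    proof (unfold linear_relations_def, elim UnE)
      assume "r \<in> {Poly_Mapping.single [v + w] 1 - Poly_Mapping.single [v] 1 - Poly_Mapping.single [w] 1
         | v w. v \<in> V \<and> w \<in> V}"
      then obtain v w where vw: "v \<in> V" "w \<in> V"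
        "r = Poly_Mapping.single [v + w] 1 - Poly_Mapping.single [v] 1 - Poly_Mapping.single [w] 1" by blast
      then have "free_map g r = Poly_Mapping.single [g v + g w] 1 - Poly_Mapping.single [g v] 1
          - Poly_Mapping.single [g w] 1" "g v \<in> V" "g w \<in> V"
        using g by (auto simp: free_map_diff free_map_single linear_endo_def)
      then show "free_map g r \<in> {Poly_Mapping.single [v + w] 1 - Poly_Mapping.single [v] 1 - Poly_Mapping.single [w] 1
         | v w. v \<in> V \<and> w \<in> V} \<union> {Poly_Mapping.single [sc a v] 1 - Poly_Mapping.single [v] a | a v. v \<in> V}"
        by blast
    next
      assume "r \<in> {Poly_Mapping.single [sc a v] 1 - Poly_Mapping.single [v] a | a v. v \<in> V}"
      then obtain a v where av: "v \<in> V" "r = Poly_Mapping.single [sc a v] 1 - Poly_Mapping.single [v] a" by blast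
      then have "free_map g r = Poly_Mapping.single [sc a (g v)] 1 - Poly_Mapping.single [g v] a" "g v \<in> V"
        using g by (auto simp: free_map_diff free_map_single linear_endo_def)
      then show "free_map g r \<in> {Poly_Mapping.single [v + w] 1 - Poly_Mapping.single [v] 1 - Poly_Mapping.single [w] 1
         | v w. v \<in> V \<and> w \<in> V} \<union> {Poly_Mapping.single [sc a v] 1 - Poly_Mapping.single [v] a | a v. v \<in> V}"
        by blast
    qed
    then show "r \<in> {p \<in> carrier (free_algebra V). free_map g p \<in> tensor_ideal V sc}"
      using r linear_relations_in_ideal linear_relations_closed by blast
  qed
  ultimately have "tensor_ideal V sc \<subseteq> {p \<in> carrier (free_algebra V). free_map g p \<in> tensor_ideal V sc}"
    unfolding tensor_ideal_eq by (rule F.genideal_minimal)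
  then show ?thesis using p by blast
qed

text \<open>Well-definedness of the induced map: two representatives differ by an element of the
  tensor ideal, which \<open>g\<close> preserves, so every member of the union in
  \<open>tensor_map\<close> is this one coset.\<close>

lemma tensor_map_coset:
  assumes g: "linear_endo g" and p: "p \<in> carrier (free_algebra V)"
  shows "tensor_map V sc g (tensor_ideal V sc +>\<^bsub>free_algebra V\<^esub> p) =
    tensor_ideal V sc +>\<^bsub>free_algebra V\<^esub> free_map g p"
proof -
  have "g ` V \<subseteq> V" using g by (simp add: linear_endo_def)
  note hom = free_map_ring_hom[OF this]
  have "tensor_ideal V sc +>\<^bsub>free_algebra V\<^esub> free_map g q =
      tensor_ideal V sc +>\<^bsub>free_algebra V\<^esub> free_map g p"
    if q: "q \<in> tensor_ideal V sc +>\<^bsub>free_algebra V\<^esub> p" for q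
  proof -
    obtain h where h: "h \<in> tensor_ideal V sc" "q = h + p"
      using q unfolding a_r_coset_def' free_algebra_simps by blast
    have qc: "q \<in> carrier (free_algebra V)"
      using F.a_closed[OF J.Icarr[OF h(1)] p] by (simp add: h(2) free_algebra_simps(5))
    have "free_map g (q - p) \<in> tensor_ideal V sc"
      using free_map_tensor_ideal[OF g h(1)] by (simp add: h(2))
    then show ?thesis
      using ring_hom_closed[OF hom qc] ring_hom_closed[OF hom p]
      by (intro coset_eqI) (simp_all add: free_map_diff)
  qed
  moreover have "p \<in> tensor_ideal V sc +>\<^bsub>free_algebra V\<^esub> p" by (rule J.a_rcos_self[OF p])
  ultimately show ?thesis unfolding tensor_map_def by blast
qed

lemma tensor_map_ring_hom:
  assumes g: "linear_endo g"
  shows "tensor_map V sc g \<in> ring_hom (tensor_algebra V sc) (tensor_algebra V sc)"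
proof -
  have "g ` V \<subseteq> V" using g by (simp add: linear_endo_def)
  note hom = free_map_ring_hom[OF this]
  note add = ring_hom_add[OF coset_ring_hom] and mult = ring_hom_mult[OF coset_ring_hom]
  show ?thesis
  proof (rule ring_hom_memI)
    fix X assume "X \<in> carrier (tensor_algebra V sc)"
    then show "tensor_map V sc g X \<in> carrier (tensor_algebra V sc)"
      unfolding mem_tensor_algebra_iff using tensor_map_coset[OF g] ring_hom_closed[OF hom] by blast
  next
    fix X Y assume "X \<in> carrier (tensor_algebra V sc)" "Y \<in> carrier (tensor_algebra V sc)"
    then obtain p q where p: "p \<in> carrier (free_algebra V)" "X = tensor_ideal V sc +>\<^bsub>free_algebra V\<^esub> p"
      and q: "q \<in> carrier (free_algebra V)" "Y = tensor_ideal V sc +>\<^bsub>free_algebra V\<^esub> q"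
      unfolding mem_tensor_algebra_iff by blast
    show "tensor_map V sc g (X \<otimes>\<^bsub>tensor_algebra V sc\<^esub> Y) =
        tensor_map V sc g X \<otimes>\<^bsub>tensor_algebra V sc\<^esub> tensor_map V sc g Y"
      using tensor_map_coset[OF g F.m_closed[OF p(1) q(1)]] mult[OF p(1) q(1)]
        mult[OF ring_hom_closed[OF hom p(1)] ring_hom_closed[OF hom q(1)]]
      by (simp add: p q tensor_map_coset[OF g] ring_hom_mult[OF hom])
    show "tensor_map V sc g (X \<oplus>\<^bsub>tensor_algebra V sc\<^esub> Y) =
        tensor_map V sc g X \<oplus>\<^bsub>tensor_algebra V sc\<^esub> tensor_map V sc g Y"
      using tensor_map_coset[OF g F.a_closed[OF p(1) q(1)]] add[OF p(1) q(1)]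
        add[OF ring_hom_closed[OF hom p(1)] ring_hom_closed[OF hom q(1)]]
      by (simp add: p q tensor_map_coset[OF g] ring_hom_add[OF hom])
  next
    show "tensor_map V sc g \<one>\<^bsub>tensor_algebra V sc\<^esub> = \<one>\<^bsub>tensor_algebra V sc\<^esub>"
      using tensor_map_coset[OF g F.one_closed] ring_hom_one[OF coset_ring_hom] ring_hom_one[OF hom] by simp
  qed
qed

lemma tensor_map_id:
  assumes "\<And>v. v \<in> V \<Longrightarrow> g v = v" "X \<in> carrier (tensor_algebra V sc)"
  shows "tensor_map V sc g X = X"
proof -
  obtain p where p: "p \<in> carrier (free_algebra V)" "X = tensor_ideal V sc +>\<^bsub>free_algebra V\<^esub> p"
    using assms(2) unfolding mem_tensor_algebra_iff by blast
  have "linear_endo g" using assms(1) add_closed scale_closed by (auto simp: linear_endo_def)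
  moreover have "free_map g p = p" using free_map_cong[OF p(1), of g id] assms(1) by (simp add: free_map_id)
  ultimately show ?thesis using tensor_map_coset p by simp
qed

lemma tensor_map_comp:
  assumes g: "linear_endo g" and h: "linear_endo h" and f: "\<And>v. v \<in> V \<Longrightarrow> f v = g (h v)"
    and X: "X \<in> carrier (tensor_algebra V sc)"
  shows "tensor_map V sc f X = tensor_map V sc g (tensor_map V sc h X)"
proof -
  obtain p where p: "p \<in> carrier (free_algebra V)" "X = tensor_ideal V sc +>\<^bsub>free_algebra V\<^esub> p"
    using X unfolding mem_tensor_algebra_iff by blast
  have hV: "h ` V \<subseteq> V" using h by (simp add: linear_endo_def)
  have "linear_endo f" using g h f add_closed scale_closed
    by (auto simp: linear_endo_def image_subset_iff)
  moreover have "free_map f p = free_map g (free_map h p)"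
    unfolding free_map_comp using f by (intro free_map_cong[OF p(1)]) simp
  moreover have "free_map h p \<in> carrier (free_algebra V)"
    by (rule ring_hom_closed[OF free_map_ring_hom[OF hV] p(1)])
  ultimately show ?thesis using tensor_map_coset g h p by simp
qed

end

section \<open>Smash products\<close>

lemma ring_hom_finsum:
  assumes "ring R" "ring S" "h \<in> ring_hom R S" "f \<in> A \<rightarrow> carrier R"
  shows "h (finsum R f A) = finsum S (\<lambda>i. h (f i)) A"
proof -
  interpret R: ring R by fact
  interpret S: ring S by fact
  have h0: "h \<zero>\<^bsub>R\<^esub> = \<zero>\<^bsub>S\<^esub>" by (rule ring_hom_zero[OF assms(3,1,2)])
  show ?thesis using assms(4)
  proof (induction A rule: infinite_finite_induct)
    case (insert i A)
    then have f: "f i \<in> carrier R" "f \<in> A \<rightarrow> carrier R" by auto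
    have "h (finsum R f (insert i A)) = h (f i) \<oplus>\<^bsub>S\<^esub> h (finsum R f A)"
      using insert.hyps f ring_hom_add[OF assms(3)] by (simp add: R.finsum_insert)
    also have "\<dots> = h (f i) \<oplus>\<^bsub>S\<^esub> finsum S (\<lambda>i. h (f i)) A" using insert.IH f by simp
    also have "\<dots> = finsum S (\<lambda>i. h (f i)) (insert i A)"
      using insert.hyps f ring_hom_closed[OF assms(3)]
      by (intro S.finsum_insert[symmetric]) auto
    finally show ?case .
  qed (simp_all add: h0)
qed

text \<open>Finiteness of the group matters because the product in the smash product is a
  \<open>finsum\<close> over all of \<open>carrier G\<close>, which would default to zero over an
  infinite set.\<close>

locale finite_group_ring_action = A: ring A + G: group G
  for A :: "('a, 'x) ring_scheme" and G :: "('g, 'y) monoid_scheme" +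
  fixes act :: "'g \<Rightarrow> 'a \<Rightarrow> 'a"
  assumes finite_G: "finite (carrier G)"
    and act_hom: "g \<in> carrier G \<Longrightarrow> act g \<in> ring_hom A A"
    and act_one: "a \<in> carrier A \<Longrightarrow> act \<one>\<^bsub>G\<^esub> a = a"
    and act_mult: "\<lbrakk>g \<in> carrier G; h \<in> carrier G; a \<in> carrier A\<rbrakk> \<Longrightarrow>
      act (g \<otimes>\<^bsub>G\<^esub> h) a = act g (act h a)"
begin

abbreviation smash :: "('g \<Rightarrow> 'a) ring" where
  "smash \<equiv> smash_product A G act"

lemmas act_closed = ring_hom_closed[OF act_hom]
  and act_add = ring_hom_add[OF act_hom]
  and act_times = ring_hom_mult[OF act_hom]
  and act_unit = ring_hom_one[OF act_hom]

lemma act_zero: "g \<in> carrier G \<Longrightarrow> act g \<zero>\<^bsub>A\<^esub> = \<zero>\<^bsub>A\<^esub>"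
  by (rule ring_hom_zero[OF act_hom A.ring_axioms A.ring_axioms])

lemma act_finsum:
  "g \<in> carrier G \<Longrightarrow> f \<in> I \<rightarrow> carrier A \<Longrightarrow> act g (finsum A f I) = finsum A (\<lambda>i. act g (f i)) I"
  by (rule ring_hom_finsum[OF A.ring_axioms A.ring_axioms act_hom])

lemma smash_simps:
  "carrier smash = carrier G \<rightarrow>\<^sub>E carrier A"
  "f \<otimes>\<^bsub>smash\<^esub> f' = (\<lambda>g\<in>carrier G.
     finsum A (\<lambda>h. f h \<otimes>\<^bsub>A\<^esub> act h (f' (inv\<^bsub>G\<^esub> h \<otimes>\<^bsub>G\<^esub> g))) (carrier G))"
  "\<one>\<^bsub>smash\<^esub> = (\<lambda>g\<in>carrier G. if g = \<one>\<^bsub>G\<^esub> then \<one>\<^bsub>A\<^esub> else \<zero>\<^bsub>A\<^esub>)"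
  "\<zero>\<^bsub>smash\<^esub> = (\<lambda>g\<in>carrier G. \<zero>\<^bsub>A\<^esub>)"
  "f \<oplus>\<^bsub>smash\<^esub> f' = (\<lambda>g\<in>carrier G. f g \<oplus>\<^bsub>A\<^esub> f' g)"
  by (simp_all add: smash_product_def)

lemma smash_apply_closed: "f \<in> carrier smash \<Longrightarrow> g \<in> carrier G \<Longrightarrow> f g \<in> carrier A"
  by (auto simp: smash_simps)

lemma smash_eqI:
  assumes "f \<in> carrier smash" "f' \<in> carrier smash" "\<And>g. g \<in> carrier G \<Longrightarrow> f g = f' g"
  shows "f = f'"
  using assms unfolding smash_simps by (rule PiE_ext)

lemma smash_mult_apply:
  "g \<in> carrier G \<Longrightarrow> (f \<otimes>\<^bsub>smash\<^esub> f') g =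
     finsum A (\<lambda>h. f h \<otimes>\<^bsub>A\<^esub> act h (f' (inv\<^bsub>G\<^esub> h \<otimes>\<^bsub>G\<^esub> g))) (carrier G)"
  and smash_add_apply: "g \<in> carrier G \<Longrightarrow> (f \<oplus>\<^bsub>smash\<^esub> f') g = f g \<oplus>\<^bsub>A\<^esub> f' g"
  by (simp_all add: smash_simps)

lemma smash_summand_closed:
  "\<lbrakk>f \<in> carrier smash; f' \<in> carrier smash; g \<in> carrier G; h \<in> carrier G\<rbrakk> \<Longrightarrow>
    f h \<otimes>\<^bsub>A\<^esub> act h (f' (inv\<^bsub>G\<^esub> h \<otimes>\<^bsub>G\<^esub> g)) \<in> carrier A"
  by (intro A.m_closed act_closed smash_apply_closed G.m_closed G.inv_closed)

lemma smash_mult_closed: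
  assumes "f \<in> carrier smash" "f' \<in> carrier smash"
  shows "f \<otimes>\<^bsub>smash\<^esub> f' \<in> carrier smash"
  unfolding smash_simps(1)
proof (rule PiE_I)
  fix g assume "g \<in> carrier G"
  then show "(f \<otimes>\<^bsub>smash\<^esub> f') g \<in> carrier A"
    unfolding smash_mult_apply[OF \<open>g \<in> carrier G\<close>]
    by (intro A.finsum_closed Pi_I smash_summand_closed assms)
qed (simp add: smash_simps)

lemma smash_add_closed:
  "\<lbrakk>f \<in> carrier smash; f' \<in> carrier smash\<rbrakk> \<Longrightarrow> f \<oplus>\<^bsub>smash\<^esub> f' \<in> carrier smash"
  by (auto simp: smash_simps)

text \<open>Both sides are the same double sum over factorizations of \<open>g\<close> into three
  factors; the sums are interchanged and the outer variable \<open>h\<close> is replaced by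
  \<open>k l\<close>.\<close>

lemma smash_assoc:
  assumes f: "f1 \<in> carrier smash" "f2 \<in> carrier smash" "f3 \<in> carrier smash"
  shows "f1 \<otimes>\<^bsub>smash\<^esub> f2 \<otimes>\<^bsub>smash\<^esub> f3 = f1 \<otimes>\<^bsub>smash\<^esub> (f2 \<otimes>\<^bsub>smash\<^esub> f3)"
proof (rule smash_eqI)
  fix g assume g: "g \<in> carrier G"
  let ?G = "carrier G"
  \<comment> \<open>The summand belonging to the factorization of \<open>g\<close> into
    \<open>k\<close>, \<open>inv k h\<close> and \<open>inv h g\<close>.\<close>
  define t where "t k h = f1 k \<otimes>\<^bsub>A\<^esub> act k (f2 (inv\<^bsub>G\<^esub> k \<otimes>\<^bsub>G\<^esub> h))
      \<otimes>\<^bsub>A\<^esub> act h (f3 (inv\<^bsub>G\<^esub> h \<otimes>\<^bsub>G\<^esub> g))" for k h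
  have tc: "t k h \<in> carrier A" if "k \<in> ?G" "h \<in> ?G" for k h
    unfolding t_def using that g f
    by (intro A.m_closed act_closed smash_apply_closed G.m_closed G.inv_closed)
  have "(f1 \<otimes>\<^bsub>smash\<^esub> f2 \<otimes>\<^bsub>smash\<^esub> f3) g = finsum A (\<lambda>h. finsum A (\<lambda>k. t k h) ?G) ?G"
    unfolding smash_mult_apply[OF g]
  proof (rule A.finsum_cong'[OF refl])
    show "(\<lambda>h. finsum A (\<lambda>k. t k h) ?G) \<in> ?G \<rightarrow> carrier A"
      by (intro Pi_I A.finsum_closed tc)
    fix h assume h: "h \<in> ?G"
    show "(f1 \<otimes>\<^bsub>smash\<^esub> f2) h \<otimes>\<^bsub>A\<^esub> act h (f3 (inv\<^bsub>G\<^esub> h \<otimes>\<^bsub>G\<^esub> g)) = finsum A (\<lambda>k. t k h) ?G"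
      unfolding smash_mult_apply[OF h] t_def
    proof (rule A.finsum_ldistr[OF finite_G])
      show "act h (f3 (inv\<^bsub>G\<^esub> h \<otimes>\<^bsub>G\<^esub> g)) \<in> carrier A"
        by (intro act_closed[OF h] smash_apply_closed[OF f(3)] G.m_closed G.inv_closed h g)
    qed (intro Pi_I smash_summand_closed f h)
  qed
  also have "\<dots> = finsum A (\<lambda>k. finsum A (\<lambda>h. t k h) ?G) ?G"
    by (rule A.finsum_swap[OF finite_G finite_G tc])
  also have "\<dots> = (f1 \<otimes>\<^bsub>smash\<^esub> (f2 \<otimes>\<^bsub>smash\<^esub> f3)) g"
    unfolding smash_mult_apply[OF g]
  proof (rule A.finsum_cong'[OF refl])
    show "(\<lambda>k. f1 k \<otimes>\<^bsub>A\<^esub> act k ((f2 \<otimes>\<^bsub>smash\<^esub> f3) (inv\<^bsub>G\<^esub> k \<otimes>\<^bsub>G\<^esub> g))) \<in> ?G \<rightarrow> carrier A"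
      using g f by (intro Pi_I smash_summand_closed smash_mult_closed)
    fix k assume k: "k \<in> ?G"
    have kg: "inv\<^bsub>G\<^esub> k \<otimes>\<^bsub>G\<^esub> g \<in> ?G" using k g by simp
    have c2: "act k (f2 l) \<in> carrier A" "f2 l \<in> carrier A" if "l \<in> ?G" for l
      by (rule act_closed[OF k smash_apply_closed[OF f(2) that]], rule smash_apply_closed[OF f(2) that])
    have img: "(\<otimes>\<^bsub>G\<^esub>) k ` ?G = ?G" using k by (rule G.surj_const_mult)
    have "finsum A (\<lambda>h. t k h) ?G = finsum A (\<lambda>h. t k h) ((\<otimes>\<^bsub>G\<^esub>) k ` ?G)"
      by (simp only: img)
    \<comment> \<open>Substitution \<open>h = k l\<close>, a bijection of the group for fixed
      \<open>k\<close>.\<close>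
    also have "\<dots> = finsum A (\<lambda>l. t k (k \<otimes>\<^bsub>G\<^esub> l)) ?G"
      using tc[OF k] k by (intro A.finsum_reindex) (auto simp: img G.inj_on_cmult)
    also have "\<dots> = finsum A (\<lambda>l. f1 k \<otimes>\<^bsub>A\<^esub> act k (f2 l \<otimes>\<^bsub>A\<^esub>
        act l (f3 (inv\<^bsub>G\<^esub> l \<otimes>\<^bsub>G\<^esub> (inv\<^bsub>G\<^esub> k \<otimes>\<^bsub>G\<^esub> g))))) ?G"
    proof (rule A.finsum_cong'[OF refl])
      show "(\<lambda>l. f1 k \<otimes>\<^bsub>A\<^esub> act k (f2 l \<otimes>\<^bsub>A\<^esub>
        act l (f3 (inv\<^bsub>G\<^esub> l \<otimes>\<^bsub>G\<^esub> (inv\<^bsub>G\<^esub> k \<otimes>\<^bsub>G\<^esub> g))))) \<in> ?G \<rightarrow> carrier A"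
        using k kg f by (intro Pi_I A.m_closed act_closed smash_summand_closed smash_apply_closed)
      fix l assume l: "l \<in> ?G"
      have f3c: "f3 (inv\<^bsub>G\<^esub> l \<otimes>\<^bsub>G\<^esub> (inv\<^bsub>G\<^esub> k \<otimes>\<^bsub>G\<^esub> g)) \<in> carrier A"
        using l kg f by (intro smash_apply_closed) auto
      have "inv\<^bsub>G\<^esub> k \<otimes>\<^bsub>G\<^esub> (k \<otimes>\<^bsub>G\<^esub> l) = l" using k l by (simp add: G.m_assoc[symmetric])
      moreover have "inv\<^bsub>G\<^esub> (k \<otimes>\<^bsub>G\<^esub> l) \<otimes>\<^bsub>G\<^esub> g = inv\<^bsub>G\<^esub> l \<otimes>\<^bsub>G\<^esub> (inv\<^bsub>G\<^esub> k \<otimes>\<^bsub>G\<^esub> g)"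
        using k l g by (simp add: G.inv_mult_group G.m_assoc)
      ultimately have "t k (k \<otimes>\<^bsub>G\<^esub> l) = f1 k \<otimes>\<^bsub>A\<^esub> act k (f2 l) \<otimes>\<^bsub>A\<^esub>
          act k (act l (f3 (inv\<^bsub>G\<^esub> l \<otimes>\<^bsub>G\<^esub> (inv\<^bsub>G\<^esub> k \<otimes>\<^bsub>G\<^esub> g))))"
        using act_mult[OF k l f3c] by (simp add: t_def)
      then show "t k (k \<otimes>\<^bsub>G\<^esub> l) = f1 k \<otimes>\<^bsub>A\<^esub> act k (f2 l \<otimes>\<^bsub>A\<^esub>
          act l (f3 (inv\<^bsub>G\<^esub> l \<otimes>\<^bsub>G\<^esub> (inv\<^bsub>G\<^esub> k \<otimes>\<^bsub>G\<^esub> g))))"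
        using k l f3c c2[OF l] smash_apply_closed[OF f(1) k]
        by (simp add: act_times act_closed A.m_assoc)
    qed
    also have "\<dots> = f1 k \<otimes>\<^bsub>A\<^esub> finsum A (\<lambda>l. act k (f2 l \<otimes>\<^bsub>A\<^esub>
        act l (f3 (inv\<^bsub>G\<^esub> l \<otimes>\<^bsub>G\<^esub> (inv\<^bsub>G\<^esub> k \<otimes>\<^bsub>G\<^esub> g))))) ?G"
      by (rule A.finsum_rdistr[OF finite_G, symmetric])
        (intro Pi_I act_closed[OF k] smash_summand_closed smash_apply_closed[OF f(1) k] f(2,3) kg; assumption)+
    also have "\<dots> = f1 k \<otimes>\<^bsub>A\<^esub> act k ((f2 \<otimes>\<^bsub>smash\<^esub> f3) (inv\<^bsub>G\<^esub> k \<otimes>\<^bsub>G\<^esub> g))"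
      unfolding smash_mult_apply[OF kg]
      by (subst act_finsum[OF k]) (intro Pi_I smash_summand_closed f(2,3) kg refl; assumption)+
    finally show "finsum A (\<lambda>h. t k h) ?G =
        f1 k \<otimes>\<^bsub>A\<^esub> act k ((f2 \<otimes>\<^bsub>smash\<^esub> f3) (inv\<^bsub>G\<^esub> k \<otimes>\<^bsub>G\<^esub> g))" .
  qed
  finally show "(f1 \<otimes>\<^bsub>smash\<^esub> f2 \<otimes>\<^bsub>smash\<^esub> f3) g = (f1 \<otimes>\<^bsub>smash\<^esub> (f2 \<otimes>\<^bsub>smash\<^esub> f3)) g" .
qed (use f in \<open>auto intro!: smash_mult_closed\<close>)

lemma finsum_delta:
  assumes "k \<in> carrier G" "F k \<in> carrier A"
    and "\<And>h. h \<in> carrier G \<Longrightarrow> h \<noteq> k \<Longrightarrow> F h = \<zero>\<^bsub>A\<^esub>"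
  shows "finsum A F (carrier G) = F k"
proof -
  have "finsum A F (carrier G) = finsum A (\<lambda>h. if k = h then F k else \<zero>\<^bsub>A\<^esub>) (carrier G)"
    using assms by (intro A.finsum_cong') auto
  also have "\<dots> = F k"
    using assms by (intro A.finsum_singleton[OF _ finite_G]) auto
  finally show ?thesis .
qed

lemma smash_elem_closed:
  "a \<in> carrier A \<Longrightarrow> smash_elem A G a g \<in> carrier smash"
  by (auto simp: smash_elem_def smash_simps)

lemma smash_one_eq: "\<one>\<^bsub>smash\<^esub> = smash_elem A G \<one>\<^bsub>A\<^esub> \<one>\<^bsub>G\<^esub>"
  by (simp add: smash_simps smash_elem_def)

lemma smash_elem_one_mult:
  assumes a: "a \<in> carrier A" and f: "f \<in> carrier smash" and g: "g \<in> carrier G"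
  shows "(smash_elem A G a \<one>\<^bsub>G\<^esub> \<otimes>\<^bsub>smash\<^esub> f) g = a \<otimes>\<^bsub>A\<^esub> f g"
proof -
  have fg: "f g \<in> carrier A" using f g by (rule smash_apply_closed)
  have "(smash_elem A G a \<one>\<^bsub>G\<^esub> \<otimes>\<^bsub>smash\<^esub> f) g =
      smash_elem A G a \<one>\<^bsub>G\<^esub> \<one>\<^bsub>G\<^esub> \<otimes>\<^bsub>A\<^esub> act \<one>\<^bsub>G\<^esub> (f (inv\<^bsub>G\<^esub> \<one>\<^bsub>G\<^esub> \<otimes>\<^bsub>G\<^esub> g))"
    unfolding smash_mult_apply[OF g]
  proof (rule finsum_delta)
    fix h assume h: "h \<in> carrier G" "h \<noteq> \<one>\<^bsub>G\<^esub>"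
    have "act h (f (inv\<^bsub>G\<^esub> h \<otimes>\<^bsub>G\<^esub> g)) \<in> carrier A"
      by (intro act_closed[OF h(1)] smash_apply_closed[OF f] G.m_closed G.inv_closed h(1) g)
    then show "smash_elem A G a \<one>\<^bsub>G\<^esub> h \<otimes>\<^bsub>A\<^esub> act h (f (inv\<^bsub>G\<^esub> h \<otimes>\<^bsub>G\<^esub> g)) = \<zero>\<^bsub>A\<^esub>"
      using h by (simp add: smash_elem_def)
  qed (use a g fg in \<open>auto simp: smash_elem_def act_one\<close>)
  also have "\<dots> = a \<otimes>\<^bsub>A\<^esub> f g" using g fg by (simp add: smash_elem_def act_one)
  finally show ?thesis .
qed

lemma smash_r_one:
  assumes f: "f \<in> carrier smash" and g: "g \<in> carrier G"
  shows "(f \<otimes>\<^bsub>smash\<^esub> \<one>\<^bsub>smash\<^esub>) g = f g"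
proof -
  have fg: "f g \<in> carrier A" using f g by (rule smash_apply_closed)
  \<comment> \<open>Only \<open>h = g\<close> contributes to the product with the unit, since the
    unit is supported at the neutral element.\<close>
  have inv1: "inv\<^bsub>G\<^esub> h \<otimes>\<^bsub>G\<^esub> g \<noteq> \<one>\<^bsub>G\<^esub>" if "h \<in> carrier G" "h \<noteq> g" for h
    using that g by (metis G.inv_closed G.inv_equality G.inv_inv)
  have "(f \<otimes>\<^bsub>smash\<^esub> \<one>\<^bsub>smash\<^esub>) g = f g \<otimes>\<^bsub>A\<^esub> act g (\<one>\<^bsub>smash\<^esub> (inv\<^bsub>G\<^esub> g \<otimes>\<^bsub>G\<^esub> g))"
    unfolding smash_mult_apply[OF g]
    using f g fg inv1
    by (intro finsum_delta)
      (auto simp: smash_simps(3) act_unit act_zero intro!: A.r_null smash_apply_closed)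
  also have "\<dots> = f g" using g fg by (simp add: smash_simps(3) act_unit)
  finally show ?thesis .
qed

lemma ring_smash: "ring smash"
proof (rule ringI)
  have zc: "\<zero>\<^bsub>smash\<^esub> \<in> carrier smash" by (auto simp: smash_simps)
  have oc: "\<one>\<^bsub>smash\<^esub> \<in> carrier smash" by (simp add: smash_one_eq smash_elem_closed)
  show "abelian_group smash"
  proof (rule abelian_groupI)
    fix f assume f: "f \<in> carrier smash"
    note fc = smash_apply_closed[OF f]
    show "\<zero>\<^bsub>smash\<^esub> \<oplus>\<^bsub>smash\<^esub> f = f"
      using fc by (intro smash_eqI smash_add_closed zc f) (simp add: smash_simps)
    show "\<exists>f'\<in>carrier smash. f' \<oplus>\<^bsub>smash\<^esub> f = \<zero>\<^bsub>smash\<^esub>"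
    proof
      show "(\<lambda>g\<in>carrier G. \<ominus>\<^bsub>A\<^esub> f g) \<in> carrier smash" using fc by (auto simp: smash_simps)
      then show "(\<lambda>g\<in>carrier G. \<ominus>\<^bsub>A\<^esub> f g) \<oplus>\<^bsub>smash\<^esub> f = \<zero>\<^bsub>smash\<^esub>"
        using fc by (intro smash_eqI smash_add_closed zc f) (simp_all add: smash_simps A.l_neg)
    qed
    fix f' assume f': "f' \<in> carrier smash"
    note fc' = smash_apply_closed[OF f']
    show "f \<oplus>\<^bsub>smash\<^esub> f' \<in> carrier smash" by (rule smash_add_closed[OF f f'])
    show "f \<oplus>\<^bsub>smash\<^esub> f' = f' \<oplus>\<^bsub>smash\<^esub> f"
      using fc fc' by (intro smash_eqI smash_add_closed f f') (simp add: smash_add_apply A.a_comm)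
    fix f'' assume f'': "f'' \<in> carrier smash"
    note fc'' = smash_apply_closed[OF f'']
    show "f \<oplus>\<^bsub>smash\<^esub> f' \<oplus>\<^bsub>smash\<^esub> f'' = f \<oplus>\<^bsub>smash\<^esub> (f' \<oplus>\<^bsub>smash\<^esub> f'')"
      using fc fc' fc'' by (intro smash_eqI smash_add_closed f f' f'') (simp add: smash_add_apply A.a_assoc)
  qed (rule zc)
  show "Group.monoid smash"
  proof (rule monoidI)
    fix f assume f: "f \<in> carrier smash"
    show "\<one>\<^bsub>smash\<^esub> \<otimes>\<^bsub>smash\<^esub> f = f"
      using f by (intro smash_eqI smash_mult_closed oc f)
        (simp add: smash_one_eq smash_elem_one_mult smash_apply_closed)
    show "f \<otimes>\<^bsub>smash\<^esub> \<one>\<^bsub>smash\<^esub> = f"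
      by (intro smash_eqI smash_mult_closed oc f smash_r_one)
  qed (auto intro!: smash_mult_closed oc smash_assoc)
  fix f1 f2 f3 assume f: "f1 \<in> carrier smash" "f2 \<in> carrier smash" "f3 \<in> carrier smash"
  show "(f1 \<oplus>\<^bsub>smash\<^esub> f2) \<otimes>\<^bsub>smash\<^esub> f3 = f1 \<otimes>\<^bsub>smash\<^esub> f3 \<oplus>\<^bsub>smash\<^esub> f2 \<otimes>\<^bsub>smash\<^esub> f3"
  proof (rule smash_eqI)
    fix g assume g: "g \<in> carrier G"
    have "((f1 \<oplus>\<^bsub>smash\<^esub> f2) \<otimes>\<^bsub>smash\<^esub> f3) g =
        finsum A (\<lambda>h. f1 h \<otimes>\<^bsub>A\<^esub> act h (f3 (inv\<^bsub>G\<^esub> h \<otimes>\<^bsub>G\<^esub> g)) \<oplus>\<^bsub>A\<^esub>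
          f2 h \<otimes>\<^bsub>A\<^esub> act h (f3 (inv\<^bsub>G\<^esub> h \<otimes>\<^bsub>G\<^esub> g))) (carrier G)"
      unfolding smash_mult_apply[OF g]
    proof (rule A.finsum_cong'[OF refl])
      show "(\<lambda>h. f1 h \<otimes>\<^bsub>A\<^esub> act h (f3 (inv\<^bsub>G\<^esub> h \<otimes>\<^bsub>G\<^esub> g)) \<oplus>\<^bsub>A\<^esub>
          f2 h \<otimes>\<^bsub>A\<^esub> act h (f3 (inv\<^bsub>G\<^esub> h \<otimes>\<^bsub>G\<^esub> g))) \<in> carrier G \<rightarrow> carrier A"
        by (intro Pi_I A.a_closed smash_summand_closed f g)
      fix h assume h: "h \<in> carrier G"
      have "act h (f3 (inv\<^bsub>G\<^esub> h \<otimes>\<^bsub>G\<^esub> g)) \<in> carrier A"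
        by (intro act_closed smash_apply_closed G.m_closed G.inv_closed f g h)
      then show "(f1 \<oplus>\<^bsub>smash\<^esub> f2) h \<otimes>\<^bsub>A\<^esub> act h (f3 (inv\<^bsub>G\<^esub> h \<otimes>\<^bsub>G\<^esub> g)) =
          f1 h \<otimes>\<^bsub>A\<^esub> act h (f3 (inv\<^bsub>G\<^esub> h \<otimes>\<^bsub>G\<^esub> g)) \<oplus>\<^bsub>A\<^esub>
          f2 h \<otimes>\<^bsub>A\<^esub> act h (f3 (inv\<^bsub>G\<^esub> h \<otimes>\<^bsub>G\<^esub> g))"
        using smash_apply_closed[OF f(1) h] smash_apply_closed[OF f(2) h]
        by (simp add: smash_add_apply[OF h] A.l_distr)
    qed
    also have "\<dots> = (f1 \<otimes>\<^bsub>smash\<^esub> f3 \<oplus>\<^bsub>smash\<^esub> f2 \<otimes>\<^bsub>smash\<^esub> f3) g"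
      unfolding smash_add_apply[OF g] smash_mult_apply[OF g]
      by (intro A.finsum_addf Pi_I smash_summand_closed f g)
    finally show "((f1 \<oplus>\<^bsub>smash\<^esub> f2) \<otimes>\<^bsub>smash\<^esub> f3) g = (f1 \<otimes>\<^bsub>smash\<^esub> f3 \<oplus>\<^bsub>smash\<^esub> f2 \<otimes>\<^bsub>smash\<^esub> f3) g" .
  qed (intro smash_mult_closed smash_add_closed f)+
  show "f3 \<otimes>\<^bsub>smash\<^esub> (f1 \<oplus>\<^bsub>smash\<^esub> f2) = f3 \<otimes>\<^bsub>smash\<^esub> f1 \<oplus>\<^bsub>smash\<^esub> f3 \<otimes>\<^bsub>smash\<^esub> f2"
  proof (rule smash_eqI)
    fix g assume g: "g \<in> carrier G"
    have "(f3 \<otimes>\<^bsub>smash\<^esub> (f1 \<oplus>\<^bsub>smash\<^esub> f2)) g =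
        finsum A (\<lambda>h. f3 h \<otimes>\<^bsub>A\<^esub> act h (f1 (inv\<^bsub>G\<^esub> h \<otimes>\<^bsub>G\<^esub> g)) \<oplus>\<^bsub>A\<^esub>
          f3 h \<otimes>\<^bsub>A\<^esub> act h (f2 (inv\<^bsub>G\<^esub> h \<otimes>\<^bsub>G\<^esub> g))) (carrier G)"
      unfolding smash_mult_apply[OF g]
    proof (rule A.finsum_cong'[OF refl])
      show "(\<lambda>h. f3 h \<otimes>\<^bsub>A\<^esub> act h (f1 (inv\<^bsub>G\<^esub> h \<otimes>\<^bsub>G\<^esub> g)) \<oplus>\<^bsub>A\<^esub>
          f3 h \<otimes>\<^bsub>A\<^esub> act h (f2 (inv\<^bsub>G\<^esub> h \<otimes>\<^bsub>G\<^esub> g))) \<in> carrier G \<rightarrow> carrier A"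
        by (intro Pi_I A.a_closed smash_summand_closed f g)
      fix h assume h: "h \<in> carrier G"
      have hg: "inv\<^bsub>G\<^esub> h \<otimes>\<^bsub>G\<^esub> g \<in> carrier G" using g h by simp
      note c = smash_apply_closed[OF f(1) hg] smash_apply_closed[OF f(2) hg] smash_apply_closed[OF f(3) h]
      show "f3 h \<otimes>\<^bsub>A\<^esub> act h ((f1 \<oplus>\<^bsub>smash\<^esub> f2) (inv\<^bsub>G\<^esub> h \<otimes>\<^bsub>G\<^esub> g)) =
          f3 h \<otimes>\<^bsub>A\<^esub> act h (f1 (inv\<^bsub>G\<^esub> h \<otimes>\<^bsub>G\<^esub> g)) \<oplus>\<^bsub>A\<^esub>
          f3 h \<otimes>\<^bsub>A\<^esub> act h (f2 (inv\<^bsub>G\<^esub> h \<otimes>\<^bsub>G\<^esub> g))"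
        using c h by (simp add: smash_add_apply[OF hg] act_add act_closed A.r_distr)
    qed
    also have "\<dots> = (f3 \<otimes>\<^bsub>smash\<^esub> f1 \<oplus>\<^bsub>smash\<^esub> f3 \<otimes>\<^bsub>smash\<^esub> f2) g"
      unfolding smash_add_apply[OF g] smash_mult_apply[OF g]
      by (intro A.finsum_addf Pi_I smash_summand_closed f g)
    finally show "(f3 \<otimes>\<^bsub>smash\<^esub> (f1 \<oplus>\<^bsub>smash\<^esub> f2)) g = (f3 \<otimes>\<^bsub>smash\<^esub> f1 \<oplus>\<^bsub>smash\<^esub> f3 \<otimes>\<^bsub>smash\<^esub> f2) g" .
  qed (intro smash_mult_closed smash_add_closed f)+
qed

lemma smash_elem_ring_hom: "(\<lambda>a. smash_elem A G a \<one>\<^bsub>G\<^esub>) \<in> ring_hom A smash"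
proof (rule ring_hom_memI)
  fix a b assume ab: "a \<in> carrier A" "b \<in> carrier A"
  show "smash_elem A G (a \<otimes>\<^bsub>A\<^esub> b) \<one>\<^bsub>G\<^esub> = smash_elem A G a \<one>\<^bsub>G\<^esub> \<otimes>\<^bsub>smash\<^esub> smash_elem A G b \<one>\<^bsub>G\<^esub>"
  proof (rule smash_eqI)
    fix g assume "g \<in> carrier G"
    then show "smash_elem A G (a \<otimes>\<^bsub>A\<^esub> b) \<one>\<^bsub>G\<^esub> g =
        (smash_elem A G a \<one>\<^bsub>G\<^esub> \<otimes>\<^bsub>smash\<^esub> smash_elem A G b \<one>\<^bsub>G\<^esub>) g"
      unfolding smash_elem_one_mult[OF ab(1) smash_elem_closed[OF ab(2)] \<open>g \<in> carrier G\<close>]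
      using ab by (simp add: smash_elem_def)
  qed (intro smash_elem_closed smash_mult_closed A.m_closed ab)+
  show "smash_elem A G (a \<oplus>\<^bsub>A\<^esub> b) \<one>\<^bsub>G\<^esub> = smash_elem A G a \<one>\<^bsub>G\<^esub> \<oplus>\<^bsub>smash\<^esub> smash_elem A G b \<one>\<^bsub>G\<^esub>"
    using ab by (intro smash_eqI smash_elem_closed smash_add_closed A.a_closed)
      (auto simp: smash_elem_def smash_simps)
qed (simp_all add: smash_elem_closed smash_one_eq)

end

section \<open>Passing from the algebra to its commutative subalgebra\<close>

text \<open>The centralizer of any set is a subring. Applied to \<open>H\<close>, this shows that
  generated elements commute with \<open>H\<close>; applied to the generated ring, it shows that
  they commute with each other.\<close>

lemma (in ring) generate_ring_commute:
  assumes H: "H \<subseteq> carrier R" and comm: "\<And>x y. x \<in> H \<Longrightarrow> y \<in> H \<Longrightarrow> x \<otimes> y = y \<otimes> x"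
    and "a \<in> generate_ring R H" "b \<in> generate_ring R H"
  shows "a \<otimes> b = b \<otimes> a"
proof -
  have cent: "generate_ring R H \<subseteq> {x \<in> carrier R. \<forall>s\<in>S. x \<otimes> s = s \<otimes> x}"
    if S: "S \<subseteq> carrier R" and HS: "\<And>x s. x \<in> H \<Longrightarrow> s \<in> S \<Longrightarrow> x \<otimes> s = s \<otimes> x" for S
  proof
    fix x assume "x \<in> generate_ring R H"
    then show "x \<in> {x \<in> carrier R. \<forall>s\<in>S. x \<otimes> s = s \<otimes> x}"
    proof (induction x rule: generate_ring.induct)
      case one
      then show ?case using S by auto
    next
      case (incl h)
      then show ?case using H HS by blast
    next
      case (a_inv h)
      then show ?case using S by (auto simp: l_minus r_minus)
    next
      case (eng_add h1 h2)
      then show ?case using S by (auto simp: l_distr r_distr)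
    next
      case (eng_mult h1 h2)
      then have h: "h1 \<in> carrier R" "h2 \<in> carrier R" by auto
      have "h1 \<otimes> h2 \<otimes> s = s \<otimes> (h1 \<otimes> h2)" if "s \<in> S" for s
      proof -
        have s: "s \<in> carrier R" "h1 \<otimes> s = s \<otimes> h1" "h2 \<otimes> s = s \<otimes> h2"
          using that S eng_mult.IH by auto
        have "h1 \<otimes> h2 \<otimes> s = (h1 \<otimes> s) \<otimes> h2" using h s(1,3) by (simp add: m_assoc)
        also have "\<dots> = s \<otimes> h1 \<otimes> h2" by (simp only: s(2))
        finally show ?thesis using h s(1) by (simp add: m_assoc)
      qed
      then show ?case using h by blast
    qed
  qed
  have "generate_ring R H \<subseteq> {x \<in> carrier R. \<forall>s\<in>H. x \<otimes> s = s \<otimes> x}"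
    using cent[OF H] comm by blast
  then have "x \<otimes> s = s \<otimes> x" if "x \<in> H" "s \<in> generate_ring R H" for x s
    using that by (auto simp: subset_iff)
  then have "generate_ring R H \<subseteq> {x \<in> carrier R. \<forall>s\<in>generate_ring R H. x \<otimes> s = s \<otimes> x}"
    using cent[OF generate_ring_incl[OF H]] by blast
  then show ?thesis using assms(3,4) by blast
qed

text \<open>Restricting scalars turns a \<open>U\<close>-module into a module over the commutative
  ring with carrier \<open>\<Gamma>\<close>. Local finiteness, \<open>cfs\<close> and the weight
  spaces see only this restriction, so the two defining conditions agree module by module.\<close>

theorem category_O_eq_harish_chandra_modules:
  assumes U: "ring U"
    and \<eta>: "\<And>a. \<eta> a \<in> carrier U" "\<And>a b. \<eta> (a + b) = \<eta> a \<oplus>\<^bsub>U\<^esub> \<eta> b"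
      "\<And>a b. \<eta> (a * b) = \<eta> a \<otimes>\<^bsub>U\<^esub> \<eta> b" "\<eta> 1 = \<one>\<^bsub>U\<^esub>"
    and Y: "finite Y" "Y \<subseteq> carrier U"
    and Y_comm: "\<And>y z. y \<in> Y \<Longrightarrow> z \<in> Y \<Longrightarrow> y \<otimes>\<^bsub>U\<^esub> z = z \<otimes>\<^bsub>U\<^esub> y"
    and \<eta>_comm: "\<And>a y. y \<in> Y \<Longrightarrow> \<eta> a \<otimes>\<^bsub>U\<^esub> y = y \<otimes>\<^bsub>U\<^esub> \<eta> a"
    and \<Gamma>: "\<Gamma> = generate_ring U (range \<eta> \<union> Y)"
  shows "(category_O U \<eta> \<Gamma> :: ('r, 'm) module set) = harish_chandra_modules U \<eta> \<Gamma>"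
proof -
  interpret U: ring U by (rule U)
  let ?G = "U\<lparr>carrier := \<Gamma>\<rparr>"
  let ?S = "range \<eta> \<union> Y"
  have S: "?S \<subseteq> carrier U" using \<eta>(1) Y by auto
  have \<Gamma>c: "\<Gamma> \<subseteq> carrier U" unfolding \<Gamma> by (rule U.generate_ring_incl[OF S])
  have sub: "subring \<Gamma> U" unfolding \<Gamma> by (rule U.generate_ring_is_subring[OF S])
  have S\<Gamma>: "?S \<subseteq> \<Gamma>" unfolding \<Gamma> by (auto intro: generate_ring.incl)
  have "\<eta> a \<otimes>\<^bsub>U\<^esub> \<eta> b = \<eta> b \<otimes>\<^bsub>U\<^esub> \<eta> a" for a b
    by (simp add: \<eta>(3)[symmetric] mult.commute)
  then have "x \<otimes>\<^bsub>U\<^esub> y = y \<otimes>\<^bsub>U\<^esub> x" if "x \<in> ?S" "y \<in> ?S" for x y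
    using that Y_comm \<eta>_comm by (auto simp: image_iff)
  then have comm: "x \<otimes>\<^bsub>U\<^esub> y = y \<otimes>\<^bsub>U\<^esub> x" if "x \<in> \<Gamma>" "y \<in> \<Gamma>" for x y
    using U.generate_ring_commute[OF S] that unfolding \<Gamma> by blast
  have ringG: "ring ?G" by (rule U.subring_is_ring[OF sub])
  interpret G: cring ?G
    using comm by (intro cring.intro ringG comm_monoid.intro ring.is_monoid[OF ringG]
        comm_monoid_axioms.intro) simp
  \<comment> \<open>Generation was assumed inside \<open>U\<close>; the module theory needs it
    inside the smaller ring.\<close>
  have gen: "\<Gamma> = generate_ring ?G ?S"
    unfolding \<Gamma> using U.subring_gen_equality[OF sub S\<Gamma>] \<Gamma> by simp
  have "(\<forall>v\<in>carrier M. fin_gen M (range \<eta>) {a \<odot>\<^bsub>M\<^esub> v | a. a \<in> \<Gamma>}) \<longleftrightarrow>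
      internal_direct_sum M (cfs U \<eta> \<Gamma>) (generalized_weight_space U \<Gamma> M)"
    if M: "left_module U M" for M :: "('r, 'm) module"
  proof -
    interpret M: left_module U M by (rule M)
    have "left_module ?G M"
      using \<Gamma>c by (intro left_module.intro left_module_axioms.intro ringG M.abelian_group_axioms)
        (auto simp: subset_iff intro: M.smult_closed M.smult_l_distr M.smult_r_distr M.smult_assoc M.smult_one)
    then interpret fg_algebra_module ?G M \<eta> Y
      using S\<Gamma> gen \<eta> Y
      by (intro fg_algebra_module.intro cring_module.intro G.is_cring fg_algebra_module_axioms.intro) auto
    have "cfs ?G \<eta> (carrier ?G) = cfs U \<eta> \<Gamma>" by (simp add: cfs_def Let_def)
    moreover have "generalized_weight_space ?G (carrier ?G) M = generalized_weight_space U \<Gamma> M"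
      by (simp add: fun_eq_iff generalized_weight_space_def)
    ultimately show ?thesis using locally_finite_iff_weight_decomposition by simp
  qed
  then show ?thesis unfolding category_O_def harish_chandra_modules_def by blast
qed

section \<open>The Cherednik algebra\<close>

lemma group_GL:
  assumes "vector_space scale"
  shows "group (GL scale)"
proof (rule groupI)
  show "\<one>\<^bsub>GL scale\<^esub> \<in> carrier (GL scale)"
    using assms by (simp add: GL_def Vector_Spaces.linear_iff)
next
  fix f g assume "f \<in> carrier (GL scale)" "g \<in> carrier (GL scale)"
  then show "f \<otimes>\<^bsub>GL scale\<^esub> g \<in> carrier (GL scale)"
    by (simp add: GL_def Vector_Spaces.linear_iff bij_comp)
next
  fix f assume f: "f \<in> carrier (GL scale)"
  then have bij: "bij f" and lin: "Vector_Spaces.linear scale scale f" by (simp_all add: GL_def)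
  have "Vector_Spaces.linear scale scale (inv_into UNIV f)"
    unfolding Vector_Spaces.linear_iff
  proof (intro conjI assms allI)
    show "inv_into UNIV f (x + y) = inv_into UNIV f x + inv_into UNIV f y" for x y
      using lin bij by (intro inv_f_eq) (auto simp: bij_is_inj Vector_Spaces.linear_iff bij_is_surj surj_f_inv_f)
    show "inv_into UNIV f (scale a x) = scale a (inv_into UNIV f x)" for a x
      using lin bij by (intro inv_f_eq) (auto simp: bij_is_inj Vector_Spaces.linear_iff bij_is_surj surj_f_inv_f)
  qed
  then show "\<exists>g\<in>carrier (GL scale). g \<otimes>\<^bsub>GL scale\<^esub> f = \<one>\<^bsub>GL scale\<^esub>"
    using bij by (intro bexI[of _ "inv_into UNIV f"]) (auto simp: GL_def bij_imp_bij_inv bij_is_inj)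
qed (simp_all add: GL_def comp_assoc)

lemma linear_forms_iff:
  "x \<in> linear_forms scale \<longleftrightarrow> vector_space scale \<and>
    (\<forall>v w. x (v + w) = x v + x w) \<and> (\<forall>a v. x (scale a v) = a * x v)"
proof -
  have "vector_space ((*) :: complex \<Rightarrow> complex \<Rightarrow> complex)"
    by unfold_locales (simp_all add: algebra_simps)
  then show ?thesis by (auto simp: linear_forms_def Vector_Spaces.linear_iff)
qed

locale finite_linear_group =
  fixes scale :: "complex \<Rightarrow> 'v::ab_group_add \<Rightarrow> 'v" and W :: "('v \<Rightarrow> 'v) set"
  assumes vs: "vector_space scale" and W_subgroup: "subgroup W (GL scale)" and finite_W: "finite W"
begin

abbreviation "V \<equiv> double_space scale"
abbreviation "sc \<equiv> double_scale scale"
abbreviation "G \<equiv> GL scale\<lparr>carrier := W\<rparr>"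
abbreviation "T \<equiv> double_tensor_algebra scale"
abbreviation "A \<equiv> double_smash_algebra scale W"

sublocale GL: group "GL scale"
  by (rule group_GL[OF vs])

sublocale G: group G
  by (rule GL.subgroup_imp_group[OF W_subgroup])

lemma mem_V_iff: "p \<in> V \<longleftrightarrow> snd p \<in> linear_forms scale"
  by (cases p) (simp add: double_space_def)

sublocale complex_vector_set V sc
proof
  show "p + q \<in> V" if "p \<in> V" "q \<in> V" for p q
    using that by (auto simp: mem_V_iff linear_forms_iff algebra_simps)
  show "sc a p \<in> V" if "p \<in> V" for a p
    using that by (auto simp: mem_V_iff linear_forms_iff double_scale_def algebra_simps split: prod.splits)
qed

lemma GL_inv_mem: "w \<in> W \<Longrightarrow> inv\<^bsub>GL scale\<^esub> w \<in> carrier (GL scale)"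
  using subgroup.subset[OF W_subgroup] GL.inv_closed by blast

lemma linear_endo_double_act:
  assumes w: "w \<in> W"
  shows "linear_endo (double_act scale w)"
proof -
  have "w \<in> carrier (GL scale)" using w subgroup.subset[OF W_subgroup] by blast
  then have lw: "Vector_Spaces.linear scale scale w" by (simp add: GL_def)
  have li: "Vector_Spaces.linear scale scale (inv\<^bsub>GL scale\<^esub> w)"
    using GL_inv_mem[OF w] by (simp add: GL_def)
  show ?thesis
    unfolding linear_endo_def
  proof (intro conjI ballI allI)
    show "double_act scale w ` V \<subseteq> V"
      using li by (auto simp: mem_V_iff linear_forms_iff double_act_def Vector_Spaces.linear_iff)
    show "double_act scale w (p + q) = double_act scale w p + double_act scale w q" for p q
      using lw by (auto simp: double_act_def Vector_Spaces.linear_iff fun_eq_iff split: prod.splits)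
    show "double_act scale w (sc a p) = sc a (double_act scale w p)" for a p
      using lw by (cases p) (simp add: double_act_def double_scale_def Vector_Spaces.linear_iff fun_eq_iff)
  qed
qed

sublocale S: finite_group_ring_action T G "\<lambda>w. tensor_map V sc (double_act scale w)"
proof -
  have T: "T = tensor_algebra V sc" by (simp add: double_tensor_algebra_def)
  have one: "\<one>\<^bsub>G\<^esub> = id" "\<one>\<^bsub>GL scale\<^esub> = id" by (simp_all add: GL_def)
  show "finite_group_ring_action T G (\<lambda>w. tensor_map V sc (double_act scale w))"
    unfolding T
  proof (intro finite_group_ring_action.intro finite_group_ring_action_axioms.intro)
    show "ring (tensor_algebra V sc)" by (rule T.ring_axioms)
    show "Group.group G" by (rule G.group_axioms)
    show "finite (carrier G)" using finite_W by simp
    show "tensor_map V sc (double_act scale g) \<in> ring_hom (tensor_algebra V sc) (tensor_algebra V sc)"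
      if "g \<in> carrier G" for g
      using that by (intro tensor_map_ring_hom linear_endo_double_act) simp
    show "tensor_map V sc (double_act scale \<one>\<^bsub>G\<^esub>) a = a" if "a \<in> carrier (tensor_algebra V sc)" for a
    proof (rule tensor_map_id[OF _ that])
      have "inv\<^bsub>GL scale\<^esub> id = id" using GL.inv_one by (simp only: one)
      then show "double_act scale \<one>\<^bsub>G\<^esub> v = v" for v
        by (simp add: one double_act_def split: prod.splits)
    qed
    show "tensor_map V sc (double_act scale (g \<otimes>\<^bsub>G\<^esub> h)) a =
        tensor_map V sc (double_act scale g) (tensor_map V sc (double_act scale h) a)"
      if "g \<in> carrier G" "h \<in> carrier G" "a \<in> carrier (tensor_algebra V sc)" for g h a
    proof (rule tensor_map_comp[OF linear_endo_double_act linear_endo_double_act _ that(3)])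
      have "g \<in> carrier (GL scale)" "h \<in> carrier (GL scale)"
        using that subgroup.subset[OF W_subgroup] by auto
      \<comment> \<open>Precomposition with the inverse reverses the order twice, so the action on
        linear forms is again a left action.\<close>
      then have "inv\<^bsub>GL scale\<^esub> (g \<circ> h) = inv\<^bsub>GL scale\<^esub> h \<circ> inv\<^bsub>GL scale\<^esub> g"
        using GL.inv_mult_group[of g h] by (simp add: GL_def)
      then show "double_act scale (g \<otimes>\<^bsub>G\<^esub> h) v = double_act scale g (double_act scale h v)" for v
        by (simp add: double_act_def GL_def comp_assoc split: prod.splits)
    qed (use that in auto)
  qed
qed

lemma A_eq: "A = S.smash"
  by (simp add: double_smash_algebra_def)

sublocale A: ring A
  unfolding A_eq by (rule S.ring_smash)

abbreviation \<iota> :: "'v double_tensor \<Rightarrow> 'v double_smash" where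
  "\<iota> t \<equiv> smash_elem T G t id"

lemma iota_ring_hom: "\<iota> \<in> ring_hom T A"
  using S.smash_elem_ring_hom by (simp add: A_eq GL_def)

lemma smash_elem_in_A: "t \<in> carrier T \<Longrightarrow> smash_elem T G t g \<in> carrier A"
  unfolding A_eq by (rule S.smash_elem_closed)

lemma vec_in_V: "(y, 0) \<in> V" and form_in_V: "x \<in> linear_forms scale \<Longrightarrow> (0, x) \<in> V"
  using vs by (simp_all add: mem_V_iff linear_forms_iff)

lemma tensor_of_in_T: "p \<in> V \<Longrightarrow> tensor_of V sc p \<in> carrier T"
  and tensor_scalar_in_T: "tensor_scalar V sc a \<in> carrier T"
  unfolding double_tensor_algebra_def by (rule tensor_of_closed, assumption) (rule tensor_scalar_closed)

lemma smash_generators_closed: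
  "smash_vec scale W y \<in> carrier A" "smash_scalar scale W a \<in> carrier A" "smash_group scale W w \<in> carrier A"
  "x \<in> linear_forms scale \<Longrightarrow> smash_form scale W x \<in> carrier A"
  unfolding smash_vec_def smash_scalar_def smash_group_def smash_form_def
  by (intro smash_elem_in_A tensor_of_in_T tensor_scalar_in_T vec_in_V form_in_V S.A.one_closed; assumption?)+

lemma ring_commutator_closed:
  "a \<in> carrier A \<Longrightarrow> b \<in> carrier A \<Longrightarrow> ring_commutator A a b \<in> carrier A"
  by (simp add: ring_commutator_def)

context
  fixes c :: "('v \<Rightarrow> 'v) \<Rightarrow> complex" and \<alpha> :: "('v \<Rightarrow> 'v) \<Rightarrow> 'v \<Rightarrow> complex" and \<alpha>v :: "('v \<Rightarrow> 'v) \<Rightarrow> 'v"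
begin

abbreviation "I \<equiv> cherednik_ideal scale W c \<alpha> \<alpha>v"
abbreviation "H \<equiv> cherednik_algebra scale W c \<alpha> \<alpha>v"
abbreviation "\<eta> \<equiv> cherednik_scalar scale W c \<alpha> \<alpha>v"
abbreviation "vec \<equiv> cherednik_vec scale W c \<alpha> \<alpha>v"

text \<open>All three families of relations must first be seen to lie in the smash product. The
  second family, the commutators of vectors, is what makes the image of Sym \<hh>
  commutative.\<close>

lemma cherednik_ideal_is_ideal: "ideal I A"
  and vec_commutator_in_ideal: "ring_commutator A (smash_vec scale W y) (smash_vec scale W y') \<in> I"
proof -
  let ?X = "smash_form scale W" and ?Y = "smash_vec scale W" and ?k = "smash_scalar scale W"
  let ?g = "smash_group scale W"
  define R1 where "R1 = {ring_commutator A (?X x) (?X x') | x x'.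
      x \<in> linear_forms scale \<and> x' \<in> linear_forms scale}"
  define R2 where "R2 = {ring_commutator A (?Y y) (?Y y') | y y'. True}"
  define R3 where "R3 = {ring_commutator A (?Y y) (?X x) \<ominus>\<^bsub>A\<^esub>
      (?k (x y) \<ominus>\<^bsub>A\<^esub> finsum A (\<lambda>s. ?k (c s * \<alpha> s y * x (\<alpha>v s)) \<otimes>\<^bsub>A\<^esub> ?g s)
        (complex_reflections scale W)) | x y. x \<in> linear_forms scale}"
  have I: "I = genideal A (R1 \<union> R2 \<union> R3)"
    by (simp add: cherednik_ideal_def Let_def R1_def R2_def R3_def)
  have "R1 \<subseteq> carrier A" "R2 \<subseteq> carrier A"
    unfolding R1_def R2_def by (auto intro!: ring_commutator_closed smash_generators_closed)
  moreover have "R3 \<subseteq> carrier A"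
    unfolding R3_def
    by (auto intro!: A.minus_closed ring_commutator_closed smash_generators_closed A.finsum_closed)
  ultimately have R: "R1 \<union> R2 \<union> R3 \<subseteq> carrier A" by blast
  show "ideal I A" unfolding I by (rule A.genideal_ideal[OF R])
  have "ring_commutator A (?Y y) (?Y y') \<in> R2" unfolding R2_def by blast
  then show "ring_commutator A (?Y y) (?Y y') \<in> I" unfolding I using A.genideal_self[OF R] by blast
qed

text \<open>The composite of the embedding of the tensor algebra at the neutral element of
  \<open>W\<close> with the projection onto \<open>H\<close>. Scalars and vectors of
  \<open>H\<close> are its values, so additivity, scaling and commutation with scalars are inherited
  from the tensor algebra.\<close>

definition \<phi> :: "'v double_tensor \<Rightarrow> 'v double_smash set" where
  "\<phi> t = I +>\<^bsub>A\<^esub> \<iota> t"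

lemma phi_ring_hom: "\<phi> \<in> ring_hom T H"
  unfolding cherednik_algebra_def
  using ring_hom_trans[OF iota_ring_hom ideal.rcos_ring_hom[OF cherednik_ideal_is_ideal]]
  by (simp add: \<phi>_def[abs_def] comp_def)

lemma cherednik_ring: "ring H"
  unfolding cherednik_algebra_def by (rule ideal.quotient_is_ring[OF cherednik_ideal_is_ideal])

lemma eta_eq_phi: "\<eta> a = \<phi> (tensor_scalar V sc a)"
  by (simp add: cherednik_scalar_def smash_scalar_def \<phi>_def)

lemma vec_eq_phi: "vec y = \<phi> (tensor_of V sc (y, 0))"
  by (simp add: cherednik_vec_def smash_vec_def \<phi>_def)

lemmas phi_closed = ring_hom_closed[OF phi_ring_hom]
  and phi_add = ring_hom_add[OF phi_ring_hom]
  and phi_mult = ring_hom_mult[OF phi_ring_hom]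
  and phi_one = ring_hom_one[OF phi_ring_hom]

lemma eta_closed: "\<eta> a \<in> carrier H"
  unfolding eta_eq_phi by (rule phi_closed[OF tensor_scalar_in_T])

lemma vec_closed: "vec y \<in> carrier H"
  unfolding vec_eq_phi by (rule phi_closed[OF tensor_of_in_T[OF vec_in_V]])

lemma eta_add: "\<eta> (a + b) = \<eta> a \<oplus>\<^bsub>H\<^esub> \<eta> b"
  unfolding eta_eq_phi phi_add[OF tensor_scalar_in_T tensor_scalar_in_T, symmetric]
  by (simp add: tensor_scalar_add double_tensor_algebra_def)

lemma eta_mult: "\<eta> (a * b) = \<eta> a \<otimes>\<^bsub>H\<^esub> \<eta> b"
  unfolding eta_eq_phi phi_mult[OF tensor_scalar_in_T tensor_scalar_in_T, symmetric]
  by (simp add: tensor_scalar_mult double_tensor_algebra_def)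

lemma eta_one: "\<eta> 1 = \<one>\<^bsub>H\<^esub>"
  unfolding eta_eq_phi phi_one[symmetric] by (simp add: tensor_scalar_one double_tensor_algebra_def)

lemma vec_add: "vec (y + z) = vec y \<oplus>\<^bsub>H\<^esub> vec z"
  unfolding vec_eq_phi phi_add[OF tensor_of_in_T[OF vec_in_V] tensor_of_in_T[OF vec_in_V], symmetric]
  using tensor_of_add[OF vec_in_V vec_in_V, of y z] by (simp add: double_tensor_algebra_def)

lemma vec_scale: "vec (scale a y) = \<eta> a \<otimes>\<^bsub>H\<^esub> vec y"
proof -
  have "sc a (y, 0) = (scale a y, 0)" by (simp add: double_scale_def fun_eq_iff)
  then show ?thesis
    unfolding vec_eq_phi eta_eq_phi phi_mult[OF tensor_scalar_in_T tensor_of_in_T[OF vec_in_V], symmetric]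
    using tensor_of_scale[OF vec_in_V, of a y] by (simp add: double_tensor_algebra_def)
qed

lemma eta_vec_commute: "\<eta> a \<otimes>\<^bsub>H\<^esub> vec y = vec y \<otimes>\<^bsub>H\<^esub> \<eta> a"
  unfolding vec_eq_phi eta_eq_phi
    phi_mult[OF tensor_scalar_in_T tensor_of_in_T[OF vec_in_V], symmetric]
    phi_mult[OF tensor_of_in_T[OF vec_in_V] tensor_scalar_in_T, symmetric]
  using tensor_scalar_commute[OF vec_in_V, of a y] by (simp add: double_tensor_algebra_def)

lemma vec_commute: "vec y \<otimes>\<^bsub>H\<^esub> vec z = vec z \<otimes>\<^bsub>H\<^esub> vec y"
proof -
  let ?Y = "smash_vec scale W"
  interpret I: ideal I A by (rule cherednik_ideal_is_ideal)
  have mult: "vec y \<otimes>\<^bsub>H\<^esub> vec z = I +>\<^bsub>A\<^esub> (?Y y \<otimes>\<^bsub>A\<^esub> ?Y z)" for y z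
    using ring_hom_mult[OF I.rcos_ring_hom smash_generators_closed(1) smash_generators_closed(1)]
    by (simp add: cherednik_vec_def cherednik_algebra_def)
  have "?Y y \<otimes>\<^bsub>A\<^esub> ?Y z \<ominus>\<^bsub>A\<^esub> ?Y z \<otimes>\<^bsub>A\<^esub> ?Y y \<in> I"
    using vec_commutator_in_ideal[of y z] by (simp add: ring_commutator_def)
  then show ?thesis
    unfolding mult
    by (subst A.quotient_eq_iff_same_a_r_cos[OF I.ideal_axioms, symmetric])
      (simp_all add: smash_generators_closed)
qed

text \<open>The map from \<hh> to \<open>H\<close> is linear over the image of the scalars, so the
  images of a spanning set generate those of all vectors. This supplies the finite generating
  set.\<close>

lemma cherednik_sym_eq:
  assumes "module.span scale B = UNIV"
  shows "cherednik_sym scale W c \<alpha> \<alpha>v = generate_ring H (range \<eta> \<union> vec ` B)"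
proof -
  interpret vector_space scale by (rule vs)
  interpret H: ring H by (rule cherednik_ring)
  have c1: "range \<eta> \<union> vec ` B \<subseteq> carrier H" and c2: "range \<eta> \<union> range vec \<subseteq> carrier H"
    using eta_closed vec_closed by auto
  let ?K = "generate_ring H (range \<eta> \<union> vec ` B)"
  have "vec y \<in> ?K" for y
  proof -
    have "y \<in> span B" using assms by simp
    then show ?thesis
    proof (induction y rule: span_induct_alt)
      case base
      \<comment> \<open>Additivity alone makes \<open>vec 0\<close> idempotent under addition, hence
        zero.\<close>
      have "vec 0 \<oplus>\<^bsub>H\<^esub> vec 0 = vec 0" using vec_add[of 0 0] by simp
      then have "vec 0 = \<zero>\<^bsub>H\<^esub>" using vec_closed by (simp add: H.add.l_cancel_one)
      then show ?case using H.zero_in_generate by simp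
    next
      case (step a x y)
      have "vec (scale a x + y) = \<eta> a \<otimes>\<^bsub>H\<^esub> vec x \<oplus>\<^bsub>H\<^esub> vec y" by (simp add: vec_add vec_scale)
      then show ?case
        using step by (auto intro!: generate_ring.eng_add generate_ring.eng_mult intro: generate_ring.incl)
    qed
  qed
  then have "range \<eta> \<union> range vec \<subseteq> ?K" by (auto intro: generate_ring.incl)
  then have "generate_ring H (range \<eta> \<union> range vec) \<subseteq> ?K"
    by (rule H.generate_ring_min_subring1[OF c2 H.generate_ring_is_subring[OF c1]])
  moreover have "?K \<subseteq> generate_ring H (range \<eta> \<union> range vec)"
    by (rule H.mono_generate_ring[OF _ c2]) auto
  ultimately show ?thesis by (simp add: cherednik_sym_def)
qed

end
end

theorem theorem3p22:
  fixes scale :: "complex \<Rightarrow> 'v::ab_group_add \<Rightarrow> 'v"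
    and Basis :: "'v set"
    and W :: "('v \<Rightarrow> 'v) set"
    and c :: "('v \<Rightarrow> 'v) \<Rightarrow> complex"
    and \<alpha> :: "('v \<Rightarrow> 'v) \<Rightarrow> 'v \<Rightarrow> complex"
    and \<alpha>v :: "('v \<Rightarrow> 'v) \<Rightarrow> 'v"
  defines "S \<equiv> complex_reflections scale W"
    and "H \<equiv> cherednik_algebra scale W c \<alpha> \<alpha>v"
    and "\<eta> \<equiv> cherednik_scalar scale W c \<alpha> \<alpha>v"
    and "\<Gamma> \<equiv> cherednik_sym scale W c \<alpha> \<alpha>v"
  assumes "finite_dimensional_vector_space scale Basis"
    and "complex_reflection_group scale W"
    and "\<forall>s\<in>S. \<forall>w\<in>W. c (w \<circ> s \<circ> inv\<^bsub>GL scale\<^esub> w) = c s"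
    and "\<forall>s\<in>S. \<alpha> s \<in> linear_forms scale \<and> \<alpha> s \<noteq> 0 \<and> (\<forall>v. s v = v \<longrightarrow> \<alpha> s v = 0)"
    and "\<forall>s\<in>S. \<alpha>v s \<noteq> 0 \<and> (\<exists>l. l \<noteq> 1 \<and> s (\<alpha>v s) = scale l (\<alpha>v s)) \<and>
           \<alpha> s (\<alpha>v s) = 2"
  shows "(category_O H \<eta> \<Gamma> :: ('v double_smash set, 'm) module set) =
         harish_chandra_modules H \<eta> \<Gamma>"
proof -
  interpret h: finite_dimensional_vector_space scale Basis by fact
  interpret finite_linear_group scale W
    using assms(6) h.vector_space_axioms
    by (simp add: finite_linear_group_def complex_reflection_group_def)
  show ?thesis
    unfolding H_def \<eta>_def \<Gamma>_def
  \<comment> \<open>The finite generating set \<open>Y\<close> is the image of the given basis of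
    \<hh>; the goals left to the end are commutation among its elements and with the
    scalars.\<close>
  proof (rule category_O_eq_harish_chandra_modules[OF cherednik_ring eta_closed eta_add eta_mult eta_one])
    show "finite (cherednik_vec scale W c \<alpha> \<alpha>v ` Basis)" using h.finite_Basis by simp
    show "cherednik_vec scale W c \<alpha> \<alpha>v ` Basis \<subseteq> carrier (cherednik_algebra scale W c \<alpha> \<alpha>v)"
      using vec_closed by blast
    show "cherednik_sym scale W c \<alpha> \<alpha>v = generate_ring (cherednik_algebra scale W c \<alpha> \<alpha>v)
        (range (cherednik_scalar scale W c \<alpha> \<alpha>v) \<union> cherednik_vec scale W c \<alpha> \<alpha>v ` Basis)"
      by (rule cherednik_sym_eq[OF h.span_Basis])
  qed (auto simp: vec_commute eta_vec_commute)
qed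

end
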